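(* Let $k$ be an algebraically closed field of characteristic $0$, let $s_1,s_2\in k$ with $27-18s_1s_2-s_1^2s_2^2+4s_1^3+4s_2^3\neq 0$, and let $K=k(X,Y)$ be the genus $2$ field given by $Y^2=X^6-s_1X^4+s_2X^2-1$. Put $u=s_1s_2$ and $v=s_1^3+s_2^3$, and let $E_1=k(X^2,Y)$ and $E_2=k(X^2,XY)$ be its paired degree $2$ elliptic subfields. Then there is an isogeny of degree $3$ between $E_1$ and $E_2$ if and only if $$(4v-u^2+110u-1125)\cdot g_1(u,v)\cdot g_2(u,v)=0,$$ where $$\begin{aligned} g_1={}&-27008u^6+256u^7-2432u^5v+v^4+7296u^3v^2-6692v^3u-1755067500u\\ &+2419308v^3-34553439u^4+127753092vu^2+16274844vu^3-1720730u^2v^2\\ &-1941120u^5+381631500v+1018668150u^2-116158860u^3+52621974v^2\\ &+387712u^4v-483963660vu-33416676v^2u+922640625, \end{aligned}$$ $$\begin{aligned} g_2={}&291350448u^6-v^4u^2-998848u^6v-3456u^7v+4749840u^4v^2+17032u^5v^2\\ &+4v^5+80368u^8+256u^9+6848224u^7-10535040v^3u^2-35872v^3u^3+26478v^4u\\ &-77908736u^5v+9516699v^4+307234984u^3v^2-419583744v^3u-826436736v^3\\ &+27502903296u^4+28808773632vu^2-23429955456vu^3+5455334016u^2v^2\\ &-41278242816v+82556485632u^2-108737593344u^3-12123095040v^2\\ &+41278242816vu+3503554560v^2u+5341019904u^5-2454612480u^4v . \end{aligned}$$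
   Context: Elliptic subfields are identified with the corresponding elliptic curves over $k$; an isogeny of degree $3$ between two elliptic curves exists if and only if their $j$-invariants satisfy $\Phi_3(j_1,j_2)=0$, where $\Phi_3$ is the classical modular polynomial of level 3. *)

theory Defs
  imports Complex_Main "HOL-Computational_Algebra.Polynomial"
begin

text \<open>
  All fields containing the base field \<open>k\<close> live inside one ambient field; \<open>k\<close> is a type of its own,
  embedded by \<open>\<iota>\<close>.
\<close>

definition is_subfield :: "'a::field set \<Rightarrow> bool" where
  "is_subfield F \<longleftrightarrow> 0 \<in> F \<and> 1 \<in> F \<and>
     (\<forall>x\<in>F. \<forall>y\<in>F. x + y \<in> F \<and> x * y \<in> F) \<and>
     (\<forall>x\<in>F. - x \<in> F \<and> inverse x \<in> F)"

definition field_hom_on :: "'a::field set \<Rightarrow> ('a \<Rightarrow> 'b::field) \<Rightarrow> bool" where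
  "field_hom_on F h \<longleftrightarrow> h 1 = 1 \<and>
     (\<forall>x\<in>F. \<forall>y\<in>F. h (x + y) = h x + h y \<and> h (x * y) = h x * h y)"

definition adjoin :: "('k::field \<Rightarrow> 'a::field) \<Rightarrow> 'a set \<Rightarrow> 'a set" where
  "adjoin \<iota> S = is_subfield hull (range \<iota> \<union> S)"

definition transcendental_over :: "('k::field \<Rightarrow> 'a::field) \<Rightarrow> 'a \<Rightarrow> bool" where
  "transcendental_over \<iota> x \<longleftrightarrow> (\<forall>p::'k poly. p \<noteq> 0 \<longrightarrow> poly (map_poly \<iota> p) x \<noteq> 0)"

text \<open>\<open>[E : F] = n\<close>: there is an \<open>F\<close>-basis \<open>b 0, \<dots>, b (n - 1)\<close> of \<open>E\<close>.\<close>

definition has_degree :: "'a::field set \<Rightarrow> 'a set \<Rightarrow> nat \<Rightarrow> bool" where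
  "has_degree E F n \<longleftrightarrow> F \<subseteq> E \<and>
     (\<exists>b::nat \<Rightarrow> 'a. (\<forall>i<n. b i \<in> E) \<and>
        (\<forall>z\<in>E. \<exists>!c::nat \<Rightarrow> 'a.
           (\<forall>i<n. c i \<in> F) \<and> (\<forall>i\<ge>n. c i = 0) \<and> z = (\<Sum>i<n. c i * b i)))"

text \<open>
  The points of the smooth projective curve over the algebraically closed field \<open>k\<close> with function
  field \<open>E\<close> are the places of \<open>E/k\<close>, each given here by its valuation ring (the local ring of the
  point).
\<close>

definition is_point :: "('k::field \<Rightarrow> 'a::field) \<Rightarrow> 'a set \<Rightarrow> 'a set \<Rightarrow> bool" where
  "is_point \<iota> E V \<longleftrightarrow> range \<iota> \<subset> V \<and> V \<subset> E \<and>
     (\<forall>x\<in>V. \<forall>y\<in>V. x + y \<in> V \<and> x - y \<in> V \<and> x * y \<in> V) \<and>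
     (\<forall>z\<in>E. z \<in> V \<or> inverse z \<in> V)"

text \<open>
  An elliptic curve is a pair \<open>(E, V)\<close> of an elliptic function field and a point (the origin).
  A nonconstant morphism from the curve of \<open>E\<close> to the curve of \<open>F\<close> is a \<open>k\<close>-embedding
  \<open>\<phi>\<close> of \<open>F\<close> into \<open>E\<close> (its comorphism); it sends the point \<open>V\<close> to the point
  \<open>{z \<in> F. \<phi> z \<in> V}\<close>, and its degree is \<open>[E : \<phi>(F)]\<close>. An isogeny \<open>(E, V) \<rightarrow> (F, W)\<close> is
  a nonconstant morphism that preserves the origins.
\<close>

definition is_isogeny ::
  "('k::field \<Rightarrow> 'a::field) \<Rightarrow> 'a set \<times> 'a set \<Rightarrow> 'a set \<times> 'a set \<Rightarrow> ('a \<Rightarrow> 'a) \<Rightarrow> bool" where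
  "is_isogeny \<iota> = (\<lambda>(E, V) (F, W) \<phi>.
     field_hom_on F \<phi> \<and> (\<forall>a. \<phi> (\<iota> a) = \<iota> a) \<and> \<phi> ` F \<subseteq> E \<and> {z\<in>F. \<phi> z \<in> V} = W)"

definition exists_isogeny_of_degree ::
  "('k::field \<Rightarrow> 'a::field) \<Rightarrow> 'a set \<times> 'a set \<Rightarrow> 'a set \<times> 'a set \<Rightarrow> nat \<Rightarrow> bool" where
  "exists_isogeny_of_degree \<iota> C D n \<longleftrightarrow>
     (\<exists>\<phi>. is_isogeny \<iota> C D \<phi> \<and> has_degree (fst C) (\<phi> ` fst D) n)"

definition g1 :: "'k::comm_ring_1 \<Rightarrow> 'k \<Rightarrow> 'k" where
  "g1 u v =
     - 27008*u^6 + 256*u^7 - 2432*u^5*v + v^4 + 7296*u^3*v^2 - 6692*v^3*u - 1755067500*u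
     + 2419308*v^3 - 34553439*u^4 + 127753092*v*u^2 + 16274844*v*u^3 - 1720730*u^2*v^2
     - 1941120*u^5 + 381631500*v + 1018668150*u^2 - 116158860*u^3 + 52621974*v^2
     + 387712*u^4*v - 483963660*v*u - 33416676*v^2*u + 922640625"

definition g2 :: "'k::comm_ring_1 \<Rightarrow> 'k \<Rightarrow> 'k" where
  "g2 u v =
     291350448*u^6 - v^4*u^2 - 998848*u^6*v - 3456*u^7*v + 4749840*u^4*v^2 + 17032*u^5*v^2
     + 4*v^5 + 80368*u^8 + 256*u^9 + 6848224*u^7 - 10535040*v^3*u^2 - 35872*v^3*u^3 + 26478*v^4*u
     - 77908736*u^5*v + 9516699*v^4 + 307234984*u^3*v^2 - 419583744*v^3*u - 826436736*v^3
     + 27502903296*u^4 + 28808773632*v*u^2 - 23429955456*v*u^3 + 5455334016*u^2*v^2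
     - 41278242816*v + 82556485632*u^2 - 108737593344*u^3 - 12123095040*v^2
     + 41278242816*v*u + 3503554560*v^2*u + 5341019904*u^5 - 2454612480*u^4*v"

end

theory Submission
  imports Defs
begin

text \<open>
  The two quotient curves are \<open>E\<^sub>1: y\<^sup>2 = x\<^sup>3 - s\<^sub>1 x\<^sup>2 + s\<^sub>2 x - 1\<close> and, with
  \<open>x = 1/X\<^sup>2\<close> and \<open>y = sqrt(-1) Y/X\<^sup>3\<close>, \<open>E\<^sub>2: y\<^sup>2 = x\<^sup>3 - s\<^sub>2 x\<^sup>2 + s\<^sub>1 x - 1\<close>. Move the given origins to infinity. An isogeny
  is then an embedding \<open>x\<^sub>2 \<mapsto> R\<close>, \<open>y\<^sub>2 \<mapsto> S\<close> with a pole at infinity. The line through the point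
  \<open>(R, S)\<close> and its conjugate under \<open>y \<mapsto> -y\<close> meets \<open>E\<^sub>2\<close> in a third point over \<open>k(x)\<close>, which is
  constant by a Wronskian argument; since both points are near infinity, the line must be vertical,
  so \<open>R = p/q\<close> lies in \<open>k(x)\<close> and \<open>S = G y\<close>. The degree of the isogeny is \<open>deg p\<close>. For degree 3
  the same Wronskian argument turns \<open>f\<^sub>1 G\<^sup>2 = f\<^sub>2(R)\<close> into the equation of an invariant differential,
  whose coefficients force the normal form: after a translation, \<open>E\<^sub>1\<close> is
  \<open>y\<^sup>2 = x\<^sup>3 + (l x + m)\<^sup>2\<close> and \<open>E\<^sub>2\<close> is the quotient by \<open>(0, \<plusminus>m)\<close>. In terms of the parameter
  \<open>h = 4 l\<^sup>3/m - 27\<close> of \<open>X\<^sub>0(3)\<close> this means \<open>j\<^sub>1 = (h + 27) (h + 3)\<^sup>3/h\<close> and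
  \<open>j\<^sub>2 = (h + 27) (h + 243)\<^sup>3/h\<^sup>3\<close>, which is equivalent to \<open>\<Phi>\<^sub>3(j\<^sub>1, j\<^sub>2) = 0\<close>, and
  \<open>\<Phi>\<^sub>3(j\<^sub>1, j\<^sub>2)\<close> is the product of the three factors divided by the sixth power of the
  discriminant, up to a power of 2.
\<close>

section \<open>The modular polynomial of level 3\<close>

text \<open>An isogeny here is only an embedding of function fields compatible with two valuation
  rings, so no group law, local parameter or discrete valuation is at hand. This is why the argument
  is pushed down to polynomials in \<open>x\<close>, where degrees, parity and divisibility take the
  place of orders of zeros and poles. The inversion \<open>x = 1/X^2\<close> has a simple origin:
  with \<open>t = X^2\<close>, the square of \<open>X * Y\<close> is \<open>t\<close> times a cubic
  in \<open>t\<close>, a quartic with the root 0, and sending this root to infinity leaves a cubic.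
  It is the first cubic reversed, hence the exchange of \<open>s1\<close> and \<open>s2\<close> and
  the common discriminant, minus the quantity assumed nonzero. The variables \<open>u\<close> and
  \<open>v\<close> generate the invariants of two symmetries: exchanging the curves swaps
  \<open>s1\<close> and \<open>s2\<close>, and multiplying \<open>t\<close> by a cube root of unity
  multiplies \<open>s1\<close> and \<open>s2\<close> by inverse cube roots of unity. Since the
  modular polynomial is symmetric, its value at the two j-invariants is a rational function of
  \<open>u\<close> and \<open>v\<close>.\<close>

definition cubic_disc :: "'k::comm_ring_1 \<Rightarrow> 'k \<Rightarrow> 'k \<Rightarrow> 'k" where
  "cubic_disc a b c = 18*a*b*c - 4*a^3*c + a^2*b^2 - 4*b^3 - 27*c^2"

definition Phi3 :: "'k::comm_ring_1 \<Rightarrow> 'k \<Rightarrow> 'k" where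
  "Phi3 x y = x^4 + y^4 - x^3*y^3 + 2232*x^2*y^2*(x + y) - 1069956*x*y*(x^2 + y^2)
     + 36864000*(x^3 + y^3) + 2587918086*x^2*y^2 + 8900222976000*x*y*(x + y)
     + 452984832000000*(x^2 + y^2) - 770845966336000000*x*y + 1855425871872000000000*(x + y)"

text \<open>The arguments of \<open>Phi3\<close> are the j-invariants,
  \<open>256 (a^2 - 3 b)^3\<close> divided by the discriminant of the cubic. By symmetry only the
  sum \<open>S\<close> and the product \<open>P\<close> of the two cubes enter, and both are
  polynomials in \<open>u\<close> and \<open>v\<close>. The constant is \<open>256^4\<close>; the
  exponent 6 is forced by the term \<open>x^3 y^3\<close>.\<close>

lemma Phi3_eq_factors:
  fixes s1 s2 :: "'k::field_char_0"
  assumes D: "27 - 18*s1*s2 - s1^2*s2^2 + 4*s1^3 + 4*s2^3 = - D" "D \<noteq> 0"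
    and u: "u = s1 * s2" and v: "v = s1^3 + s2^3"
  shows "Phi3 (256 * (s1^2 - 3*s2)^3 / D) (256 * (s2^2 - 3*s1)^3 / D) * D^6
           = 4294967296 * ((4*v - u^2 + 110*u - 1125) * g1 u v * g2 u v)"
proof -
  define m where "m = (s1^2 - 3*s2)^3"
  define n where "n = (s2^2 - 3*s1)^3"
  define S where "S = v^2 - 2*u^3 - 9*u*v + 54*u^2 - 27*v"
  define P where "P = (u^2 - 3*v + 9*u)^3"
  have S: "m + n = S" unfolding m_def n_def S_def u v by algebra
  have P: "m * n = P" unfolding m_def n_def P_def u v by algebra
  have Du: "D = u^2 + 18*u - 4*v - 27" using D(1) unfolding u v by algebra
  have "Phi3 (256 * m / D) (256 * n / D) * D^6 = 4294967296 *
    ((m^4 + n^4)*D^2 - 65536*m^3*n^3 + 571392*m^2*n^2*(m+n)*D - 1069956*m*n*(m^2+n^2)*D^2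
    + 144000*(m^3+n^3)*D^3 + 2587918086*m^2*n^2*D^2 + 34766496000*m*n*(m+n)*D^3
    + 6912000000*(m^2+n^2)*D^4 - 11762176000000*m*n*D^4 + 110592000000000*(m+n)*D^5)"
    using D(2) unfolding Phi3_def by (simp add: divide_simps) algebra
  \<comment> \<open>Every symmetric expression in \<open>m\<close> and \<open>n\<close> is rewritten
    through \<open>S\<close> and \<open>P\<close>, so that the last identity involves only the
    variables \<open>u\<close> and \<open>v\<close>.\<close>
  also have "(m^4 + n^4)*D^2 - 65536*m^3*n^3 + 571392*m^2*n^2*(m+n)*D - 1069956*m*n*(m^2+n^2)*D^2
    + 144000*(m^3+n^3)*D^3 + 2587918086*m^2*n^2*D^2 + 34766496000*m*n*(m+n)*D^3
    + 6912000000*(m^2+n^2)*D^4 - 11762176000000*m*n*D^4 + 110592000000000*(m+n)*D^5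
    = (S^4 - 4*S^2*P + 2*P^2)*D^2 - 65536*P^3 + 571392*P^2*S*D - 1069956*P*(S^2 - 2*P)*D^2
    + 144000*(S^3 - 3*S*P)*D^3 + 2587918086*P^2*D^2 + 34766496000*P*S*D^3
    + 6912000000*(S^2 - 2*P)*D^4 - 11762176000000*P*D^4 + 110592000000000*S*D^5"
    unfolding S[symmetric] P[symmetric] by algebra
  also have "\<dots> = (4*v - u^2 + 110*u - 1125) * g1 u v * g2 u v"
    unfolding S_def P_def Du g1_def g2_def by algebra
  finally show ?thesis unfolding m_def n_def .
qed

text \<open>The classical parametrization of the modular curve of level 3 by
  \<open>h = (eta(tau) / eta(3 tau))^12\<close>, with \<open>x = j(3 tau)\<close> and
  \<open>y = j(tau)\<close>. The factor \<open>h^12\<close> clears all denominators;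
  \<open>y^4\<close> and \<open>x^3 y^3\<close> both require it.\<close>

lemma Phi3_parametrization:
  fixes h x y :: "'k::field_char_0"
  assumes "h \<noteq> 0" and x: "x * h = (h + 27) * (h + 3)^3" and y: "y * h^3 = (h + 27) * (h + 243)^3"
  shows "Phi3 x y = 0"
proof -
  define a where "a = (h + 27) * (h + 3)^3"
  define b where "b = (h + 27) * (h + 243)^3"
  have ab: "x * h = a" "y * h^3 = b" using x y by (simp_all add: a_def b_def)
  have "Phi3 x y * h^12 = a^4*h^8 + b^4 - a^3*b^3 + 2232*a^2*b^2*h*(a*h^2 + b)
     - 1069956*a*b*h^2*(a^2*h^4 + b^2) + 36864000*h^3*(a^3*h^6 + b^3) + 2587918086*a^2*b^2*h^4
     + 8900222976000*a*b*h^5*(a*h^2 + b) + 452984832000000*h^6*(a^2*h^4 + b^2)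
     - 770845966336000000*a*b*h^8 + 1855425871872000000000*h^9*(a*h^2+b)"
    unfolding ab[symmetric] Phi3_def by algebra
  also have "\<dots> = 0" unfolding a_def b_def by algebra
  finally show ?thesis using \<open>h \<noteq> 0\<close> by simp
qed

text \<open>Vieta's formulas with roots listed by multiplicity, so that power sums over the list
  stay correct when roots coincide.\<close>

lemma monic_quartic_roots:
  fixes c0 c1 c2 c3 :: "'k::alg_closed_field"
  obtains r1 r2 r3 r4 where
    "c3 = - (r1 + r2 + r3 + r4)"
    "c2 = r1*r2 + r1*r3 + r1*r4 + r2*r3 + r2*r4 + r3*r4"
    "c1 = - (r1*r2*r3 + r1*r2*r4 + r1*r3*r4 + r2*r3*r4)"
    "c0 = r1*r2*r3*r4"
proof -
  let ?p = "[:c0, c1, c2, c3, 1:]"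
  obtain A where A: "size A = degree ?p" "?p = smult (lead_coeff ?p) (\<Prod>x\<in>#A. [:-x, 1:])"
    using alg_closed_imp_factorization[of ?p] by auto
  have "size A = Suc (Suc (Suc (Suc 0)))" using A(1) by simp
  then obtain r1 B1 where B1: "A = add_mset r1 B1" "size B1 = Suc (Suc (Suc 0))"
    by (metis size_eq_Suc_imp_eq_union size_add_mset nat.inject)
  then obtain r2 B2 where B2: "B1 = add_mset r2 B2" "size B2 = Suc (Suc 0)"
    by (metis size_eq_Suc_imp_eq_union size_add_mset nat.inject)
  then obtain r3 B3 where B3: "B2 = add_mset r3 B3" "size B3 = Suc 0"
    by (metis size_eq_Suc_imp_eq_union size_add_mset nat.inject)
  then obtain r4 where "B3 = {#r4#}"
    by (metis size_eq_Suc_imp_eq_union size_add_mset nat.inject size_eq_0_iff_empty)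
  with B1 B2 B3 have "A = {#r1, r2, r3, r4#}" by simp
  with A(2) have "?p = [:-r1, 1:] * ([:-r2, 1:] * ([:-r3, 1:] * [:-r4, 1:]))"
    by simp
  then show ?thesis by (intro that[of r1 r2 r3 r4]) (simp_all add: algebra_simps)
qed

text \<open>In characteristic 0 the factors 2, 3 and 4 in Newton's identities can be cancelled, so
  four power sums determine the quartic. This avoids expanding elementary symmetric functions of
  complicated root expressions.\<close>

lemma newton_product_4:
  fixes x1 x2 x3 x4 z :: "'k::field_char_0"
  assumes p: "\<And>k. p k = x1^k + x2^k + x3^k + x4^k"
    and e: "p 1 = e1" "p 2 = e1 * p 1 - 2 * e2" "p 3 = e1 * p 2 - e2 * p 1 + 3 * e3"
      "p 4 = e1 * p 3 - e2 * p 2 + e3 * p 1 - 4 * e4"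
  shows "(z - x1) * (z - x2) * (z - x3) * (z - x4) = z^4 - e1*z^3 + e2*z^2 - e3*z + e4"
proof -
  have e1: "e1 = x1 + x2 + x3 + x4" using e(1) by (simp add: p)
  have "2 * e2 = 2 * (x1*x2 + x1*x3 + x1*x4 + x2*x3 + x2*x4 + x3*x4)"
    using e(2) unfolding p e1 by algebra
  hence e2: "e2 = x1*x2 + x1*x3 + x1*x4 + x2*x3 + x2*x4 + x3*x4" by (metis mult_cancel_left zero_neq_numeral)
  have "3 * e3 = 3 * (x1*x2*x3 + x1*x2*x4 + x1*x3*x4 + x2*x3*x4)"
    using e(3) unfolding p e1 e2 by algebra
  hence e3: "e3 = x1*x2*x3 + x1*x2*x4 + x1*x3*x4 + x2*x3*x4" by (metis mult_cancel_left zero_neq_numeral)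
  have "4 * e4 = 4 * (x1*x2*x3*x4)"
    using e(4) unfolding p e1 e2 e3 by algebra
  hence e4: "e4 = x1*x2*x3*x4" by (metis mult_cancel_left zero_neq_numeral)
  show ?thesis unfolding e1 e2 e3 e4 by algebra
qed

text \<open>
  For fixed \<open>x\<close>, the four solutions \<open>h\<close> of \<open>x h = (h + 27) (h + 3)\<^sup>3\<close> give the four roots
  of \<open>\<Phi>\<^sub>3(x, \<cdot>)\<close> with the right multiplicities: the power sums of these values are
  compared with the coefficients via Newton's identities. The substitution \<open>h = 729 / g\<close> (the
  Fricke involution) makes the values Laurent polynomials in \<open>g\<close> with few poles.
\<close>
lemma Phi3_zero_parametrization:
  fixes x y :: "'k::{alg_closed_field, field_char_0}"
  assumes "Phi3 x y = 0"
  obtains h where "h \<noteq> 0" "x * h = (h + 27) * (h + 3)^3" "y * h^3 = (h + 27) * (h + 243)^3"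
proof -
  \<comment> \<open>The quartic is \<open>(g + 27) (g + 243)^3 - x g^3\<close>, which is the
    equation \<open>x h = (h + 27) (h + 3)^3\<close> after \<open>h = 729 / g\<close>.\<close>
  obtain r1 r2 r3 r4 where r:
    "756 - x = - (r1 + r2 + r3 + r4)"
    "196830 = r1*r2 + r1*r3 + r1*r4 + r2*r3 + r2*r4 + r3*r4"
    "19131876 = - (r1*r2*r3 + r1*r2*r4 + r1*r3*r4 + r2*r3*r4)"
    "387420489 = r1*r2*r3*r4"
    by (rule monic_quartic_roots)
  have nz: "r1 \<noteq> 0" "r2 \<noteq> 0" "r3 \<noteq> 0" "r4 \<noteq> 0" using r(4) by auto
  define R where "R = {r1, r2, r3, r4}"
  have quart: "g^4 = (x - 756)*g^3 - 196830*g^2 - 19131876*g - 387420489" if "g \<in> R" for g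
  proof -
    have "(g - r1) * (g - r2) * (g - r3) * (g - r4) = 0" using that by (auto simp: R_def)
    thus ?thesis using r by algebra
  qed
  define s where "s k = r1^k + r2^k + r3^k + r4^k" for k
  define t where "t k = inverse r1^k + inverse r2^k + inverse r3^k + inverse r4^k" for k
  have x: "r1 + r2 + r3 + r4 = x - 756" using r(1) by algebra
  have s0: "s 0 = 4" by (simp add: s_def)
  have s1: "s 1 = x - 756" using x by (simp add: s_def)
  have s2: "s 2 = x^2 - 1512*x + 177876"
  proof -
    have "s 2 = (x - 756) * s 1 - 2 * 196830" unfolding s1 r(2) x[symmetric] s_def by algebra
    thus ?thesis unfolding s1 by algebra
  qed
  have s3: "s 3 = x^3 - 2268*x^2 + 1124118*x - 43066404"
  proof -
    have "s 3 = (x - 756) * s 2 - 196830 * s 1 - 3 * 19131876"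
      unfolding s1 r(2) r(3) x[symmetric] s_def by algebra
    thus ?thesis unfolding s1 s2 by algebra
  qed
  have srec: "s (k + 4) = (x - 756) * s (k + 3) - 196830 * s (k + 2) - 19131876 * s (k + 1) - 387420489 * s k" for k
  proof -
    have "g^(k+4) = (x - 756)*g^(k+3) - 196830*g^(k+2) - 19131876*g^(k+1) - 387420489*g^k" if "g \<in> R" for g
      using arg_cong[OF quart[OF that], of "\<lambda>z. g^k * z"] by (simp add: power_add power2_eq_square algebra_simps)
    from this[of r1] this[of r2] this[of r3] this[of r4] show ?thesis
      unfolding s_def R_def by (simp only: insert_iff simp_thms) (simp only: algebra_simps)
  qed
  have "s 4 = (x - 756) * s 3 - 196830 * s 2 - 19131876 * s 1 - 387420489 * s 0"
    using srec[of 0] by (simp add: eval_nat_numeral)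
  hence s4: "s 4 = x^4 - 3024*x^3 + 2641896*x^2 - 614424528*x + 10460884644"
    unfolding s0 s1 s2 s3 by algebra
  have "s 5 = (x - 756) * s 4 - 196830 * s 3 - 19131876 * s 2 - 387420489 * s 1"
    using srec[of 1] by (simp add: eval_nat_numeral)
  hence s5: "s 5 = x^5 - 3780*x^4 + 4731210*x^3 - 2184419340*x^2 + 282245657895*x - 2541880177236"
    unfolding s1 s2 s3 s4 by algebra
  have "s 6 = (x - 756) * s 5 - 196830 * s 4 - 19131876 * s 3 - 387420489 * s 2"
    using srec[of 2] by (simp add: eval_nat_numeral)
  hence s6: "s 6 = x^6 - 4536*x^5 + 7392060*x^4 - 5185132056*x^3 + 1456665963534*x^2 - 115903124105616*x
      + 617673783704436"
    unfolding s2 s3 s4 s5 by algebra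
  have "s 7 = (x - 756) * s 6 - 196830 * s 5 - 19131876 * s 4 - 387420489 * s 3"
    using srec[of 3] by (simp add: eval_nat_numeral)
  hence s7: "s 7 = x^7 - 5292*x^6 + 10624446*x^5 - 10048643892*x^4 + 4502849106105*x^3 - 836849090852964*x^2
      + 44005610299878108*x - 150094645757352324"
    unfolding s3 s4 s5 s6 by algebra
  have "s 8 = (x - 756) * s 7 - 196830 * s 6 - 19131876 * s 5 - 387420489 * s 4"
    using srec[of 4] by (simp add: eval_nat_numeral)
  hence s8: "s 8 = x^8 - 6048*x^7 + 14428368*x^6 - 17207036064*x^5 + 10716575789448*x^4 - 3309758835977088*x^3
      + 430716476686996368*x^2 - 15766972392051011520*x + 36472996659600322884"
    unfolding s4 s5 s6 s7 by algebra
  have "s 9 = (x - 756) * s 8 - 196830 * s 7 - 19131876 * s 6 - 387420489 * s 5"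
    using srec[of 5] by (simp add: eval_nat_numeral)
  hence s9: "s 9 = x^9 - 6804*x^8 + 18803826*x^7 - 27092389788*x^6 + 21720280116699*x^5 - 9573575081393556*x^4
      + 2143966702978283112*x^3 - 203694085993700514132*x^2 + 5402776297326605639325*x
      - 8862938127278098580916"
    unfolding s5 s6 s7 s8 by algebra
  have "s 10 = (x - 756) * s 9 - 196830 * s 8 - 19131876 * s 7 - 387420489 * s 6"
    using srec[of 6] by (simp add: eval_nat_numeral)
  hence s10: "s 10 = x^10 - 7560*x^9 + 23750820*x^8 - 40136786280*x^7 + 39463049590290*x^6 - 22808754185243472*x^5
      + 7461631425284745660*x^4 - 1257212206107958923360*x^3 + 90063731999272342242015*x^2
      - 1786955277522756703433400*x + 2153693963281448898405396"
    unfolding s6 s7 s8 s9 by algebra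
  have "s 11 = (x - 756) * s 10 - 196830 * s 9 - 19131876 * s 8 - 387420489 * s 7"
    using srec[of 7] by (simp add: eval_nat_numeral)
  hence s11: "s 11 = x^11 - 8316*x^10 + 29269350*x^9 - 56772306756*x^8 + 66220625111949*x^7 - 47584216111761252*x^6
      + 20754933606198248292*x^5 - 5214973928970428756100*x^4 + 680096593306911397838958*x^3
      - 37698231461967619826842152*x^2 + 574266510806710853539172754*x
      - 523347633032919597780067044"
    unfolding s7 s8 s9 s10 by algebra
  have "s 12 = (x - 756) * s 11 - 196830 * s 10 - 19131876 * s 9 - 387420489 * s 8"
    using srec[of 8] by (simp add: eval_nat_numeral)
  hence s12: "s 12 = x^12 - 9072*x^11 + 35359416*x^10 - 77431032432*x^9 + 104595400982700*x^8 - 90104294401142400*x^7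
      + 49473827332414624440*x^6 - 16825139996526627153120*x^5 + 3332952600470916964583742*x^4
      - 344130014196566110674067680*x^3 + 15077066733783838103813914896*x^2
      - 180199220550115970933042137488*x + 127173474825798705178180298724"
    unfolding s8 s9 s10 s11 by algebra
  \<comment> \<open>This is \<open>(g + 27) (g + 3)^3 / g\<close>, the value of \<open>y\<close>
    belonging to \<open>h = 729 / g\<close>. Its pole at 0 is simple, so the fourth power sum
    \<open>p 4\<close> needs inverse powers only up to the fourth.\<close>
  define w :: "'k \<Rightarrow> 'k" where "w g = g^3 + 36*g^2 + 270*g + 756 + 729*inverse g" for g
  define p where "p k = w r1^k + w r2^k + w r3^k + w r4^k" for k
  have inv: "g * inverse g = 1" if "g \<in> R" for g using that nz by (auto simp: R_def)
  \<comment> \<open>The quartic divided by \<open>g\<close>, \<open>g^2\<close>, \<open>g^3\<close>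
    and \<open>g^4\<close>; summed over the roots, these equations run the recursion of the power
    sums downwards to negative exponents.\<close>
  have trec: "g^3 = (x - 756)*g^2 - 196830*g - 19131876 - 387420489*q"
    "g^2 = (x - 756)*g - 196830 - 19131876*q - 387420489*q^2"
    "g = (x - 756) - 196830*q - 19131876*q^2 - 387420489*q^3"
    "1 = (x - 756)*q - 196830*q^2 - 19131876*q^3 - 387420489*q^4"
    if "g \<in> R" and q: "q = inverse g" for g q
  proof -
    have gq: "g * q = 1" using inv[OF \<open>g \<in> R\<close>] q by simp
    show 1: "g^3 = (x - 756)*g^2 - 196830*g - 19131876 - 387420489*q"
      using quart[OF \<open>g \<in> R\<close>] gq by algebra
    show 2: "g^2 = (x - 756)*g - 196830 - 19131876*q - 387420489*q^2"
      using 1 gq by algebra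
    show 3: "g = (x - 756) - 196830*q - 19131876*q^2 - 387420489*q^3"
      using 2 gq by algebra
    show 4: "1 = (x - 756)*q - 196830*q^2 - 19131876*q^3 - 387420489*q^4"
      using 3 gq by algebra
  qed
  have R: "r1 \<in> R" "r2 \<in> R" "r3 \<in> R" "r4 \<in> R" by (auto simp: R_def)
  note trecs = trec[OF R(1) refl] trec[OF R(2) refl] trec[OF R(3) refl] trec[OF R(4) refl]
  have "s 3 = (x - 756)*s 2 - 196830*s 1 - 19131876*4 - 387420489*t 1"
    unfolding s_def t_def using trecs(1,5,9,13) by algebra
  hence t1: "t 1 = -4/81" unfolding s1 s2 s3 by algebra
  have "s 2 = (x - 756)*s 1 - 196830*4 - 19131876*t 1 - 387420489*t 2"
    unfolding s_def t_def using trecs(2,6,10,14) by algebra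
  hence t2: "t 2 = 28/19683" unfolding s1 s2 t1 by algebra
  have "s 1 = (x - 756)*4 - 196830*t 1 - 19131876*t 2 - 387420489*t 3"
    unfolding s_def t_def using trecs(3,7,11,15) by algebra
  hence t3: "t 3 = x/129140163 - 244/4782969" unfolding s1 t1 t2 by algebra
  have "4 = (x - 756)*t 1 - 196830*t 2 - 19131876*t 3 - 387420489*t 4"
    unfolding s_def t_def using trecs(4,8,12,16) by algebra
  hence t4: "t 4 = 2188/1162261467 - 16*x/31381059609" unfolding t1 t2 t3 by algebra
  have y1: "w g^1 = g^3 + 36*g^2 + 270*g^1 + 756 + 729*q^1"
    if "g \<in> R" and q: "q = inverse g" for g q
  proof -
    have gq: "g * q = 1" using inv[OF \<open>g \<in> R\<close>] q by simp
    have gq1: "g^1 * q^1 = 1" using gq by algebra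
    have "w g = (g^4 + 36*g^3 + 270*g^2 + 756*g + 729) * q"
      unfolding w_def q[symmetric] using gq by algebra
    hence "w g^1 = (g^4 + 36*g^3 + 270*g^2 + 756*g + 729)^1 * q^1"
      by (simp only: power_mult_distrib)
    also have "\<dots> = (g^3 + 36*g^2 + 270*g^1 + 756)*(g^1*q^1)
        + 729*q^1"
      by algebra
    finally show ?thesis by (simp only: gq1 mult_1_right)
  qed
  have "p 1 = s 3 + 36*s 2 + 270*s 1 + 3024 + 729*t 1"
    unfolding p_def s_def t_def y1[OF R(1) refl] y1[OF R(2) refl] y1[OF R(3) refl] y1[OF R(4) refl]
    by algebra
  hence p1: "p 1 = x^3 - 2232*x^2 + 1069956*x - 36864000"
    unfolding s3 s2 s1 t1 by algebra
  have y2: "w g^2 = g^6 + 72*g^5 + 1836*g^4 + 20952*g^3 + 128790*g^2 + 460728*g^1 + 965196 + 1102248*q^1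
        + 531441*q^2"
    if "g \<in> R" and q: "q = inverse g" for g q
  proof -
    have gq: "g * q = 1" using inv[OF \<open>g \<in> R\<close>] q by simp
    have gq1: "g^1 * q^2 = q^1" using gq by algebra
    have gq2: "g^2 * q^2 = 1" using gq by algebra
    have "w g = (g^4 + 36*g^3 + 270*g^2 + 756*g + 729) * q"
      unfolding w_def q[symmetric] using gq by algebra
    hence "w g^2 = (g^4 + 36*g^3 + 270*g^2 + 756*g + 729)^2 * q^2"
      by (simp only: power_mult_distrib)
    also have "\<dots> = (g^6 + 72*g^5 + 1836*g^4 + 20952*g^3 + 128790*g^2 + 460728*g^1 + 965196)*(g^2*q^2)
        + 1102248*(g^1*q^2) + 531441*q^2"
      by algebra
    finally show ?thesis by (simp only: gq1 gq2 mult_1_right)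
  qed
  have "p 2 = s 6 + 72*s 5 + 1836*s 4 + 20952*s 3 + 128790*s 2 + 460728*s 1 + 3860784 + 1102248*t 1
        + 531441*t 2"
    unfolding p_def s_def t_def y2[OF R(1) refl] y2[OF R(2) refl] y2[OF R(3) refl] y2[OF R(4) refl]
    by algebra
  hence p2: "p 2 = x^6 - 4464*x^5 + 7121736*x^4 - 4850016048*x^3 + 1304190901764*x^2 - 96686161920000*x
      + 452984832000000"
    unfolding s6 s5 s4 s3 s2 s1 t1 t2 by algebra
  have y3: "w g^3 = g^9 + 108*g^8 + 4698*g^7 + 107244*g^6 + 1433943*g^5 + 12194712*g^4 + 69502860*g^3
        + 272885112*g^2 + 743013567*g^1 + 1382297724 + 1680416442*q^1 + 1205308188*q^2
        + 387420489*q^3"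
    if "g \<in> R" and q: "q = inverse g" for g q
  proof -
    have gq: "g * q = 1" using inv[OF \<open>g \<in> R\<close>] q by simp
    have gq1: "g^1 * q^3 = q^2" using gq by algebra
    have gq2: "g^2 * q^3 = q^1" using gq by algebra
    have gq3: "g^3 * q^3 = 1" using gq by algebra
    have "w g = (g^4 + 36*g^3 + 270*g^2 + 756*g + 729) * q"
      unfolding w_def q[symmetric] using gq by algebra
    hence "w g^3 = (g^4 + 36*g^3 + 270*g^2 + 756*g + 729)^3 * q^3"
      by (simp only: power_mult_distrib)
    also have "\<dots> = (g^9 + 108*g^8 + 4698*g^7 + 107244*g^6 + 1433943*g^5 + 12194712*g^4 + 69502860*g^3
        + 272885112*g^2 + 743013567*g^1 + 1382297724)*(g^3*q^3)
        + 1680416442*(g^2*q^3) + 1205308188*(g^1*q^3) + 387420489*q^3"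
      by algebra
    finally show ?thesis by (simp only: gq1 gq2 gq3 mult_1_right)
  qed
  have "p 3 = s 9 + 108*s 8 + 4698*s 7 + 107244*s 6 + 1433943*s 5 + 12194712*s 4 + 69502860*s 3
        + 272885112*s 2 + 743013567*s 1 + 5529190896 + 1680416442*t 1 + 1205308188*t 2
        + 387420489*t 3"
    unfolding p_def s_def t_def y3[OF R(1) refl] y3[OF R(2) refl] y3[OF R(3) refl] y3[OF R(4) refl]
    by algebra
  hence p3: "p 3 = x^9 - 6696*x^8 + 18155340*x^7 - 25558880616*x^6 + 19911348844254*x^5 - 8462606079164976*x^4
      + 1807117806969180036*x^3 - 160955105128759296000*x^2 + 3894649030705152000000*x
      - 5566277615616000000000"
    unfolding s9 s8 s7 s6 s5 s4 s3 s2 s1 t1 t2 t3 by algebra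
  have y4: "w g^4 = g^12 + 144*g^11 + 8856*g^10 + 306288*g^9 + 6645564*g^8 + 96402960*g^7 + 980178408*g^6
        + 7229802096*g^5 + 39597196518*g^4 + 163243873584*g^3 + 509025527208*g^2
        + 1195572188880*g^1 + 2084164924284 + 2617470219312*q^1 + 2240840108376*q^2
        + 1171559558736*q^3 + 282429536481*q^4"
    if "g \<in> R" and q: "q = inverse g" for g q
  proof -
    have gq: "g * q = 1" using inv[OF \<open>g \<in> R\<close>] q by simp
    have gq1: "g^1 * q^4 = q^3" using gq by algebra
    have gq2: "g^2 * q^4 = q^2" using gq by algebra
    have gq3: "g^3 * q^4 = q^1" using gq by algebra
    have gq4: "g^4 * q^4 = 1" using gq by algebra
    have "w g = (g^4 + 36*g^3 + 270*g^2 + 756*g + 729) * q"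
      unfolding w_def q[symmetric] using gq by algebra
    hence "w g^4 = (g^4 + 36*g^3 + 270*g^2 + 756*g + 729)^4 * q^4"
      by (simp only: power_mult_distrib)
    also have "\<dots> = (g^12 + 144*g^11 + 8856*g^10 + 306288*g^9 + 6645564*g^8 + 96402960*g^7 + 980178408*g^6
        + 7229802096*g^5 + 39597196518*g^4 + 163243873584*g^3 + 509025527208*g^2
        + 1195572188880*g^1 + 2084164924284)*(g^4*q^4)
        + 2617470219312*(g^3*q^4) + 2240840108376*(g^2*q^4) + 1171559558736*(g^1*q^4) + 282429536481*q^4"
      by algebra
    finally show ?thesis by (simp only: gq1 gq2 gq3 gq4 mult_1_right)
  qed
  have "p 4 = s 12 + 144*s 11 + 8856*s 10 + 306288*s 9 + 6645564*s 8 + 96402960*s 7 + 980178408*s 6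
        + 7229802096*s 5 + 39597196518*s 4 + 163243873584*s 3 + 509025527208*s 2
        + 1195572188880*s 1 + 8336659697136 + 2617470219312*t 1 + 2240840108376*t 2
        + 1171559558736*t 3 + 282429536481*t 4"
    unfolding p_def s_def t_def y4[OF R(1) refl] y4[OF R(2) refl] y4[OF R(3) refl] y4[OF R(4) refl]
    by algebra
  hence p4: "p 4 = x^12 - 8928*x^11 + 34170768*x^10 - 73282891104*x^9 + 96628448733768*x^8 - 80918256474027648*x^7
      + 42962982281067899088*x^6 - 14031884553812442400320*x^5 + 2645214547626470062192644*x^4
      - 256694870958596281221120000*x^3 + 10386519850921312124928000000*x^2
      - 111775963127469834240000000000*x + 68398419340689408000000000000"
    unfolding s12 s11 s10 s9 s8 s7 s6 s5 s4 s3 s2 s1 t1 t2 t3 t4 by algebra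
  \<comment> \<open>The coefficients on the right are those of \<open>Phi3 x y\<close> as a monic
    quartic in \<open>y\<close>; the remaining goals are Newton's identities for \<open>p 1\<close>
    to \<open>p 4\<close>.\<close>
  have "(y - w r1) * (y - w r2) * (y - w r3) * (y - w r4) = y^4 - (x^3 - 2232*x^2 + 1069956*x - 36864000)*y^3
      + (2232*x^3 + 2587918086*x^2 + 8900222976000*x + 452984832000000)*y^2
      - (1069956*x^3 - 8900222976000*x^2 + 770845966336000000*x - 1855425871872000000000)*y
      + (x^4 + 36864000*x^3 + 452984832000000*x^2 + 1855425871872000000000*x)"
  proof (rule newton_product_4[where p = p, OF p_def])
  qed (unfold p1 p2 p3 p4, algebra+)
  also have "\<dots> = Phi3 x y" unfolding Phi3_def by algebra
  finally have "(y - w r1) * (y - w r2) * (y - w r3) * (y - w r4) = Phi3 x y" .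
  with assms obtain g where g: "g \<in> R" "y = w g" using R by auto
  define q where "q = inverse g"
  have gq: "g * q = 1" using inv[OF g(1)] by (simp add: q_def)
  \<comment> \<open>Here \<open>q = 1 / g\<close>, and \<open>729 * q\<close> undoes the
    substitution.\<close>
  show ?thesis
  proof (rule that[of "729 * q"])
    show "729 * q \<noteq> 0" using gq by auto
    show "x * (729 * q) = (729 * q + 27) * (729 * q + 3)^3"
      using trec(4)[OF g(1) q_def] by algebra
    show "y * (729 * q)^3 = (729 * q + 27) * (729 * q + 243)^3"
      unfolding g(2) w_def q_def[symmetric] using gq by algebra
  qed
qed

section \<open>Cubics up to affine substitution, and the normal form of a 3-isogeny\<close>

lemma cubic_disc_identity:
  fixes a b c :: "'k::field_char_0"
  shows "27 * cubic_disc a b c = 4 * (a^2 - 3*b)^3 - (2*a^3 - 9*a*b + 27*c)^2"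
  unfolding cubic_disc_def by algebra

text \<open>Equal j-invariants give isomorphic curves over an algebraically closed field. The
  quantities \<open>P\<close> and \<open>N\<close> are c4 and c6 up to constants; once they match
  with weights 2 and 3 in \<open>\<kappa>\<close>, the translation \<open>r\<close> that matches the
  quadratic terms matches the others as well. The sought relation says that substituting
  \<open>\<kappa> x + r\<close> turns the first cubic into \<open>\<kappa>^3\<close> times the
  second.\<close>

lemma cubic_affine_equivalence:
  fixes a2 a4 a6 b2 b4 b6 :: "'k::{alg_closed_field, field_char_0}"
  assumes D: "cubic_disc a2 a4 a6 \<noteq> 0" "cubic_disc b2 b4 b6 \<noteq> 0"
    and eq: "(a2^2 - 3*a4)^3 * cubic_disc b2 b4 b6 = (b2^2 - 3*b4)^3 * cubic_disc a2 a4 a6"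
  obtains \<kappa> r where "\<kappa> \<noteq> 0" "3*r + a2 = \<kappa> * b2" "3*r^2 + 2*a2*r + a4 = \<kappa>^2 * b4"
    "r^3 + a2*r^2 + a4*r + a6 = \<kappa>^3 * b6"
proof -
  define Pa where "Pa = a2^2 - 3*a4"
  define Pb where "Pb = b2^2 - 3*b4"
  define Na where "Na = 2*a2^3 - 9*a2*a4 + 27*a6"
  define Nb where "Nb = 2*b2^3 - 9*b2*b4 + 27*b6"
  have Da: "27 * cubic_disc a2 a4 a6 = 4*Pa^3 - Na^2" and Db: "27 * cubic_disc b2 b4 b6 = 4*Pb^3 - Nb^2"
    by (simp_all add: cubic_disc_identity Pa_def Pb_def Na_def Nb_def)
  have eq': "Pa^3 * cubic_disc b2 b4 b6 = Pb^3 * cubic_disc a2 a4 a6"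
    using eq by (simp add: Pa_def Pb_def)
  have "Pa^3 * (27 * cubic_disc b2 b4 b6) = Pb^3 * (27 * cubic_disc a2 a4 a6)" using eq' by algebra
  hence PN: "Pa^3 * Nb^2 = Pb^3 * Na^2" unfolding Da Db by algebra
  have "\<exists>\<kappa>. \<kappa> \<noteq> 0 \<and> Pa = \<kappa>^2 * Pb \<and> Na = \<kappa>^3 * Nb"
  proof (cases "Pb = 0")
    \<comment> \<open>The j-invariant is 0, so \<open>P\<close> does not determine the scale and a
      cube root of \<open>Na / Nb\<close> is taken instead.\<close>
    case True
    hence "Pa = 0" using eq' D by simp
    have N: "Na \<noteq> 0" "Nb \<noteq> 0" using D Da Db True \<open>Pa = 0\<close> by auto
    obtain k where "k^3 = Na / Nb" using nth_root_exists[of 3] by auto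
    thus ?thesis using N True \<open>Pa = 0\<close> by (intro exI[of _ k]) auto
  next
    case False
    hence "Pa \<noteq> 0" using eq' D by auto
    obtain k where k: "k^2 = Pa / Pb" using nth_root_exists[of 2] by auto
    have "k \<noteq> 0" using k \<open>Pa \<noteq> 0\<close> False by auto
    have Pa: "Pa = k^2 * Pb" using k False by simp
    have "Pb^3 * (Na^2 - (k^3 * Nb)^2) = 0" using PN unfolding Pa by algebra
    hence "Na^2 = (k^3 * Nb)^2" using False by simp
    \<comment> \<open>The square root \<open>k\<close> of \<open>Pa / Pb\<close> is fixed up to
      sign, and the sign is chosen to match \<open>N\<close>.\<close>
    then consider "Na = k^3 * Nb" | "Na = (-k)^3 * Nb" by (auto simp: power2_eq_iff)
    thus ?thesis
    proof cases
      case 1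
      thus ?thesis using \<open>k \<noteq> 0\<close> Pa by blast
    next
      case 2
      thus ?thesis using \<open>k \<noteq> 0\<close> Pa by (intro exI[of _ "-k"]) auto
    qed
  qed
  then obtain k where k: "k \<noteq> 0" "Pa = k^2 * Pb" "Na = k^3 * Nb" by blast
  define r where "r = (k * b2 - a2) / 3"
  have 1: "3*r = k * b2 - a2" by (simp add: r_def)
  have "3 * (3*r^2 + 2*a2*r + a4) = 3 * (k^2 * b4)"
    using 1 k(2) unfolding Pa_def Pb_def by algebra
  hence 2: "3*r^2 + 2*a2*r + a4 = k^2 * b4" by (metis mult_cancel_left zero_neq_numeral)
  have "27 * (r^3 + a2*r^2 + a4*r + a6) = 27 * (k^3 * b6)"
    using 1 2 k(3) unfolding Na_def Nb_def by algebra
  hence 3: "r^3 + a2*r^2 + a4*r + a6 = k^3 * b6" by (metis mult_cancel_left zero_neq_numeral)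
  show ?thesis by (rule that[OF k(1) _ 2 3]) (simp add: 1)
qed

text \<open>\<open>A2\<close>, \<open>A4\<close>, \<open>A6\<close> are the coefficients of the
  first cubic after translation by \<open>a\<close>. The conditions on them say that
  \<open>A2 x^2 + A4 x + A6\<close> is \<open>(l x + m)^2\<close> with \<open>m\<close> nonzero,
  phrased without choosing square roots. The last three equations identify the second cubic, up to
  \<open>\<kappa>\<close> and \<open>r\<close>, with
  \<open>x^3 + A2 x^2 - 9 A4 x - 27 A6 - 8 A2 A4\<close>, the quotient by the subgroup of order
  3.\<close>

definition three_isogeny_normal_form :: "'k::field \<Rightarrow> 'k \<Rightarrow> 'k \<Rightarrow> 'k \<Rightarrow> 'k \<Rightarrow> 'k \<Rightarrow> bool" where
  "three_isogeny_normal_form a2 a4 a6 b2 b4 b6 \<longleftrightarrow>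
     (\<exists>a \<kappa> r A2 A4 A6. \<kappa> \<noteq> 0 \<and> A6 \<noteq> 0 \<and> A4^2 = 4*A2*A6 \<and>
        A2 = 3*a + a2 \<and> A4 = 3*a^2 + 2*a2*a + a4 \<and> A6 = a^3 + a2*a^2 + a4*a + a6 \<and>
        3*r + b2 = \<kappa> * A2 \<and> 3*r^2 + 2*b2*r + b4 = \<kappa>^2 * (-9*A4) \<and>
        r^3 + b2*r^2 + b4*r + b6 = \<kappa>^3 * (-27*A6 - 8*A2*A4))"

text \<open>The weights 2 and 6 cancel in the j-invariant.\<close>

lemma cubic_disc_affine:
  fixes a b c :: "'k::field_char_0"
  assumes "3*r + a = k * a'" "3*r^2 + 2*a*r + b = k^2 * b'" "r^3 + a*r^2 + b*r + c = k^3 * c'"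
  shows "a^2 - 3*b = k^2 * (a'^2 - 3*b')" "cubic_disc a b c = k^6 * cubic_disc a' b' c'"
proof -
  have a: "a = k * a' - 3*r" using assms(1) by algebra
  have b: "b = k^2 * b' - 3*r^2 - 2*a*r" using assms(2) by algebra
  have c: "c = k^3 * c' - r^3 - a*r^2 - b*r" using assms(3) by algebra
  show "a^2 - 3*b = k^2 * (a'^2 - 3*b')" unfolding b a by algebra
  show "cubic_disc a b c = k^6 * cubic_disc a' b' c'" unfolding cubic_disc_def c b a by algebra
qed

text \<open>A normal form yields a parameter \<open>h\<close> for its pair of j-invariants.
  Conversely, a parameter yields one explicit pair of curves with the given j-invariants, and
  equality of j-invariants transports it to the given cubics by affine maps.\<close>

lemma three_isogeny_normal_form_iff:
  fixes a2 a4 a6 b2 b4 b6 :: "'k::{alg_closed_field, field_char_0}"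
  assumes D: "cubic_disc a2 a4 a6 \<noteq> 0" "cubic_disc b2 b4 b6 \<noteq> 0"
  shows "three_isogeny_normal_form a2 a4 a6 b2 b4 b6 \<longleftrightarrow>
    Phi3 (256 * (a2^2 - 3*a4)^3 / cubic_disc a2 a4 a6) (256 * (b2^2 - 3*b4)^3 / cubic_disc b2 b4 b6) = 0"
    (is "?L \<longleftrightarrow> Phi3 ?j1 ?j2 = 0")
proof
  assume ?L
  then obtain a k r A2 A4 A6 where k: "k \<noteq> 0" "A6 \<noteq> 0" "A4^2 = 4*A2*A6"
    and A: "A2 = 3*a + a2" "A4 = 3*a^2 + 2*a2*a + a4" "A6 = a^3 + a2*a^2 + a4*a + a6"
    and B: "3*r + b2 = k * A2" "3*r^2 + 2*b2*r + b4 = k^2 * (-9*A4)"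
      "r^3 + b2*r^2 + b4*r + b6 = k^3 * (-27*A6 - 8*A2*A4)"
    unfolding three_isogeny_normal_form_def by blast
  obtain m where m: "m^2 = A6" using nth_root_exists[of 2] by auto
  hence m0: "m \<noteq> 0" using k(2) by auto
  define l where "l = A4 / (2*m)"
  have A4: "A4 = 2*l*m" using m0 by (simp add: l_def)
  have "A6 * A2 = A6 * l^2" using k(3) unfolding A4 m[symmetric] using m0 by algebra
  hence A2: "A2 = l^2" using k(2) by simp
  have j1: "a2^2 - 3*a4 = A2^2 - 3*A4" "cubic_disc a2 a4 a6 = cubic_disc A2 A4 A6"
    using cubic_disc_affine[of a a2 1 A2 a4 A4 a6 A6] by (simp_all add: A)
  note j2 = cubic_disc_affine[OF B]
  define \<Delta> where "\<Delta> = 4*l^3 - 27*m"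
  have D1: "cubic_disc a2 a4 a6 = m^3 * \<Delta>" unfolding j1 A2 A4 m[symmetric] unfolding cubic_disc_def \<Delta>_def by algebra
  have D2: "cubic_disc b2 b4 b6 = k^6 * m * \<Delta>^3"
    unfolding j2 A2 A4 m[symmetric] unfolding cubic_disc_def \<Delta>_def by algebra
  have "\<Delta> \<noteq> 0" using D(1) D1 by auto
  have P1: "a2^2 - 3*a4 = l * (l^3 - 6*m)" unfolding j1 A2 A4 by algebra
  have P2: "b2^2 - 3*b4 = k^2 * (l * (l^3 + 54*m))" unfolding j2 A2 A4 by algebra
  \<comment> \<open>Up to \<open>k^6\<close>, the discriminant of the quotient divided by that of
    the curve is \<open>h^2\<close>.\<close>
  define h where "h = \<Delta> / m"
  have hm: "h * m = 4*l^3 - 27*m" using m0 by (simp add: h_def \<Delta>_def)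
  show "Phi3 ?j1 ?j2 = 0"
  proof (rule Phi3_parametrization[of h])
    show "h \<noteq> 0" using \<open>\<Delta> \<noteq> 0\<close> m0 by (simp add: h_def)
    have "?j1 * h * m^4 = 256 * (l * (l^3 - 6*m))^3"
      using m0 \<open>\<Delta> \<noteq> 0\<close> unfolding P1 D1 h_def by (simp add: divide_simps) algebra
    also have "\<dots> = (h + 27) * (h + 3)^3 * m^4" using hm by algebra
    finally show "?j1 * h = (h + 27) * (h + 3)^3" by (rule mult_right_cancel[THEN iffD1, rotated]) (simp add: m0)
    have "?j2 * h^3 * m^4 = 256 * (l * (l^3 + 54*m))^3"
      using m0 \<open>\<Delta> \<noteq> 0\<close> k(1) unfolding P2 D2 h_def by (simp add: divide_simps) algebra
    also have "\<dots> = (h + 27) * (h + 243)^3 * m^4" using hm by algebra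
    finally show "?j2 * h^3 = (h + 27) * (h + 243)^3" by (rule mult_right_cancel[THEN iffD1, rotated]) (simp add: m0)
  qed
next
  assume "Phi3 ?j1 ?j2 = 0"
  then obtain h where h: "h \<noteq> 0" "?j1 * h = (h + 27) * (h + 3)^3" "?j2 * h^3 = (h + 27) * (h + 243)^3"
    by (rule Phi3_zero_parametrization)
  \<comment> \<open>The model with \<open>m = 1\<close>, that is \<open>A2 = l^2\<close>,
    \<open>A4 = 2 l\<close>, \<open>A6 = 1\<close>; its parameter is
    \<open>4 l^3 - 27\<close>.\<close>
  obtain l where "l^3 = (h + 27) / 4" using nth_root_exists[of 3 "(h + 27) / 4"] by auto
  hence "4*l^3 = h + 27" by (simp add: mult.commute)
  hence l: "h = 4*l^3 - 27" by algebra
  have d1: "cubic_disc (l^2) (2*l) 1 = h" unfolding l cubic_disc_def power_one mult_1_right by algebra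
  have d2: "cubic_disc (l^2) (-18*l) (-27 - 16*l^3) = h^3" unfolding l cubic_disc_def by algebra
  have n1: "cubic_disc (l^2) (2*l) 1 \<noteq> 0" unfolding d1 by fact
  have n2: "cubic_disc (l^2) (-18*l) (-27 - 16*l^3) \<noteq> 0" unfolding d2 using h(1) by simp
  have "256 * (a2^2 - 3*a4)^3 * h = (h + 27) * (h + 3)^3 * cubic_disc a2 a4 a6"
    using h(2) D(1) by (simp add: divide_simps)
  also have "\<dots> = 256 * (((l^2)^2 - 3*(2*l))^3 * cubic_disc a2 a4 a6)" unfolding l by algebra
  finally have "(a2^2 - 3*a4)^3 * cubic_disc (l^2) (2*l) 1 = ((l^2)^2 - 3*(2*l))^3 * cubic_disc a2 a4 a6"
    unfolding d1 by simp
  then obtain k1 a where k1: "k1 \<noteq> 0" "3*a + a2 = k1 * l^2" "3*a^2 + 2*a2*a + a4 = k1^2 * (2*l)"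
    "a^3 + a2*a^2 + a4*a + a6 = k1^3 * 1"
    using cubic_affine_equivalence[OF D(1) n1] by blast
  have "256 * (b2^2 - 3*b4)^3 * h^3 = (h + 27) * (h + 243)^3 * cubic_disc b2 b4 b6"
    using h(3) D(2) by (simp add: divide_simps)
  also have "\<dots> = 256 * (((l^2)^2 - 3*(-18*l))^3 * cubic_disc b2 b4 b6)" unfolding l by algebra
  finally have "(b2^2 - 3*b4)^3 * cubic_disc (l^2) (-18*l) (-27 - 16*l^3)
      = ((l^2)^2 - 3*(-18*l))^3 * cubic_disc b2 b4 b6"
    unfolding d2 by simp
  then obtain k2 r where k2: "k2 \<noteq> 0" "3*r + b2 = k2 * l^2" "3*r^2 + 2*b2*r + b4 = k2^2 * (-18*l)"
    "r^3 + b2*r^2 + b4*r + b6 = k2^3 * (-27 - 16*l^3)"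
    using cubic_affine_equivalence[OF D(2) n2] by blast
  \<comment> \<open>The model is scaled by \<open>k1\<close> to meet the first cubic and its
    quotient by \<open>k2\<close> to meet the second. The quotient formulas are homogeneous, so only
    the ratio remains.\<close>
  define k where "k = k2 / k1"
  have k: "k * k1 = k2" "k \<noteq> 0" using k1(1) k2(1) by (simp_all add: k_def)
  show ?L unfolding three_isogeny_normal_form_def
  proof (intro exI conjI)
    show "k \<noteq> 0" by fact
    show "(k1^2 * (2*l))^2 = 4 * (k1 * l^2) * (k1^3 * 1)" by algebra
    show "k1^3 * 1 \<noteq> 0" using k1(1) by simp
    show "k1 * l^2 = 3*a + a2" by (simp add: k1)
    show "3*r + b2 = k * (k1 * l^2)" unfolding k2(2) k(1)[symmetric] by algebra
    show "3*r^2 + 2*b2*r + b4 = k^2 * (-9 * (k1^2 * (2*l)))" unfolding k2(3) k(1)[symmetric] by algebra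
    show "r^3 + b2*r^2 + b4*r + b6 = k^3 * (-27 * (k1^3 * 1) - 8 * (k1 * l^2) * (k1^2 * (2*l)))"
      unfolding k2(4) k(1)[symmetric] by algebra
  qed (use k1 in simp_all)
qed

lemma three_isogeny_normal_form_iff_factors:
  fixes s1 s2 :: "'k::{alg_closed_field, field_char_0}"
  assumes disc: "27 - 18*s1*s2 - s1^2*s2^2 + 4*s1^3 + 4*s2^3 \<noteq> 0"
    and u: "u = s1 * s2" and v: "v = s1^3 + s2^3"
  shows "three_isogeny_normal_form (-s1) s2 (-1) (-s2) s1 (-1) \<longleftrightarrow>
    (4*v - u^2 + 110*u - 1125) * g1 u v * g2 u v = 0"
proof -
  define D where "D = - (27 - 18*s1*s2 - s1^2*s2^2 + 4*s1^3 + 4*s2^3)"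
  have D: "27 - 18*s1*s2 - s1^2*s2^2 + 4*s1^3 + 4*s2^3 = - D" "D \<noteq> 0"
    unfolding D_def using disc by (simp_all only: minus_minus neg_equal_0_iff_equal not_False_eq_True)
  have d: "cubic_disc (-s1) s2 (-1) = D" "cubic_disc (-s2) s1 (-1) = D"
    unfolding cubic_disc_def D_def by algebra+
  show ?thesis
    using three_isogeny_normal_form_iff[of "-s1" s2 "-1" "-s2" s1 "-1"] Phi3_eq_factors[OF D u v] D(2)
    by (auto simp: d)
qed

section \<open>Rational solutions of cubic equations\<close>

text \<open>
  The polynomials over an abstract field do not form an instance of the type classes with a gcd, so
  coprimality is used in its Bezout form.
\<close>
definition comaximal :: "'r::comm_ring_1 \<Rightarrow> 'r \<Rightarrow> bool" where
  "comaximal p q \<longleftrightarrow> (\<exists>x y. x * p + y * q = 1)"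

lemma comaximal_commute: "comaximal p q \<longleftrightarrow> comaximal q p"
  unfolding comaximal_def by (metis add.commute)

lemma comaximal_mult_right:
  assumes "comaximal p q" "comaximal p r"
  shows "comaximal p (q * r)"
proof -
  obtain x y z w where "x * p + y * q = 1" "z * p + w * r = 1"
    using assms by (auto simp: comaximal_def)
  hence "(x * p + y * q) * (z * p + w * r) = 1" by simp
  hence "(x * z * p + x * w * r + y * z * q) * p + (y * w) * (q * r) = 1"
    by (simp add: algebra_simps)
  thus ?thesis unfolding comaximal_def by blast
qed

lemma comaximal_one_right: "comaximal p 1"
  unfolding comaximal_def by (intro exI[of _ 0] exI[of _ 1]) simp

lemma comaximal_power_right: "comaximal p q \<Longrightarrow> comaximal p (q ^ n)"
  by (induction n) (simp_all add: comaximal_one_right comaximal_mult_right)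

lemma comaximal_power: "comaximal p q \<Longrightarrow> comaximal (p ^ m) (q ^ n)"
  using comaximal_commute comaximal_power_right by metis

lemma comaximal_dvd_both:
  assumes "comaximal p q" "m dvd p * w" "m dvd q * w"
  shows "m dvd w"
proof -
  obtain x y where "x * p + y * q = 1" using assms(1) by (auto simp: comaximal_def)
  hence "w = x * (p * w) + y * (q * w)" by (metis distrib_right mult.assoc mult_1)
  thus ?thesis using assms(2,3) by (metis dvd_add dvd_mult)
qed

lemma comaximal_dvd_mult: "comaximal p q \<Longrightarrow> p dvd q * r \<Longrightarrow> p dvd r"
  by (rule comaximal_dvd_both[of p q]) auto

lemma comaximal_poly_nonzero:
  assumes "comaximal p q" "poly p a = 0"
  shows "poly q a \<noteq> 0"
proof
  assume "poly q a = 0"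
  obtain x y where "x * p + y * q = 1" using assms(1) by (auto simp: comaximal_def)
  hence "poly (x * p + y * q) a = 1" by simp
  thus False using assms(2) \<open>poly q a = 0\<close> by simp
qed

text \<open>A nonzero element of least degree in the ideal generated by \<open>a\<close> and
  \<open>b\<close> divides both by division with remainder; cancelling it from its own expression as
  a combination leaves a Bezout relation.\<close>

lemma comaximal_reduction:
  fixes a b :: "'k::field poly"
  assumes "b \<noteq> 0"
  obtains d p q where "a = d * p" "b = d * q" "comaximal p q"
proof -
  define I where "I = {x * a + y * b | x y. True}"
  have "0 * a + 1 * b \<in> I" unfolding I_def by blast
  hence "\<exists>d. d \<in> I \<and> d \<noteq> 0" using assms by auto
  obtain d where d: "d \<in> I" "d \<noteq> 0" "\<And>e. e \<in> I \<Longrightarrow> e \<noteq> 0 \<Longrightarrow> degree d \<le> degree e"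
    using ex_has_least_nat[of "\<lambda>d. d \<in> I \<and> d \<noteq> 0" b degree] \<open>0 * a + 1 * b \<in> I\<close> assms by auto
  obtain x y where xy: "d = x * a + y * b" using d(1) by (auto simp: I_def)
  have "d dvd s" if "s \<in> I" for s
  proof (rule ccontr)
    assume "\<not> d dvd s"
    hence "s mod d \<noteq> 0" by auto
    obtain x' y' where "s = x' * a + y' * b" using \<open>s \<in> I\<close> by (auto simp: I_def)
    hence "s mod d = (x' - s div d * x) * a + (y' - s div d * y) * b"
      unfolding minus_div_mult_eq_mod[symmetric] xy by (simp add: algebra_simps)
    hence "s mod d \<in> I" unfolding I_def by blast
    with d(3) \<open>s mod d \<noteq> 0\<close> degree_mod_less'[OF d(2) \<open>s mod d \<noteq> 0\<close>] show False by fastforce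
  qed
  moreover have "1 * a + 0 * b \<in> I" unfolding I_def by blast
  ultimately have "d dvd a" "d dvd b" using \<open>0 * a + 1 * b \<in> I\<close> by auto
  then obtain p q where pq: "a = d * p" "b = d * q" by (auto elim!: dvdE)
  have "d * (x * p + y * q) = d * 1" using xy pq by (simp add: algebra_simps)
  hence "x * p + y * q = 1" using d(2) by simp
  thus ?thesis using pq that unfolding comaximal_def by blast
qed

section \<open>Binary quartic forms and Wronskians\<close>

definition cubic_form :: "'k::comm_ring_1 \<Rightarrow> 'k \<Rightarrow> 'k \<Rightarrow> 'k poly \<Rightarrow> 'k poly \<Rightarrow> 'k poly" where
  "cubic_form a b c p q = q * (p^3 + [:a:]*p^2*q + [:b:]*p*q^2 + [:c:]*q^3)"

text \<open>The numerator of the derivative of \<open>p / q\<close> over the denominator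
  \<open>q^2\<close>.\<close>

definition wronskian :: "'k::idom poly \<Rightarrow> 'k poly \<Rightarrow> 'k poly" where
  "wronskian p q = pderiv p * q - p * pderiv q"

text \<open>\<open>FA\<close> and \<open>FB\<close> are the partial derivatives of the binary
  quartic form with respect to \<open>p\<close> and \<open>q\<close>. Two binary cubic forms without
  common zero generate every form of degree 5, whence the fifth powers; the cofactors solve the
  corresponding linear system, and \<open>D\<close> is 16 times the discriminant.\<close>

lemma cubic_form_bezout:
  fixes a b c p q :: "'r::idom"
  defines "FA \<equiv> q * (3*p^2 + 2*a*p*q + b*q^2)"
    and "FB \<equiv> p^3 + 2*a*p^2*q + 3*b*p*q^2 + 4*c*q^3"
    and "D \<equiv> 16 * (18*a*b*c - 4*a^3*c + a^2*b^2 - 4*b^3 - 27*c^2)"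
  shows "D * p^5 =
      ((64*a^4*c - 16*a^3*b^2 - 272*a^2*b*c + 60*a*b^3 + 384*a*c^2 + 4*b^2*c) * p^2
       + (96*a^3*b*c - 24*a^2*b^3 - 64*a^2*c^2 - 320*a*b^2*c + 72*b^4 + 480*b*c^2) * p * q
       + (128*a^3*c^2 - 32*a^2*b^2*c - 448*a*b*c^2 + 96*b^3*c + 576*c^3) * q^2) * FA
      + (D * p^2
       + (-64*a^4*c + 16*a^3*b^2 + 240*a^2*b*c - 52*a*b^3 - 288*a*c^2 - 12*b^2*c) * p * q
       + (-32*a^3*b*c + 8*a^2*b^3 + 112*a*b^2*c - 24*b^4 - 144*b*c^2) * q^2) * FB"
    and "D * q^5 =
      ((8*a^2 - 24*b) * p^2 + (16*a^3 - 52*a*b + 36*c) * p * q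
       + (16*a^2*b + 48*a*c - 64*b^2) * q^2) * FA
      + ((72*b - 24*a^2) * p * q + (60*a*b - 16*a^3 - 108*c) * q^2) * FB"
  unfolding FA_def FB_def D_def by algebra+

text \<open>
  Over \<open>f M\<^sup>2 = F(p, q)\<close> with \<open>F\<close> a squarefree binary quartic form, \<open>M\<close> divides the
  Wronskian of \<open>p\<close> and \<open>q\<close>: this is the statement that the differential
  \<open>d(p/q) / sqrt(F)\<close> is regular, obtained from Euler's identity instead of local expansions.
\<close>
lemma dvd_wronskian:
  fixes f M p q :: "'k::field_char_0 poly"
  assumes eq: "f * M^2 = cubic_form a b c p q" and cop: "comaximal p q" and D: "cubic_disc a b c \<noteq> 0"
  shows "M dvd wronskian p q"
proof -
  define A B C where "A = [:a:]" and "B = [:b:]" and "C = [:c:]"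
  define FA where "FA = q * (3*p^2 + 2*A*p*q + B*q^2)"
  define FB where "FB = p^3 + 2*A*p^2*q + 3*B*p*q^2 + 4*C*q^3"
  have eq': "f * M^2 = q * (p^3 + A*p^2*q + B*p*q^2 + C*q^3)"
    using eq by (simp add: cubic_form_def A_def B_def C_def)
  have d0: "pderiv A = 0" "pderiv B = 0" "pderiv C = 0" by (simp_all add: A_def B_def C_def pderiv_pCons)
  have "pderiv (f * M^2) = M * (pderiv f * M + 2 * f * pderiv M)"
    by (simp add: pderiv_mult pderiv_power power2_eq_square algebra_simps)
  also have "pderiv (f * M^2) = FA * pderiv p + FB * pderiv q"
    unfolding eq' FA_def FB_def
    by (simp add: pderiv_mult pderiv_add d0 pderiv_power power2_eq_square power3_eq_cube) algebra
  finally have 1: "FA * pderiv p + FB * pderiv q = M * (pderiv f * M + 2 * f * pderiv M)" .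
  have 2: "p * FA + q * FB = M * (4 * f * M)"
    using eq' unfolding FA_def FB_def by algebra
  \<comment> \<open>Cramer's rule for the two linear equations in \<open>FA\<close> and
    \<open>FB\<close>, whose determinant is the Wronskian; both right-hand sides are multiples of
    \<open>M\<close>.\<close>
  have "FB * wronskian p q = M * (pderiv p * (4 * f * M) - p * (pderiv f * M + 2 * f * pderiv M))"
    using 1 2 unfolding wronskian_def by algebra
  hence dB: "M dvd FB * wronskian p q" by simp
  have "FA * wronskian p q = M * (q * (pderiv f * M + 2 * f * pderiv M) - pderiv q * (4 * f * M))"
    using 1 2 unfolding wronskian_def by algebra
  hence dA: "M dvd FA * wronskian p q" by simp
  define D' where "D' = 16 * (18*A*B*C - 4*A^3*C + A^2*B^2 - 4*B^3 - 27*C^2)"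
  have D': "D' = [:16 * cubic_disc a b c:]"
    unfolding D'_def A_def B_def C_def cubic_disc_def
    by (simp add: power2_eq_square power3_eq_cube numeral_poly algebra_simps)
  have "M dvd (U * FA + V * FB) * wronskian p q" for U V
    using dA dB by (metis distrib_right dvd_add dvd_mult mult.assoc)
  from this cubic_form_bezout[where a = A and b = B and c = C and p = p and q = q]
  have "M dvd D' * p^5 * wronskian p q" "M dvd D' * q^5 * wronskian p q"
    unfolding D'_def FA_def FB_def by metis+
  hence "M dvd p^5 * wronskian p q" "M dvd q^5 * wronskian p q"
    using D unfolding D' by (simp_all add: dvd_smult_iff)
  thus ?thesis using comaximal_dvd_both[OF comaximal_power[OF cop]] by blast
qed

lemma degree_wronskian:
  fixes p q :: "'k::field_char_0 poly"
  assumes "wronskian p q \<noteq> 0"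
  shows "degree (wronskian p q) < degree p + degree q"
proof -
  have *: "degree (pderiv p * q) < degree p + degree q" "degree (p * pderiv q) < degree p + degree q"
    if "degree p > 0 \<and> degree q > 0"
    using that degree_mult_le[of "pderiv p" q] degree_mult_le[of p "pderiv q"]
    by (auto simp: degree_pderiv)
  consider "degree p > 0 \<and> degree q > 0" | "degree p = 0" "degree q > 0" | "degree q = 0" "degree p > 0"
    | "degree p = 0" "degree q = 0" by auto
  thus ?thesis
  proof cases
    case 1
    thus ?thesis using * unfolding wronskian_def by (simp add: degree_diff_less)
  next
    case 2
    thus ?thesis using degree_mult_le[of p "pderiv q"]
      by (auto simp: wronskian_def degree_pderiv pderiv_eq_0_iff[THEN iffD2])
  next
    case 3
    thus ?thesis using degree_mult_le[of "pderiv p" q]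
      by (auto simp: wronskian_def degree_pderiv pderiv_eq_0_iff[THEN iffD2])
  next
    case 4
    thus ?thesis using assms by (simp add: wronskian_def pderiv_eq_0_iff[THEN iffD2])
  qed
qed

text \<open>A vanishing Wronskian and comaximality make each of \<open>p\<close> and
  \<open>q\<close> divide its own derivative, which in characteristic 0 happens only for
  constants.\<close>

lemma wronskian_eq_0:
  fixes p q :: "'k::field_char_0 poly"
  assumes "wronskian p q = 0" "comaximal p q"
  shows "degree p = 0 \<and> degree q = 0"
proof -
  have *: "degree s = 0" if "comaximal s r" "pderiv r * s = r * pderiv s" for r s :: "'k poly"
  proof (rule ccontr)
    assume "degree s \<noteq> 0"
    have "s dvd pderiv s" using that comaximal_dvd_mult dvd_triv_right by metis
    hence "degree s \<le> degree (pderiv s)" using \<open>degree s \<noteq> 0\<close>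
      by (intro dvd_imp_degree_le) (auto simp: pderiv_eq_0_iff)
    thus False using \<open>degree s \<noteq> 0\<close> by (simp add: degree_pderiv)
  qed
  have "pderiv p * q = p * pderiv q" using assms(1) by (simp add: wronskian_def)
  with *[of p q] *[of q p] assms(2) show ?thesis by (simp add: comaximal_commute mult.commute)
qed

lemma monic_cubic_roots:
  fixes a b c :: "'k::alg_closed_field"
  obtains e1 e2 e3 where "a = - (e1 + e2 + e3)" "b = e1*e2 + e1*e3 + e2*e3" "c = - (e1*e2*e3)"
proof -
  obtain e1 where "poly [:c, b, a, 1:] e1 = 0" using alg_closed_imp_poly_has_root[of "[:c,b,a,1:]"] by auto
  hence e1: "c = - (e1 * (e1 * (e1 + a) + b))" by (simp add: algebra_simps eq_neg_iff_add_eq_0)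
  obtain e2 where "poly [:e1 * (e1 + a) + b, e1 + a, 1:] e2 = 0"
    using alg_closed_imp_poly_has_root[of "[:e1 * (e1 + a) + b, e1 + a, 1:]"] by auto
  hence e2: "e1 * (e1 + a) + b = - (e2 * (e2 + e1 + a))"
    by (simp add: algebra_simps eq_neg_iff_add_eq_0)
  show ?thesis
  proof (rule that[of e1 e2 "- (e1 + e2 + a)"])
    show "b = e1*e2 + e1*(- (e1 + e2 + a)) + e2*(- (e1 + e2 + a))" using e2 by algebra
    show "c = - (e1*e2*(- (e1 + e2 + a)))" using e1 e2 by algebra
  qed simp
qed

lemma cubic_disc_roots:
  fixes e1 e2 e3 :: "'k::field_char_0"
  shows "cubic_disc (- (e1 + e2 + e3)) (e1*e2 + e1*e3 + e2*e3) (- (e1*e2*e3))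
          = ((e1 - e2) * (e1 - e3) * (e2 - e3))^2"
  unfolding cubic_disc_def by algebra

lemma cubic_form_roots:
  fixes e1 e2 e3 :: "'k::field_char_0"
  shows "cubic_form (- (e1 + e2 + e3)) (e1*e2 + e1*e3 + e2*e3) (- (e1*e2*e3)) p q
          = q * ((p - [:e1:]*q) * (p - [:e2:]*q) * (p - [:e3:]*q))"
proof -
  have "[:- (e1 + e2 + e3):] = - ([:e1:] + [:e2:] + [:e3:])"
    "[:e1*e2 + e1*e3 + e2*e3:] = [:e1:]*[:e2:] + [:e1:]*[:e3:] + [:e2:]*[:e3:]"
    "[:- (e1*e2*e3):] = - ([:e1:]*[:e2:]*[:e3:])" by simp_all
  thus ?thesis unfolding cubic_form_def by algebra
qed

lemma wronskian_shift: "wronskian (p - [:e:] * q) q = wronskian p q"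
  unfolding wronskian_def by (simp add: pderiv_diff pderiv_smult algebra_simps)

lemma monic_cubic_form_roots:
  fixes a b c :: "'k::{alg_closed_field, field_char_0}"
  assumes "cubic_disc a b c \<noteq> 0"
  obtains e1 e2 e3 where "e1 \<noteq> e2" "e1 \<noteq> e3" "e2 \<noteq> e3"
    "\<And>p q. cubic_form a b c p q = q * ((p - [:e1:]*q) * (p - [:e2:]*q) * (p - [:e3:]*q))"
proof -
  obtain e1 e2 e3 where e: "a = - (e1 + e2 + e3)" "b = e1*e2 + e1*e3 + e2*e3" "c = - (e1*e2*e3)"
    by (rule monic_cubic_roots)
  have "((e1 - e2) * (e1 - e3) * (e2 - e3))^2 \<noteq> 0"
    using assms unfolding e cubic_disc_roots .
  hence "e1 \<noteq> e2" "e1 \<noteq> e3" "e2 \<noteq> e3" by auto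
  thus ?thesis using that cubic_form_roots unfolding e by blast
qed

text \<open>Leading terms of \<open>p\<close> and \<open>e * q\<close> cancel for at most one
  \<open>e\<close>, so at most one of the three linear factors of the form drops below the degree of
  \<open>q\<close>.\<close>

lemma degree_diff_const_mult:
  fixes p q :: "'k::field poly"
  assumes "degree (p - [:e:] * q) < degree q" "e \<noteq> e'"
  shows "degree (p - [:e':] * q) = degree q"
proof -
  have "p - [:e':] * q = (p - [:e:] * q) + smult (e - e') q" by (simp add: smult_diff_left)
  also have "degree \<dots> = degree (smult (e - e') q)"
    using assms by (intro degree_add_eq_right) simp
  finally show ?thesis using assms(2) by simp
qed

lemma degree_diff_const_mult_left:
  fixes p q :: "'k::field poly"
  assumes "degree q < degree p"
  shows "degree (p - [:e:] * q) = degree p"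
  using assms degree_add_eq_left[of "smult (-e) q" p] degree_smult_le[of "-e" q] by simp

text \<open>
  An elliptic curve has no nonconstant points over \<open>k(x)\<close>: by degrees, \<open>M\<close> is too large to
  divide a nonzero Wronskian.
\<close>
lemma square_eq_cubic_form_imp_const:
  fixes M p q :: "'k::{alg_closed_field, field_char_0} poly"
  assumes eq: "M^2 = cubic_form a b c p q" and cop: "comaximal p q" and D: "cubic_disc a b c \<noteq> 0"
    and q: "q \<noteq> 0"
  shows "degree p = 0 \<and> degree q = 0"
proof (rule ccontr)
  assume nc: "\<not> ?thesis"
  have W0: "wronskian p q \<noteq> 0" using wronskian_eq_0[OF _ cop] nc by blast
  have "M dvd wronskian p q" by (rule dvd_wronskian[OF _ cop D, of 1]) (simp add: eq)
  hence dM: "degree M \<le> degree (wronskian p q)" using W0 by (rule dvd_imp_degree_le)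
  obtain e1 e2 e3 where e: "e1 \<noteq> e2" "e1 \<noteq> e3" "e2 \<noteq> e3"
    and roots: "\<And>p q. cubic_form a b c p q = q * ((p - [:e1:]*q) * (p - [:e2:]*q) * (p - [:e3:]*q))"
    using monic_cubic_form_roots[OF D] by metis
  define N where "N e = p - [:e:] * q" for e
  have WN: "wronskian (N e) q = wronskian p q" for e
    unfolding N_def by (rule wronskian_shift)
  have N0: "N e \<noteq> 0" for e
    using W0 WN[of e] by (auto simp: wronskian_def)
  have F: "M^2 = q * (N e1 * N e2 * N e3)" using eq unfolding roots N_def .
  have degF: "2 * degree M = degree q + degree (N e1) + degree (N e2) + degree (N e3)"
  proof -
    have "degree (M^2) = degree (q * (N e1 * N e2 * N e3))" by (simp only: F)
    moreover have "M \<noteq> 0" using F N0 q by auto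
    ultimately show ?thesis using N0 q by (simp add: degree_mult_eq degree_power_eq)
  qed
  \<comment> \<open>The Wronskian is the same for every shift \<open>N e\<close>, so the bound may
    be applied to the factor of smallest degree.\<close>
  have dW: "degree (wronskian p q) < degree (N e) + degree q" for e
    using degree_wronskian[of "N e" q] W0 by (simp add: WN)
  show False
  proof (cases "degree p > degree q")
    case True
    have "degree (N e) = degree p" for e
      unfolding N_def using True by (rule degree_diff_const_mult_left)
    thus False using degF dM dW[of e1] True by simp
  next
    case False
    have le: "degree (N e) \<le> degree q" for e
      unfolding N_def using False by (intro degree_diff_le) (auto intro: order.trans[OF degree_smult_le])
    have other: "degree (N e') = degree q" if "degree (N e) < degree q" "e \<noteq> e'" for e e'
      using degree_diff_const_mult that unfolding N_def by blast
    consider "degree (N e1) < degree q" | "degree (N e2) < degree q"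
      | "degree (N e1) = degree q" "degree (N e2) = degree q"
      using le[of e1] le[of e2] by linarith
    thus False
    proof cases
      case 1
      thus False using other[OF 1 e(1)] other[OF 1 e(2)] degF dM dW[of e1] by linarith
    next
      case 2
      thus False using other[OF 2 e(1)[symmetric]] other[OF 2 e(3)] degF dM dW[of e2] by linarith
    next
      case 3
      thus False using le[of e3] degF dM dW[of e3] by linarith
    qed
  qed
qed

lemma even_degree_if_even_order:
  fixes p :: "'k::alg_closed_field poly"
  assumes "p \<noteq> 0" "\<And>x. poly p x = 0 \<Longrightarrow> even (order x p)"
  shows "even (degree p)"
proof -
  obtain A where A: "size A = degree p" "p = smult (lead_coeff p) (\<Prod>x\<in>#A. [:-x, 1:])"
    using alg_closed_imp_factorization[OF assms(1)] by blast
  have "proots p = proots (\<Prod>x\<in>#A. [:-x, 1:])"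
    using assms(1) by (subst A(2)) simp
  also have "\<dots> = A"
  proof (induction A)
    case (add x A)
    have "(\<Prod>x\<in>#A. [:-x, 1:]) \<noteq> 0" by (auto simp: prod_mset_zero_iff)
    with add show ?case by (simp add: proots_mult del: mult_pCons_left)
  qed simp
  finally have "proots p = A" .
  have "even (\<Sum>x\<in>set_mset (proots p). count (proots p) x)"
    using assms by (intro dvd_sum) auto
  thus ?thesis using A(1) \<open>proots p = A\<close> by (simp add: size_multiset_overloaded_eq)
qed

text \<open>
  The kernel of a \<open>3\<close>-isogeny does not contain points of order two: otherwise one of the
  cubics \<open>p - e\<^sub>i q\<close> would have only roots of even order.
\<close>
lemma two_simple_poles_impossible:
  fixes p q M :: "'k::{alg_closed_field, field_char_0} poly"
  assumes eq: "[:-z, 1:] * q * M^2 = cubic_form a b c p q" and cop: "comaximal p q"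
    and D: "cubic_disc a b c \<noteq> 0" and deg: "degree p = 3" "degree q < 3" "q \<noteq> 0" 
  shows False
proof -
  obtain e1 e2 e3 where e: "e1 \<noteq> e2" "e1 \<noteq> e3" "e2 \<noteq> e3"
    and roots: "\<And>p q. cubic_form a b c p q = q * ((p - [:e1:]*q) * (p - [:e2:]*q) * (p - [:e3:]*q))"
    using monic_cubic_form_roots[OF D] by metis
  define N where "N e = p - [:e:] * q" for e
  have dN: "degree (N e) = 3" for e
    unfolding N_def using deg by (simp only: degree_diff_const_mult_left)
  have N0: "N e \<noteq> 0" for e using dN[of e] by auto
  have disj: "poly (N e') x \<noteq> 0" if "poly (N e) x = 0" "e \<noteq> e'" for e e' x
  proof
    assume "poly (N e') x = 0"
    hence "(e - e') * poly q x = 0" "poly p x = e * poly q x"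
      using that(1) by (auto simp: N_def algebra_simps)
    thus False using that(2) comaximal_poly_nonzero[OF cop, of x] by auto
  qed
  have "q * ([:-z, 1:] * M^2) = q * (N e1 * N e2 * N e3)" using eq unfolding roots N_def by (simp only: mult_ac)
  hence F: "[:-z, 1:] * M^2 = N e1 * N e2 * N e3" using deg by (metis mult_cancel_left)
  have M0: "M \<noteq> 0" using F N0 by auto
  \<comment> \<open>The factors \<open>N e\<close> have no common roots, so outside \<open>z\<close>
    each root of \<open>N e\<close> has even order. As \<open>N e\<close> has odd degree, it must
    vanish at \<open>z\<close>; two of the factors cannot both do so.\<close>
  have "poly (N e) z = 0"
    if F': "[:-z, 1:] * M^2 = N e * N e' * N e''" and ne: "e \<noteq> e'" "e \<noteq> e''" for e e' e''
  proof (rule ccontr)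
    assume z: "poly (N e) z \<noteq> 0"
    have "even (order x (N e))" if x: "poly (N e) x = 0" for x
    proof -
      have "x \<noteq> z" using x z by auto
      moreover have "[:-z, 1:] * M^2 \<noteq> 0" using M0 by (simp del: mult_pCons_left)
      ultimately have "order x ([:-z, 1:] * M^2) = 2 * order x M"
        using M0 by (simp add: order_mult order_0I power2_eq_square del: mult_pCons_left)
      moreover have "order x (N e * N e' * N e'') = order x (N e)"
        using N0 disj[OF x ne(1)] disj[OF x ne(2)] by (simp add: order_mult order_0I)
      ultimately show ?thesis using F' by simp
    qed
    hence "even (degree (N e))" using N0 by (intro even_degree_if_even_order)
    thus False using dN[of e] by simp
  qed
  from this[of e1 e2 e3] this[of e2 e1 e3] have "poly (N e1) z = 0" "poly (N e2) z = 0"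
    using F e by (auto simp: mult_ac)
  thus False using disj e(1) by blast
qed

section \<open>From the equation of the map to the normal form\<close>

lemma squarefree_square_dvd:
  fixes h u :: "'k::{alg_closed_field, field_char_0} poly"
  assumes dvd: "h^2 dvd [:a6, a4, a2, 1:] * u^2" and D: "cubic_disc a2 a4 a6 \<noteq> 0" and h: "h \<noteq> 0"
  shows "h dvd u"
proof -
  let ?f = "[:a6, a4, a2, 1:]"
  obtain d u' h' where r: "u = d * u'" "h = d * h'" "comaximal u' h'"
    using comaximal_reduction[OF h] by metis
  have "d^2 * h'^2 dvd d^2 * (u'^2 * ?f)"
    using dvd unfolding r by (simp only: power_mult_distrib mult_ac)
  hence "h'^2 dvd u'^2 * ?f" using h r(2) by (subst (asm) dvd_times_left_cancel_iff) auto
  \<comment> \<open>What remains of \<open>h\<close> after removing its common factor with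
    \<open>u\<close> has its square dividing the cubic, and a nonzero discriminant excludes a double
    root.\<close>
  hence h2: "h'^2 dvd ?f" using r(3) comaximal_commute comaximal_power comaximal_dvd_mult by metis
  have "degree h' = 0"
  proof (rule ccontr)
    assume "degree h' \<noteq> 0"
    then obtain z where "poly h' z = 0" using alg_closed_imp_poly_has_root by blast
    then obtain g where "h' = [:-z, 1:] * g" by (metis poly_eq_0_iff_dvd dvdE)
    with h2 obtain k where k: "?f = [:-z, 1:] * ([:-z, 1:] * k)"
      by (auto simp: power2_eq_square mult_ac elim!: dvdE simp del: mult_pCons_left mult_pCons_right)
    have "poly ?f z = 0" unfolding k by simp
    moreover have "poly (pderiv ?f) z = 0" unfolding k by (simp add: pderiv_mult del: mult_pCons_left)
    ultimately have "a6 + z * (a4 + z * (a2 + z)) = 0" "a4 + z * (2*a2 + z * 3) = 0"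
      by (simp_all add: pderiv_pCons)
    hence "cubic_disc a2 a4 a6 = 0" unfolding cubic_disc_def by algebra
    thus False using D by simp
  qed
  hence "h' dvd 1" using h r(2) by (simp add: is_unit_iff_degree)
  thus ?thesis unfolding r by (meson dvd_refl mult_dvd_mono unit_imp_dvd)
qed

text \<open>Coefficient comparison with the double pole at 0. The squared factor is
  \<open>p' x - 2 p\<close>, the Wronskian of \<open>p\<close> and \<open>x^2\<close> divided by
  \<open>x\<close>. The coefficient of \<open>x^9\<close> gives \<open>C * P3 = 1\<close>, those of
  1 and \<open>x\<close> give \<open>P0\<close> and \<open>P1\<close>, those of \<open>x^8\<close>,
  \<open>x^7\<close>, \<open>x^6\<close> give the quotient curve, and that of \<open>x^5\<close>
  gives the condition \<open>A4^2 = 4*A2*A6\<close>.\<close>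

lemma three_isogeny_coefficients:
  fixes A2 A4 A6 P0 P1 P2 P3 b2 b4 b6 C :: "'k::field_char_0"
  assumes eq: "[:A6, A4, A2, 1:] * [:-2*P0, -P1, 0, P3:]^2 =
      smult C ([:P0, P1, P2, P3:]^3 + [:b2:] * [:P0, P1, P2, P3:]^2 * [:0,0,1:]
        + [:b4:] * [:P0, P1, P2, P3:] * [:0,0,1:]^2 + [:b6:] * [:0,0,1:]^3)"
    and nz: "C \<noteq> 0" "P0 \<noteq> 0" "P3 \<noteq> 0"
  shows "A6 \<noteq> 0" "A4^2 = 4*A2*A6" "3*P2 + b2 = P3 * A2"
    "3*P2^2 + 2*b2*P2 + b4 = P3^2 * (-9*A4)"
    "P2^3 + b2*P2^2 + b4*P2 + b6 = P3^3 * (-27*A6 - 8*A2*A4)"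
proof -
  have l: "[:A6, A4, A2, 1:] * [:-2*P0, -P1, 0, P3:]^2 =
    [:4*A6*P0^2, 4*A4*P0^2 + 4*A6*P0*P1, 4*A2*P0^2 + 4*A4*P0*P1 + A6*P1^2,
      4*A2*P0*P1 + A4*P1^2 - 4*A6*P0*P3 + 4*P0^2,
      A2*P1^2 - 4*A4*P0*P3 - 2*A6*P1*P3 + 4*P0*P1, -4*A2*P0*P3 - 2*A4*P1*P3 + P1^2,
      -2*A2*P1*P3 + A6*P3^2 - 4*P0*P3, A4*P3^2 - 2*P1*P3, A2*P3^2, P3^2:]"
    by (simp add: power2_eq_square; algebra)
  have r: "[:P0, P1, P2, P3:]^3 + [:b2:] * [:P0, P1, P2, P3:]^2 * [:0,0,1:]
        + [:b4:] * [:P0, P1, P2, P3:] * [:0,0,1:]^2 + [:b6:] * [:0,0,1:]^3 =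
    [:P0^3, 3*P0^2*P1, 3*P0^2*P2 + P0^2*b2 + 3*P0*P1^2,
      3*P0^2*P3 + 6*P0*P1*P2 + 2*P0*P1*b2 + P1^3,
      6*P0*P1*P3 + 3*P0*P2^2 + 2*P0*P2*b2 + P0*b4 + 3*P1^2*P2 + P1^2*b2,
      6*P0*P2*P3 + 2*P0*P3*b2 + 3*P1^2*P3 + 3*P1*P2^2 + 2*P1*P2*b2 + P1*b4,
      3*P0*P3^2 + 6*P1*P2*P3 + 2*P1*P3*b2 + P2^3 + P2^2*b2 + P2*b4 + b6,
      3*P1*P3^2 + 3*P2^2*P3 + 2*P2*P3*b2 + P3*b4, 3*P2*P3^2 + P3^2*b2, P3^3:]"
    by (simp add: power2_eq_square power3_eq_cube; algebra)
  have e: "4*A6*P0^2 = C * P0^3" "4*A4*P0^2 + 4*A6*P0*P1 = C * (3*P0^2*P1)"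
    "-4*A2*P0*P3 - 2*A4*P1*P3 + P1^2 =
      C * (6*P0*P2*P3 + 2*P0*P3*b2 + 3*P1^2*P3 + 3*P1*P2^2 + 2*P1*P2*b2 + P1*b4)"
    "-2*A2*P1*P3 + A6*P3^2 - 4*P0*P3 =
      C * (3*P0*P3^2 + 6*P1*P2*P3 + 2*P1*P3*b2 + P2^3 + P2^2*b2 + P2*b4 + b6)"
    "A4*P3^2 - 2*P1*P3 = C * (3*P1*P3^2 + 3*P2^2*P3 + 2*P2*P3*b2 + P3*b4)"
    "A2*P3^2 = C * (3*P2*P3^2 + P3^2*b2)" "P3^2 = C * P3^3"
    using eq unfolding l r smult_pCons pCons_eq_iff by blast+
  have C: "C * P3 = 1" using e(7) nz by algebra
  have "4*A6 = C * P0" using e(1) nz by algebra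
  hence P0: "P0 = 4*A6*P3" using C by algebra
  show A6: "A6 \<noteq> 0" using P0 nz by auto
  have "A4 * P0 = 2*A6*P1" using e(2) P0 C nz by algebra
  hence "2*A6 * P1 = 2*A6 * (2*A4*P3)" unfolding P0 by algebra
  hence P1: "P1 = 2*A4*P3" using A6 by (metis mult_cancel_left mult_eq_0_iff zero_neq_numeral)
  show B2: "3*P2 + b2 = P3 * A2" using e(6) C nz by algebra
  hence b2: "b2 = P3 * A2 - 3*P2" by algebra
  have "P3 * (A4*P3 - 2*P1) = P3 * (3*P1 + C * (3*P2^2 + 2*P2*b2 + b4))" using e(5) C by algebra
  hence "A4*P3 - 2*P1 = 3*P1 + C * (3*P2^2 + 2*P2*b2 + b4)" using nz(3) by simp
  thus B4: "3*P2^2 + 2*b2*P2 + b4 = P3^2 * (-9*A4)" unfolding P1 using C by algebra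
  hence b4: "b4 = P3^2 * (-9*A4) - 3*P2^2 - 2*b2*P2" by algebra
  show "P2^3 + b2*P2^2 + b4*P2 + b6 = P3^3 * (-27*A6 - 8*A2*A4)"
    using e(4) C unfolding P1 P0 b4 b2 by algebra
  have "6 * P3^2 * A4^2 = 6 * P3^2 * (4*A2*A6)"
    using e(3) C unfolding P1 P0 b4 b2 by algebra
  thus "A4^2 = 4*A2*A6" using nz(3) by simp
qed

lemma degree_cubic_form:
  fixes p q :: "'k::{alg_closed_field, field_char_0} poly"
  assumes "degree p > degree q" "q \<noteq> 0" "cubic_disc a b c \<noteq> 0"
  shows "degree (cubic_form a b c p q) = 3 * degree p + degree q" "cubic_form a b c p q \<noteq> 0"
proof -
  obtain e1 e2 e3 where
    roots: "cubic_form a b c p q = q * ((p - [:e1:]*q) * (p - [:e2:]*q) * (p - [:e3:]*q))"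
    using monic_cubic_form_roots[OF assms(3)] by metis
  have d: "degree (p - [:e:]*q) = degree p" for e
    using assms(1) by (rule degree_diff_const_mult_left)
  hence nz: "p - [:e:]*q \<noteq> 0" for e using assms(1) by (metis degree_0 not_less0)
  show "degree (cubic_form a b c p q) = 3 * degree p + degree q"
    unfolding roots using nz d assms(2) by (simp add: degree_mult_eq del: mult_pCons_left)
  show "cubic_form a b c p q \<noteq> 0" unfolding roots using nz assms(2) by (simp del: mult_pCons_left)
qed

lemma three_isogeny_normal_form_of_double_pole:
  fixes p q M :: "'k::field_char_0 poly"
  assumes eq: "[:a6, a4, a2, 1:] * M^2 = cubic_form b2 b4 b6 p q"
    and W: "wronskian p q = M * [:t:]" and t: "t \<noteq> 0"
    and q: "q = smult l ([:-z, 1:]^2)" "l \<noteq> 0" and p: "degree p = 3" "poly p z \<noteq> 0"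
  shows "three_isogeny_normal_form a2 a4 a6 b2 b4 b6"
proof -
  define L where "L = [:-z, 1:]"
  define f where "f = [:a6, a4, a2, 1:]"
  define G where "G = p^3 + [:b2:]*p^2*q + [:b4:]*p*q^2 + [:b6:]*q^3"
  \<comment> \<open>The Wronskian of \<open>p\<close> and \<open>l L^2\<close> without its obvious
    factor \<open>l L\<close>.\<close>
  define w where "w = pderiv p * L - (p + p)"
  have L0: "L \<noteq> 0" by (simp add: L_def)
  have q': "q = [:l:] * L^2" using q(1) by (simp add: L_def)
  have dq: "pderiv q = [:l:] * (2 * L)"
    unfolding q' L_def by (simp add: pderiv_smult pderiv_mult pderiv_pCons power2_eq_square numeral_poly algebra_simps)
  have Ww: "[:l:] * L * w = M * [:t:]"
    using W unfolding wronskian_def dq unfolding q' w_def by algebra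
  have "f * M^2 = q * G" using eq by (simp only: cubic_form_def f_def G_def)
  hence "[:l:] * L^2 * ([:l:] * (f * w^2)) = [:l:] * L^2 * ([:t:]^2 * G)"
    using Ww unfolding q' by algebra
  moreover have "[:l:] * L^2 \<noteq> 0" using L0 q(2) by simp
  ultimately have main: "[:l:] * (f * w^2) = [:t:]^2 * G" by (metis mult_cancel_left)
  \<comment> \<open>Translation of the pole from \<open>z\<close> to 0.\<close>
  define sh where "sh r = pcompose r [:z, 1:]" for r :: "'k poly"
  have sh: "sh (r + s) = sh r + sh s" "sh (r - s) = sh r - sh s" "sh (r * s) = sh r * sh s"
    "sh (r ^ n) = sh r ^ n" "sh [:c:] = [:c:]" for r s n c
  proof -
    show "sh (r ^ n) = sh r ^ n" by (induction n) (simp_all add: sh_def pcompose_mult pcompose_1)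
  qed (simp_all add: sh_def pcompose_add pcompose_diff pcompose_mult)
  have shL: "sh L = [:0, 1:]" by (simp add: sh_def L_def pcompose_pCons)
  \<comment> \<open>Both \<open>p\<close> and \<open>q\<close> are written with the factor
    \<open>l\<close>, which then cancels as \<open>l^3\<close>.\<close>
  obtain P0 P1 P2 P3 where P: "sh p = [:l:] * [:P0, P1, P2, P3:]"
  proof -
    have "degree (sh p) \<le> 3" by (simp add: sh_def degree_pcompose p(1))
    hence "sh p = [:coeff (sh p) 0, coeff (sh p) 1, coeff (sh p) 2, coeff (sh p) 3:]"
      by (intro poly_eqI) (auto simp: coeff_pCons coeff_eq_0 numeral_2_eq_2 numeral_3_eq_3 split: nat.splits)
    hence "sh p = [:l:] * [:coeff (sh p) 0 / l, coeff (sh p) 1 / l, coeff (sh p) 2 / l, coeff (sh p) 3 / l:]"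
      using q(2) by simp
    thus ?thesis by (rule that)
  qed
  have P0: "P0 \<noteq> 0"
  proof
    assume "P0 = 0"
    hence "poly (sh p) 0 = 0" by (simp add: P)
    thus False using p(2) by (simp add: sh_def poly_pcompose)
  qed
  have P3: "P3 \<noteq> 0"
  proof
    assume "P3 = 0"
    hence "degree (sh p) \<le> 2" by (simp add: P)
    thus False by (simp add: sh_def degree_pcompose p(1))
  qed
  have "sh (pderiv p) = pderiv (sh p)"
    by (simp add: sh_def pderiv_pcompose pderiv_pCons)
  hence shw: "sh w = [:l:] * [:-2*P0, -P1, 0, P3:]"
    unfolding w_def sh shL P by (simp add: pderiv_pCons pderiv_smult algebra_simps)
  define A2 where "A2 = 3*z + a2"
  define A4 where "A4 = 3*z^2 + 2*a2*z + a4"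
  define A6 where "A6 = z^3 + a2*z^2 + a4*z + a6"
  have shf: "sh f = [:A6, A4, A2, 1:]"
    by (simp add: sh_def f_def pcompose_pCons A2_def A4_def A6_def; algebra)
  have "[:l:] * (sh f * sh w ^2) = [:t:]^2 * sh G"
    using arg_cong[OF main, of sh] by (simp only: sh)
  moreover have "sh G = sh p ^ 3 + [:b2:] * sh p ^ 2 * sh q + [:b4:] * sh p * sh q ^ 2 + [:b6:] * sh q ^ 3"
    by (simp only: G_def sh)
  moreover have "sh q = [:l:] * [:0,0,1:]" by (simp only: q' sh shL) (simp add: power2_eq_square)
  ultimately have "[:l:]^3 * ([:A6, A4, A2, 1:] * [:-2*P0, -P1, 0, P3:]^2) = [:l:]^3 * ([:t:]^2 *
     ([:P0, P1, P2, P3:]^3 + [:b2:] * [:P0, P1, P2, P3:]^2 * [:0,0,1:]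
        + [:b4:] * [:P0, P1, P2, P3:] * [:0,0,1:]^2 + [:b6:] * [:0,0,1:]^3))"
    unfolding shf shw P by algebra
  hence "[:A6, A4, A2, 1:] * [:-2*P0, -P1, 0, P3:]^2 = [:t:]^2 *
     ([:P0, P1, P2, P3:]^3 + [:b2:] * [:P0, P1, P2, P3:]^2 * [:0,0,1:]
        + [:b4:] * [:P0, P1, P2, P3:] * [:0,0,1:]^2 + [:b6:] * [:0,0,1:]^3)"
    by (rule mult_left_cancel[THEN iffD1, rotated]) (simp add: q(2))
  moreover have "[:t:]^2 * r = smult (t^2) r" for r by (simp add: power2_eq_square)
  ultimately have "[:A6, A4, A2, 1:] * [:-2*P0, -P1, 0, P3:]^2 = smult (t^2)
     ([:P0, P1, P2, P3:]^3 + [:b2:] * [:P0, P1, P2, P3:]^2 * [:0,0,1:]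
        + [:b4:] * [:P0, P1, P2, P3:] * [:0,0,1:]^2 + [:b6:] * [:0,0,1:]^3)"
    by (simp only:)
  note c = three_isogeny_coefficients[OF this _ P0 P3]
  show ?thesis unfolding three_isogeny_normal_form_def
  proof (intro exI conjI)
    show "P3 \<noteq> 0" by fact
    show "A6 \<noteq> 0" "A4^2 = 4*A2*A6" "3*P2 + b2 = P3 * A2"
      "3*P2^2 + 2*b2*P2 + b4 = P3^2 * (-9*A4)"
      "P2^3 + b2*P2^2 + b4*P2 + b6 = P3^3 * (-27*A6 - 8*A2*A4)"
      using t by (intro c, simp)+
  qed (rule A2_def A4_def A6_def)+
qed

text \<open>Squarefreeness of the cubic removes \<open>h\<close>. The equations
  \<open>3 + 2 deg M = 9 + deg q\<close> and \<open>deg M + deg s < 3 + deg q\<close> leave only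
  \<open>deg q = 2\<close> with constant cofactor \<open>s\<close>, which expresses the invariance
  of the differential. Either the zeros of \<open>q\<close> coincide and the normal form results, or
  they are abscissas of points of order two, which is impossible.\<close>

lemma three_isogeny_normal_form_of_map:
  fixes p q g h :: "'k::{alg_closed_field, field_char_0} poly"
  assumes eq: "[:a6, a4, a2, 1:] * (g * q^2)^2 = h^2 * cubic_form b2 b4 b6 p q" "h \<noteq> 0"
    and cop: "comaximal p q" and deg: "degree p = 3" "degree q < 3" "q \<noteq> 0"
    and D: "cubic_disc a2 a4 a6 \<noteq> 0" "cubic_disc b2 b4 b6 \<noteq> 0"
  shows "three_isogeny_normal_form a2 a4 a6 b2 b4 b6"
proof -
  let ?f = "[:a6, a4, a2, 1:]"
  let ?F = "cubic_form b2 b4 b6 p q"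
  have "h dvd g * q^2" using eq D(1) by (intro squarefree_square_dvd[of h a6 a4 a2]) auto
  then obtain M where M: "g * q^2 = h * M" by blast
  have "h^2 * (?f * M^2) = h^2 * ?F" using eq(1) unfolding M by (simp only: power_mult_distrib mult_ac)
  hence fM: "?f * M^2 = ?F" using eq(2) by (metis mult_cancel_left power_not_zero)
  have degF: "degree ?F = 9 + degree q" "?F \<noteq> 0" using degree_cubic_form[of q p] deg D(2) by auto
  hence M0: "M \<noteq> 0" using fM by auto
  have "degree (?f * M^2) = 3 + 2 * degree M" using M0
    by (subst degree_mult_eq) (auto simp: degree_power_eq)
  hence dM: "3 + 2 * degree M = 9 + degree q" using fM degF(1) by simp
  have W0: "wronskian p q \<noteq> 0" using wronskian_eq_0[OF _ cop] deg by auto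
  have dvd: "M dvd wronskian p q" by (rule dvd_wronskian[OF fM cop D(2)])
  then obtain s where s: "wronskian p q = M * s" by blast
  have "degree M + degree s < 3 + degree q"
    using degree_wronskian[OF W0] W0 s deg(1) by (auto simp: degree_mult_eq)
  hence dq: "degree q = 2" "degree s = 0" using dM deg(2) by linarith+
  obtain t where t: "s = [:t:]" using dq(2) by (rule degree_eq_zeroE)
  have t0: "t \<noteq> 0" using W0 s t by auto
  have s: "wronskian p q = M * [:t:]" using s t by simp
  obtain z1 z2 l where q: "q = smult l ([:-z1, 1:] * [:-z2, 1:])" "l \<noteq> 0"
  proof -
    obtain z1 where "poly q z1 = 0" using alg_closed_imp_poly_has_root dq by force
    then obtain k where k: "q = [:-z1, 1:] * k" by (metis poly_eq_0_iff_dvd dvdE)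
    hence "degree k = 1" using dq deg(3) by (auto simp: degree_mult_eq simp del: mult_pCons_left)
    then obtain b c where "k = [:b, c:]" "c \<noteq> 0"
      by (cases k) (auto split: if_splits elim!: degree_eq_zeroE)
    hence "q = smult c ([:-z1, 1:] * [:-(-b/c), 1:])" unfolding k by (simp add: field_simps)
    thus ?thesis using that \<open>c \<noteq> 0\<close> by blast
  qed
  have qz: "poly q z1 = 0" "poly q z2 = 0"
    unfolding q(1) poly_smult poly_mult by simp_all
  have pz: "poly p z1 \<noteq> 0" "poly p z2 \<noteq> 0"
    using comaximal_poly_nonzero[OF cop, of z1] comaximal_poly_nonzero[OF cop, of z2] qz by auto
  show ?thesis
  proof (cases "z1 = z2")
    case True
    show ?thesis
      by (rule three_isogeny_normal_form_of_double_pole[OF fM s t0 _ q(2) deg(1) pz(1)])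
        (simp only: q True power2_eq_square)
  next
    case False
    \<comment> \<open>At a simple zero of \<open>q\<close> the Wronskian equals
      \<open>- p q'\<close> and is nonzero, so \<open>M\<close> does not vanish there and the zero
      of the form must come from the cubic.\<close>
    have root: "poly ?f x = 0" if "poly q x = 0" "poly (pderiv q) x \<noteq> 0" "poly p x \<noteq> 0" for x
    proof -
      have "poly (wronskian p q) x \<noteq> 0" using that by (simp add: wronskian_def)
      hence "poly M x \<noteq> 0" using s by auto
      moreover have "poly (?f * M^2) x = 0" unfolding fM using that(1) by (simp add: cubic_form_def)
      ultimately show ?thesis by (simp only: poly_mult poly_power mult_eq_0_iff power_eq_0_iff) simp
    qed
    have "poly (pderiv q) z1 \<noteq> 0" "poly (pderiv q) z2 \<noteq> 0"
      using False q(2) unfolding q(1) pderiv_smult pderiv_mult poly_smult poly_add poly_mult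
      by (simp_all add: pderiv_pCons)
    hence "poly ?f z1 = 0" "poly ?f z2 = 0" using root qz pz by blast+
    hence r: "a6 + z1 * (a4 + z1 * (a2 + z1)) = 0" "a6 + z2 * (a4 + z2 * (a2 + z2)) = 0" by simp_all
    \<comment> \<open>The third root of the cubic.\<close>
    define z where "z = - (a2 + z1 + z2)"
    have "(z1 - z2) * (a4 - (z1*z2 + z1*z + z2*z)) = 0" using r unfolding z_def by algebra
    hence a4: "a4 = z1*z2 + z1*z + z2*z" using False by simp
    have a6: "a6 = - (z1*z2*z)" using r unfolding a4 z_def by algebra
    have a2: "a2 = - (z + z1 + z2)" by (simp add: z_def)
    have f: "?f = [:-z, 1:] * ([:-z1, 1:] * [:-z2, 1:])"
      unfolding a2 a4 a6 by (simp add: algebra_simps)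
    \<comment> \<open>The square root absorbs the leading coefficient \<open>l\<close> of
      \<open>q\<close> into \<open>M\<close>.\<close>
    obtain m where m: "m^2 = 1 / l" using nth_root_exists[of 2 "1 / l"] by auto
    have "[:-z, 1:] * q * (smult m M)^2 = smult (l * m^2) (?f * M^2)"
      unfolding f q(1) by (simp add: power2_eq_square mult_ac del: mult_pCons_left mult_pCons_right)
    hence "[:-z, 1:] * q * (smult m M)^2 = ?F" using m q(2) fM by simp
    from two_simple_poles_impossible[OF this cop D(2) deg] show ?thesis by simp
  qed
qed

section \<open>Function fields\<close>

lemma is_subfieldD:
  assumes "is_subfield F"
  shows "0 \<in> F" "1 \<in> F" "x \<in> F \<Longrightarrow> y \<in> F \<Longrightarrow> x + y \<in> F" "x \<in> F \<Longrightarrow> y \<in> F \<Longrightarrow> x * y \<in> F"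
    "x \<in> F \<Longrightarrow> - x \<in> F" "x \<in> F \<Longrightarrow> inverse x \<in> F" "x \<in> F \<Longrightarrow> y \<in> F \<Longrightarrow> x - y \<in> F"
    "x \<in> F \<Longrightarrow> y \<in> F \<Longrightarrow> x / y \<in> F" "x \<in> F \<Longrightarrow> x ^ n \<in> F"
proof -
  show *: "0 \<in> F" "1 \<in> F" "\<And>x y. x \<in> F \<Longrightarrow> y \<in> F \<Longrightarrow> x + y \<in> F" "\<And>x y. x \<in> F \<Longrightarrow> y \<in> F \<Longrightarrow> x * y \<in> F"
    "\<And>x. x \<in> F \<Longrightarrow> - x \<in> F" "\<And>x. x \<in> F \<Longrightarrow> inverse x \<in> F"
    using assms unfolding is_subfield_def by blast+
  show "x \<in> F \<Longrightarrow> y \<in> F \<Longrightarrow> x - y \<in> F" using *(3)[of x "-y"] *(5) by simp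
  show "x \<in> F \<Longrightarrow> y \<in> F \<Longrightarrow> x / y \<in> F" using *(4)[of x "inverse y"] *(6) by (simp add: divide_inverse)
  show "x \<in> F \<Longrightarrow> x ^ n \<in> F" by (induction n) (use * in auto)
qed

lemma is_subfield_adjoin: "is_subfield (adjoin \<iota> S)"
  unfolding adjoin_def by (rule hull_in) (auto simp: is_subfield_def)

lemma range_subset_adjoin: "\<iota> c \<in> adjoin \<iota> S"
  unfolding adjoin_def by (rule hull_inc) auto

lemma subset_adjoin: "s \<in> S \<Longrightarrow> s \<in> adjoin \<iota> S"
  unfolding adjoin_def by (rule hull_inc) auto

lemma adjoin_least: "is_subfield F \<Longrightarrow> range \<iota> \<subseteq> F \<Longrightarrow> S \<subseteq> F \<Longrightarrow> adjoin \<iota> S \<subseteq> F"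
  unfolding adjoin_def by (rule hull_minimal) auto

lemmas adjoin_closed = is_subfieldD[OF is_subfield_adjoin]

locale field_embedding =
  fixes \<iota> :: "'k::field \<Rightarrow> 'a::field"
  assumes hom: "field_hom_on UNIV \<iota>"
begin

lemma
  shows \<iota>_add: "\<iota> (a + b) = \<iota> a + \<iota> b" and \<iota>_mult: "\<iota> (a * b) = \<iota> a * \<iota> b" and \<iota>_1 [simp]: "\<iota> 1 = 1"
  using hom by (auto simp: field_hom_on_def)

lemma \<iota>_0 [simp]: "\<iota> 0 = 0" using \<iota>_add[of 0 0] by (metis add.right_neutral add_left_cancel)

lemma \<iota>_minus: "\<iota> (- a) = - \<iota> a" using \<iota>_add[of a "-a"] by (simp add: eq_neg_iff_add_eq_0 add.commute)

lemma \<iota>_diff: "\<iota> (a - b) = \<iota> a - \<iota> b" using \<iota>_add[of a "-b"] by (simp add: \<iota>_minus)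

lemma \<iota>_eq_0 [simp]: "\<iota> a = 0 \<longleftrightarrow> a = 0"
proof
  assume "\<iota> a = 0"
  hence "\<iota> (a * inverse a) = 0" by (simp add: \<iota>_mult)
  thus "a = 0" by (metis \<iota>_1 right_inverse zero_neq_one)
qed simp

lemma \<iota>_inverse: "\<iota> (inverse a) = inverse (\<iota> a)"
proof (cases "a = 0")
  case False
  hence "\<iota> a * \<iota> (inverse a) = 1" by (simp flip: \<iota>_mult)
  thus ?thesis by (metis inverse_unique)
qed simp

lemma \<iota>_power: "\<iota> (a ^ n) = \<iota> a ^ n" by (induction n) (simp_all add: \<iota>_mult)

lemma \<iota>_eq_iff [simp]: "\<iota> a = \<iota> b \<longleftrightarrow> a = b" using \<iota>_eq_0[of "a - b"] by (simp add: \<iota>_diff del: \<iota>_eq_0)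

lemma \<iota>_numeral: "\<iota> (numeral n) = numeral n"
  by (induction n) (simp_all only: numeral.simps \<iota>_add \<iota>_1)

lemmas \<iota>_simps = \<iota>_add \<iota>_mult \<iota>_minus \<iota>_diff \<iota>_inverse \<iota>_power \<iota>_numeral

definition ev :: "'a \<Rightarrow> 'k poly \<Rightarrow> 'a" where "ev x p = poly (map_poly \<iota> p) x"

lemma ev_0 [simp]: "ev x 0 = 0" by (simp add: ev_def)

lemma ev_pCons [simp]: "ev x (pCons c p) = \<iota> c + x * ev x p"
  by (simp add: ev_def map_poly_pCons)

lemma ev_1 [simp]: "ev x 1 = 1" by (simp add: ev_def)

lemma ev_add: "ev x (p + q) = ev x p + ev x q"
proof -
  have "map_poly \<iota> (p + q) = map_poly \<iota> p + map_poly \<iota> q"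
    by (intro poly_eqI) (simp add: coeff_map_poly \<iota>_add)
  thus ?thesis by (simp add: ev_def)
qed

lemma ev_smult: "ev x (smult c p) = \<iota> c * ev x p"
  by (induction p) (simp_all add: \<iota>_mult algebra_simps)

lemma ev_mult: "ev x (p * q) = ev x p * ev x q"
  by (induction p) (simp_all add: ev_add ev_smult algebra_simps)

lemma ev_minus: "ev x (- p) = - ev x p"
  using ev_add[of x p "-p"] by (simp add: eq_neg_iff_add_eq_0 add.commute)

lemma ev_diff: "ev x (p - q) = ev x p - ev x q"
  using ev_add[of x p "-q"] by (simp add: ev_minus)

lemma ev_power: "ev x (p ^ n) = ev x p ^ n" by (induction n) (simp_all add: ev_mult)

lemmas ev_simps = ev_add ev_mult ev_minus ev_diff ev_smult ev_power

abbreviation tr :: "'a \<Rightarrow> bool" where "tr x \<equiv> transcendental_over \<iota> x"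

lemma tr_ev: "tr x \<Longrightarrow> ev x p = 0 \<longleftrightarrow> p = 0"
  unfolding transcendental_over_def ev_def by auto

abbreviation K :: "'a \<Rightarrow> 'a set" where "K x \<equiv> adjoin \<iota> {x}"

lemma ev_mem: "is_subfield F \<Longrightarrow> range \<iota> \<subseteq> F \<Longrightarrow> x \<in> F \<Longrightarrow> ev x p \<in> F"
  by (induction p) (auto intro: is_subfieldD)

lemma ev_mem_adjoin: "x \<in> adjoin \<iota> S \<Longrightarrow> ev x p \<in> adjoin \<iota> S"
  by (rule ev_mem[OF is_subfield_adjoin]) (auto intro: range_subset_adjoin)

lemma K_iff:
  assumes x: "tr x"
  shows "z \<in> K x \<longleftrightarrow> (\<exists>a b. b \<noteq> 0 \<and> z = ev x a / ev x b)"
proof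
  let ?R = "{ev x a / ev x b | a b. b \<noteq> 0}"
  have I: "ev x a / ev x b \<in> ?R" if "b \<noteq> 0" for a b using that by blast
  have "is_subfield ?R" unfolding is_subfield_def
  proof (intro conjI ballI)
    show "0 \<in> ?R" using I[of 1 0] by simp
    show "1 \<in> ?R" using I[of 1 1] by simp
    fix r s assume "r \<in> ?R" "s \<in> ?R"
    then obtain a b c d where *: "r = ev x a / ev x b" "b \<noteq> 0" "s = ev x c / ev x d" "d \<noteq> 0" by blast
    have "r + s = ev x (a * d + c * b) / ev x (b * d)"
      using *(2,4) x by (simp add: *(1,3) ev_simps tr_ev divide_simps)
    thus "r + s \<in> ?R" using I[of "b * d"] * by simp
    have "r * s = ev x (a * c) / ev x (b * d)" using * by (simp add: ev_simps)
    thus "r * s \<in> ?R" using I[of "b * d"] * by simp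
  next
    fix r assume "r \<in> ?R"
    then obtain a b where *: "r = ev x a / ev x b" "b \<noteq> 0" by blast
    have "- r = ev x (- a) / ev x b" using * by (simp add: ev_simps)
    thus "- r \<in> ?R" using I[of b] * by simp
    show "inverse r \<in> ?R"
    proof (cases "a = 0")
      case True
      thus ?thesis using I[of 1 0] * by simp
    next
      case False
      have "inverse r = ev x b / ev x a" using * by simp
      thus ?thesis using I[OF False] by simp
    qed
  qed
  moreover have "\<iota> c \<in> ?R" for c using I[of 1 "[:c:]"] by simp
  moreover have "x \<in> ?R" using I[of 1 "[:0,1:]"] by simp
  ultimately have "K x \<subseteq> ?R" by (intro adjoin_least) auto
  thus "z \<in> K x \<Longrightarrow> \<exists>a b. b \<noteq> 0 \<and> z = ev x a / ev x b" by blast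
next
  assume "\<exists>a b. b \<noteq> 0 \<and> z = ev x a / ev x b"
  thus "z \<in> K x" by (auto intro: adjoin_closed(8) ev_mem_adjoin[OF subset_adjoin])
qed

lemma K_E:
  assumes "tr x" "z \<in> K x"
  obtains a b where "b \<noteq> 0" "z = ev x a / ev x b"
  using assms K_iff by blast

lemma ev_K: "ev x p \<in> K x" by (intro ev_mem_adjoin subset_adjoin) simp

lemma K_subset: "x \<in> adjoin \<iota> S \<Longrightarrow> K x \<subseteq> adjoin \<iota> S"
  by (rule adjoin_least[OF is_subfield_adjoin]) (auto intro: range_subset_adjoin)

lemma adjoin_pair_iff:
  assumes x: "tr x" and y: "y^2 = ev x f"
  shows "z \<in> adjoin \<iota> {x, y} \<longleftrightarrow> (\<exists>A\<in>K x. \<exists>B\<in>K x. z = A + B * y)"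
proof
  let ?R = "{A + B * y | A B. A \<in> K x \<and> B \<in> K x}"
  have I: "A + B * y \<in> ?R" if "A \<in> K x" "B \<in> K x" for A B using that by blast
  note cl = adjoin_closed ev_K
  have I0: "A \<in> ?R" if "A \<in> K x" for A using I[OF that adjoin_closed(1)] by simp
  have mult: "r * s \<in> ?R" if rs: "r \<in> ?R" "s \<in> ?R" for r s
  proof -
    obtain A B C D where *: "r = A + B * y" "s = C + D * y" "A \<in> K x" "B \<in> K x" "C \<in> K x" "D \<in> K x"
      using rs by blast
    have "r * s = (A * C + B * D * ev x f) + (A * D + B * C) * y"
      unfolding * y[symmetric] by (simp add: power2_eq_square algebra_simps)
    moreover have "A * C + B * D * ev x f \<in> K x" "A * D + B * C \<in> K x" using * by (auto intro!: cl)
    ultimately show ?thesis using I by simp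
  qed
  have "is_subfield ?R" unfolding is_subfield_def
  proof (intro conjI ballI)
    show "0 \<in> ?R" by (intro I0 cl)
    show "1 \<in> ?R" by (intro I0 cl)
    fix r s assume r: "r \<in> ?R" "s \<in> ?R"
    then obtain A B C D where *: "r = A + B * y" "s = C + D * y" "A \<in> K x" "B \<in> K x" "C \<in> K x" "D \<in> K x"
      by blast
    have "r + s = (A + C) + (B + D) * y" using * by (simp add: algebra_simps)
    moreover have "A + C \<in> K x" "B + D \<in> K x" using * by (auto intro!: cl)
    ultimately show "r + s \<in> ?R" using I by simp
    show "r * s \<in> ?R" by (rule mult[OF r])
  next
    fix r assume "r \<in> ?R"
    then obtain A B where *: "r = A + B * y" "A \<in> K x" "B \<in> K x" by blast
    have "- r = (- A) + (- B) * y" using * by simp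
    moreover have "- A \<in> K x" "- B \<in> K x" using * by (auto intro!: cl)
    ultimately show "- r \<in> ?R" using I[of "- A" "- B"] by simp
    show "inverse r \<in> ?R"
    proof (cases "A - B * y = 0")
      \<comment> \<open>The norm can vanish for a nonzero element if \<open>y\<close> lies in
        \<open>k(x)\<close>; in this case the element is \<open>2 A\<close> and lies in
        \<open>k(x)\<close> itself.\<close>
      case True
      hence "r = A + A" using * by simp
      hence "inverse r \<in> K x" using *(2) by (simp only: adjoin_closed(3,6))
      thus ?thesis by (rule I0)
    next
      case False
      have "r * (A - B * y) = A^2 - B^2 * ev x f" unfolding *(1) y[symmetric] by (simp add: power2_eq_square algebra_simps)
      hence N: "r * (A - B * y) \<in> K x" using * by (auto intro!: cl)
      have "inverse r = (A + (- B) * y) * (inverse (r * (A - B * y)) + 0 * y)"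
        using False by simp
      also have "\<dots> \<in> ?R" using *(2,3) N by (intro mult I adjoin_closed(1,5,6))
      finally show ?thesis .
    qed
  qed
  moreover have "\<iota> c \<in> ?R" for c by (intro I0 range_subset_adjoin)
  moreover have "x \<in> ?R" by (intro I0 subset_adjoin) simp
  moreover have "y \<in> ?R" using I[OF adjoin_closed(1,2)] by simp
  ultimately have "adjoin \<iota> {x, y} \<subseteq> ?R" by (intro adjoin_least) auto
  thus "z \<in> adjoin \<iota> {x, y} \<Longrightarrow> \<exists>A\<in>K x. \<exists>B\<in>K x. z = A + B * y" by blast
next
  have "K x \<subseteq> adjoin \<iota> {x, y}" by (intro K_subset subset_adjoin) simp
  moreover assume "\<exists>A\<in>K x. \<exists>B\<in>K x. z = A + B * y"
  ultimately show "z \<in> adjoin \<iota> {x, y}" by (auto intro!: adjoin_closed intro: subset_adjoin)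
qed

text \<open>A polynomial of odd degree is no square in \<open>k(x)\<close>:
  \<open>A^2 = B^2 f\<close> would equate an even and an odd degree.\<close>

lemma pair_independent:
  assumes x: "tr x" and y: "y^2 = ev x f" and f: "odd (degree f)"
    and AB: "A \<in> K x" "B \<in> K x" "A + B * y = 0"
  shows "A = 0 \<and> B = 0"
proof -
  obtain a b where A: "b \<noteq> 0" "A = ev x a / ev x b" using x AB(1) by (rule K_E)
  obtain c d where B: "d \<noteq> 0" "B = ev x c / ev x d" using x AB(2) by (rule K_E)
  have "A = - (B * y)" using AB(3) by (simp add: eq_neg_iff_add_eq_0)
  hence "A^2 = B^2 * ev x f" by (simp add: power_mult_distrib y)
  hence "ev x ((a * d)^2) = ev x ((c * b)^2 * f)"
    using A B x by (simp add: ev_simps tr_ev power_divide divide_simps power_mult_distrib)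
  hence "ev x ((a * d)^2 - (c * b)^2 * f) = 0" by (simp add: ev_diff)
  hence eq: "(a * d)^2 = (c * b)^2 * f" using tr_ev[OF x] by simp
  have "c = 0"
  proof (rule ccontr)
    assume "c \<noteq> 0"
    moreover have "f \<noteq> 0" using f by auto
    ultimately have "a * d \<noteq> 0" using eq A(1) by auto
    hence "2 * degree (a * d) = 2 * degree (c * b) + degree f"
      using arg_cong[OF eq, of degree] \<open>c \<noteq> 0\<close> A(1) \<open>f \<noteq> 0\<close> by (simp add: degree_mult_eq degree_power_eq)
    thus False using f by presburger
  qed
  thus ?thesis using B AB(3) by simp
qed

end

lemma field_hom_onD:
  assumes h: "field_hom_on F h" and F: "is_subfield F"
  shows "h 0 = 0" "h 1 = 1" "x \<in> F \<Longrightarrow> y \<in> F \<Longrightarrow> h (x + y) = h x + h y"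
    "x \<in> F \<Longrightarrow> y \<in> F \<Longrightarrow> h (x * y) = h x * h y" "x \<in> F \<Longrightarrow> h (- x) = - h x"
    "x \<in> F \<Longrightarrow> h (inverse x) = inverse (h x)" "x \<in> F \<Longrightarrow> h (x ^ n) = h x ^ n"
    "x \<in> F \<Longrightarrow> y \<in> F \<Longrightarrow> h (x - y) = h x - h y"
proof -
  show *: "h 1 = 1" "\<And>x y. x \<in> F \<Longrightarrow> y \<in> F \<Longrightarrow> h (x + y) = h x + h y"
    "\<And>x y. x \<in> F \<Longrightarrow> y \<in> F \<Longrightarrow> h (x * y) = h x * h y"
    using h by (auto simp: field_hom_on_def)
  note D = is_subfieldD[OF F]
  show h0: "h 0 = 0" using *(2)[OF D(1) D(1)] by (metis add.right_neutral add_left_cancel)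
  show m: "\<And>x. x \<in> F \<Longrightarrow> h (- x) = - h x"
    using *(2)[OF _ D(5)] h0 by (metis add.right_inverse eq_neg_iff_add_eq_0 add.commute)
  show "x \<in> F \<Longrightarrow> h (inverse x) = inverse (h x)"
    using *(3)[OF _ D(6)] h0 *(1) by (cases "x = 0") (auto, metis right_inverse inverse_unique)
  show "x \<in> F \<Longrightarrow> h (x ^ n) = h x ^ n" by (induction n) (auto simp: * D)
  show "x \<in> F \<Longrightarrow> y \<in> F \<Longrightarrow> h (x - y) = h x - h y" using *(2)[of x "-y"] D(5) m by simp
qed

context field_embedding
begin

lemma hom_ev:
  assumes h: "field_hom_on F h" "\<And>c. h (\<iota> c) = \<iota> c" and F: "is_subfield F" "range \<iota> \<subseteq> F" "x \<in> F"
  shows "h (ev x p) = ev (h x) p"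
  using F by (induction p) (auto simp: field_hom_onD[OF h(1) F(1)] h(2) is_subfieldD ev_mem range_subsetD)

lemma hom_image_adjoin:
  assumes h: "field_hom_on (adjoin \<iota> S) h" "\<And>c. h (\<iota> c) = \<iota> c"
  shows "h ` adjoin \<iota> S = adjoin \<iota> (h ` S)"
proof
  note hD = field_hom_onD[OF h(1) is_subfield_adjoin]
  let ?F = "{z \<in> adjoin \<iota> S. h z \<in> adjoin \<iota> (h ` S)}"
  have "is_subfield ?F" unfolding is_subfield_def by (auto simp: hD intro: adjoin_closed)
  moreover have "range \<iota> \<subseteq> ?F" by (auto simp: h(2) range_subset_adjoin)
  moreover have "S \<subseteq> ?F" by (auto intro: subset_adjoin)
  ultimately have "adjoin \<iota> S \<subseteq> ?F" by (rule adjoin_least)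
  thus "h ` adjoin \<iota> S \<subseteq> adjoin \<iota> (h ` S)" by auto
  let ?G = "h ` adjoin \<iota> S"
  have "is_subfield ?G" unfolding is_subfield_def
  proof (intro conjI ballI)
    show "0 \<in> ?G" by (metis hD(1) adjoin_closed(1) imageI)
    show "1 \<in> ?G" by (metis hD(2) adjoin_closed(2) imageI)
    fix x y assume "x \<in> ?G" "y \<in> ?G"
    then obtain x' y' where *: "x' \<in> adjoin \<iota> S" "y' \<in> adjoin \<iota> S" "x = h x'" "y = h y'" by auto
    show "x + y \<in> ?G" "x * y \<in> ?G" unfolding *(3,4) using *(1,2)
      by (simp_all only: hD(3,4)[symmetric] imageI adjoin_closed)
  next
    fix x assume "x \<in> ?G"
    then obtain x' where *: "x' \<in> adjoin \<iota> S" "x = h x'" by auto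
    show "- x \<in> ?G" "inverse x \<in> ?G" unfolding *(2) using *(1)
      by (simp_all only: hD(5,6)[symmetric] imageI adjoin_closed)
  qed
  moreover have "range \<iota> \<subseteq> ?G" by (metis h(2) image_eqI range_subset_adjoin image_subsetI)
  moreover have "h ` S \<subseteq> ?G" by (auto intro: subset_adjoin)
  ultimately show "adjoin \<iota> (h ` S) \<subseteq> ?G" by (rule adjoin_least)
qed

lemma pair_fraction:
  assumes x: "tr x" and y: "y^2 = ev x f" and z: "z \<in> adjoin \<iota> {x, y}"
  obtains a b d where "d \<noteq> 0" "z = (ev x a + ev x b * y) / ev x d"
proof -
  obtain A B where AB: "A \<in> K x" "B \<in> K x" "z = A + B * y"
    using z unfolding adjoin_pair_iff[OF x y] by blast
  obtain a b where A: "b \<noteq> 0" "A = ev x a / ev x b" using x AB(1) by (rule K_E)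
  obtain c d where B: "d \<noteq> 0" "B = ev x c / ev x d" using x AB(2) by (rule K_E)
  have "z = (ev x (a * d) + ev x (c * b) * y) / ev x (b * d)"
    unfolding AB(3) A(2) B(2) using A(1) B(1) x by (simp add: ev_simps tr_ev divide_simps)
  thus ?thesis using A B by (intro that[of "b * d" "a * d" "c * b"]) auto
qed

lemma pair_eq_iff:
  assumes x: "tr x" and y: "y^2 = ev x f" and f: "odd (degree f)"
  shows "ev x a + ev x b * y = ev x c + ev x d * y \<longleftrightarrow> a = c \<and> b = d"
proof
  assume "ev x a + ev x b * y = ev x c + ev x d * y"
  hence "ev x (a - c) + ev x (b - d) * y = 0" by (simp add: ev_diff algebra_simps)
  from pair_independent[OF x y f ev_K ev_K this] show "a = c \<and> b = d"
    by (simp add: tr_ev[OF x])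
qed simp

text \<open>The field is \<open>k(x)\<close> with a formal square root of \<open>f\<close> adjoined,
  so any solution \<open>(x', y')\<close> over a transcendental \<open>x'\<close> is the image of
  \<open>(x, y)\<close>. The map is read off from a chosen representation as a fraction;
  independence of \<open>1\<close> and \<open>y\<close> over \<open>k(x)\<close> makes the choice
  irrelevant.\<close>

lemma hom_extension:
  assumes x: "tr x" and y: "y^2 = ev x f" and f: "odd (degree f)"
    and x': "tr x'" and y': "y'^2 = ev x' f"
  obtains h where "field_hom_on (adjoin \<iota> {x, y}) h" "\<And>c. h (\<iota> c) = \<iota> c" "h x = x'" "h y = y'"
proof -
  define val where "val u v a b d = (ev u a + ev u b * v) / ev u d" for u v a b d
  define h where "h z = (SOME w. \<exists>a b d. d \<noteq> 0 \<and> z = val x y a b d \<and> w = val x' y' a b d)" for z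
  have h: "h (val x y a b d) = val x' y' a b d" if d: "d \<noteq> 0" for a b d
  proof -
    show ?thesis unfolding h_def
    proof (rule some_equality)
      show "\<exists>a' b' d'. d' \<noteq> 0 \<and> val x y a b d = val x y a' b' d' \<and> val x' y' a b d = val x' y' a' b' d'"
        using d by blast
      fix w assume "\<exists>a' b' d'. d' \<noteq> 0 \<and> val x y a b d = val x y a' b' d' \<and> w = val x' y' a' b' d'"
      then obtain a' b' d' where *: "d' \<noteq> 0" "val x y a b d = val x y a' b' d'" "w = val x' y' a' b' d'"
        by blast
      have "ev x (a * d') + ev x (b * d') * y = ev x (a' * d) + ev x (b' * d) * y"
        using *(2) d *(1) unfolding val_def by (simp add: ev_simps tr_ev[OF x] frac_eq_eq algebra_simps)
      hence eq: "a * d' = a' * d" "b * d' = b' * d" using pair_eq_iff[OF x y f] by blast+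
      have "ev x' (a * d') + ev x' (b * d') * y' = ev x' (a' * d) + ev x' (b' * d) * y'" by (simp add: eq)
      thus "w = val x' y' a b d" unfolding *(3) val_def using d *(1)
        by (simp add: ev_simps tr_ev[OF x'] frac_eq_eq algebra_simps)
    qed
  qed
  have add: "val u v a b d + val u v a' b' d' = val u v (a * d' + a' * d) (b * d' + b' * d) (d * d')"
    if "tr u" "d \<noteq> 0" "d' \<noteq> 0" for u v a b d a' b' d'
    unfolding val_def using that(2,3) by (simp add: ev_simps tr_ev[OF that(1)] add_frac_eq algebra_simps)
  have mult: "val u v a b d * val u v a' b' d' = val u v (a * a' + b * b' * f) (a * b' + a' * b) (d * d')"
    if "v^2 = ev u f" for u v a b d a' b' d'
  proof -
    have "(ev u a + ev u b * v) * (ev u a' + ev u b' * v)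
        = ev u (a * a' + b * b' * f) + ev u (a * b' + a' * b) * v"
      by (simp add: ev_simps that[symmetric] power2_eq_square algebra_simps)
    thus ?thesis unfolding val_def by (simp add: ev_simps)
  qed
  have hc: "h (\<iota> c) = \<iota> c" for c using h[of 1 "[:c:]" 0] by (simp add: val_def)
  show ?thesis
  proof (rule that)
    show "h (\<iota> c) = \<iota> c" for c by (rule hc)
    show "h x = x'" using h[of 1 "[:0,1:]" 0] by (simp add: val_def)
    show "h y = y'" using h[of 1 0 1] by (simp add: val_def)
    show "field_hom_on (adjoin \<iota> {x, y}) h" unfolding field_hom_on_def
    proof (intro conjI ballI)
      show "h 1 = 1" using hc[of 1] by simp
      fix z w assume zw: "z \<in> adjoin \<iota> {x, y}" "w \<in> adjoin \<iota> {x, y}"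
      obtain a b d where z: "d \<noteq> 0" "z = val x y a b d"
        using pair_fraction[OF x y zw(1)] unfolding val_def by blast
      obtain a' b' d' where w: "d' \<noteq> 0" "w = val x y a' b' d'"
        using pair_fraction[OF x y zw(2)] unfolding val_def by blast
      note * = z w
      have dd: "d * d' \<noteq> 0" using * by simp
      show "h (z + w) = h z + h w" "h (z * w) = h z * h w"
        unfolding *(2,4) add[OF x z(1) w(1)] mult[OF y]
        by (simp_all only: h[OF dd] h[OF z(1)] h[OF w(1)] add[OF x' z(1) w(1)] mult[OF y'])
    qed
  qed
qed

end

section \<open>Places\<close>

locale place = field_embedding \<iota> for \<iota> :: "'k::field \<Rightarrow> 'a::field" +
  fixes E V :: "'a set"
  assumes subfield: "is_subfield E" and point: "is_point \<iota> E V"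
begin

text \<open>The maximal ideal. Zero is listed separately because \<open>inverse 0 = 0\<close> lies
  in \<open>V\<close>.\<close>

definition M where "M = {z \<in> E. z = 0 \<or> inverse z \<notin> V}"

lemma V_E: "z \<in> V \<Longrightarrow> z \<in> E"
  and V_\<iota>: "\<iota> c \<in> V"
  and V_add: "a \<in> V \<Longrightarrow> b \<in> V \<Longrightarrow> a + b \<in> V"
  and V_diff: "a \<in> V \<Longrightarrow> b \<in> V \<Longrightarrow> a - b \<in> V"
  and V_mult: "a \<in> V \<Longrightarrow> b \<in> V \<Longrightarrow> a * b \<in> V"
  and V_total: "z \<in> E \<Longrightarrow> z \<notin> V \<Longrightarrow> inverse z \<in> V"
  using point unfolding is_point_def by auto

lemma V_0: "0 \<in> V" and V_1: "1 \<in> V" using V_\<iota>[of 0] V_\<iota>[of 1] by simp_all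

lemma V_minus: "a \<in> V \<Longrightarrow> - a \<in> V" using V_diff[OF V_0] by simp

lemma V_power: "a \<in> V \<Longrightarrow> a ^ n \<in> V" by (induction n) (auto intro: V_1 V_mult)

lemma V_ev: "x \<in> V \<Longrightarrow> ev x p \<in> V" by (induction p) (auto intro: V_0 V_\<iota> V_add V_mult)

lemmas E_closed = is_subfieldD[OF subfield]

lemma \<iota>_E: "\<iota> c \<in> E" using V_\<iota> V_E by blast

lemma M_V: "z \<in> M \<Longrightarrow> z \<in> V"
  using V_total[of "inverse z"] E_closed(6)[of z] V_0 unfolding M_def by auto

lemma M_E: "z \<in> M \<Longrightarrow> z \<in> E" by (simp add: M_def)

lemma M_0: "0 \<in> M" using E_closed(1) by (simp add: M_def)

lemma inverse_M: "z \<in> E \<Longrightarrow> z \<notin> V \<Longrightarrow> inverse z \<in> M"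
  using E_closed(6) by (auto simp: M_def)

lemma unit_inverse_V: "z \<in> E \<Longrightarrow> z \<notin> M \<Longrightarrow> inverse z \<in> V" by (auto simp: M_def)

lemma M_mult: "a \<in> V \<Longrightarrow> b \<in> M \<Longrightarrow> a * b \<in> M"
proof -
  assume a: "a \<in> V" and b: "b \<in> M"
  show "a * b \<in> M"
  proof (cases "a * b = 0")
    case False
    have eq: "a * inverse (a * b) = inverse b" using False by simp
    have "inverse b \<notin> V" using b False by (auto simp: M_def)
    hence "inverse (a * b) \<notin> V" using V_mult[OF a, of "inverse (a * b)"] unfolding eq by blast
    thus ?thesis using V_E[OF a] b E_closed(4) by (auto simp: M_def)
  qed (use M_0 in auto)
qed

lemma one_notin_M: "1 \<notin> M" using V_1 by (simp add: M_def)

lemma M_add: "a \<in> M \<Longrightarrow> b \<in> M \<Longrightarrow> a + b \<in> M"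
proof -
  have *: "a + b \<in> M" if "a \<in> M" "b \<in> M" "a / b \<in> V" "b \<noteq> 0" for a b
  proof -
    have "a + b = (a / b + 1) * b" using that(4) by (simp add: field_simps)
    also have "\<dots> \<in> M" using that V_1 by (intro M_mult V_add)
    finally show ?thesis .
  qed
  assume ab: "a \<in> M" "b \<in> M"
  show "a + b \<in> M"
  proof (cases "a = 0 \<or> b = 0")
    case False
    hence "a / b \<in> V \<or> b / a \<in> V"
      using V_total[of "a / b"] E_closed(8) M_E ab by auto
    thus ?thesis using *[of a b] *[of b a] ab False by (auto simp: add.commute)
  qed (use ab in auto)
qed

lemma M_minus: "a \<in> M \<Longrightarrow> - a \<in> M" using M_mult[of "-1" a] V_minus[OF V_1] by simp

lemma M_diff: "a \<in> M \<Longrightarrow> b \<in> M \<Longrightarrow> a - b \<in> M" using M_add[of a "-b"] M_minus by simp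

lemma M_\<iota>: "\<iota> c \<in> M \<longleftrightarrow> c = 0"
  using V_\<iota>[of "inverse c"] M_0 by (auto simp: M_def \<iota>_inverse)

lemma sq_V: "z \<in> E \<Longrightarrow> z^2 \<in> V \<Longrightarrow> z \<in> V"
proof (rule ccontr)
  assume *: "z \<in> E" "z^2 \<in> V" "z \<notin> V"
  hence "z^2 * inverse z \<in> V" by (intro V_mult V_total)
  moreover have "z^2 * inverse z = z" by (cases "z = 0") (simp_all add: power2_eq_square)
  ultimately show False using * by simp
qed

lemma prime_M: "a \<in> V \<Longrightarrow> b \<in> V \<Longrightarrow> a * b \<in> M \<Longrightarrow> a \<in> M \<or> b \<in> M"
proof (rule ccontr)
  assume *: "a \<in> V" "b \<in> V" "a * b \<in> M" "\<not> (a \<in> M \<or> b \<in> M)"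
  hence "inverse a * (a * b) \<in> M" using M_mult unit_inverse_V V_E by blast
  moreover have "a \<noteq> 0" using * M_0 by auto
  ultimately show False using * by (simp flip: mult.assoc)
qed

lemma sq_M: "z \<in> E \<Longrightarrow> z^2 \<in> M \<Longrightarrow> z \<in> M"
  using sq_V[of z] M_V prime_M[of z z] by (auto simp: power2_eq_square)

lemma unit_add: "u \<in> V \<Longrightarrow> u \<notin> M \<Longrightarrow> m \<in> M \<Longrightarrow> u + m \<in> V \<and> u + m \<notin> M"
  using M_diff[of "u + m" m] V_add M_V by auto

lemma unit_mult: "u \<notin> M \<Longrightarrow> w \<notin> M \<Longrightarrow> u \<in> V \<Longrightarrow> w \<in> V \<Longrightarrow> u * w \<in> V \<and> u * w \<notin> M"
  using prime_M V_mult by blast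

lemma unit_inverse: "u \<in> V \<Longrightarrow> u \<notin> M \<Longrightarrow> inverse u \<in> V \<and> inverse u \<notin> M"
  using unit_inverse_V[of u] V_E[of u] M_0 by (auto simp: M_def)

lemma mult_M_notin_V: "w \<in> E \<Longrightarrow> m \<in> M \<Longrightarrow> w * m \<notin> M \<Longrightarrow> w \<notin> V"
  using M_mult by blast

lemma inverse_M_notin_V: "z \<in> M \<Longrightarrow> z \<noteq> 0 \<Longrightarrow> inverse z \<notin> V" by (simp add: M_def)

end

locale place_at_infinity = place +
  fixes x :: 'b
  assumes x_E: "x \<in> E" and x_pole: "x \<notin> V"
begin

lemma x_nz: "x \<noteq> 0" using x_pole V_0 by auto

lemma inverse_x_M: "inverse x \<in> M" using x_E x_pole by (rule inverse_M)

lemma inverse_x_power_M: "n > 0 \<Longrightarrow> inverse x ^ n \<in> M"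
  using M_mult[OF V_power[OF M_V[OF inverse_x_M]] inverse_x_M, of "n - 1"]
  by (simp only: power_minus_mult)

text \<open>At a pole of \<open>x\<close> the leading term dominates: divided by the top power of
  \<open>x\<close>, the lower terms lie in \<open>M\<close>.\<close>

lemma ev_unit:
  assumes "p \<noteq> 0"
  obtains u where "u \<in> V" "u \<notin> M" "ev x p = x ^ degree p * u"
  using assms
proof (induction p arbitrary: thesis)
  case (pCons c p)
  show ?case
  proof (cases "p = 0")
    case True
    thus ?thesis using pCons V_\<iota>[of c] M_\<iota>[of c] by (intro pCons(3)[of "\<iota> c"]) auto
  next
    case False
    then obtain u where u: "u \<in> V" "u \<notin> M" "ev x p = x ^ degree p * u" using pCons(2) by blast
    define n where "n = degree p + 1"
    have "\<iota> c * inverse x ^ n \<in> M" by (intro M_mult V_\<iota> inverse_x_power_M) (simp add: n_def)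
    from unit_add[OF u(1,2) this]
    have w: "u + \<iota> c * inverse x ^ n \<in> V" "u + \<iota> c * inverse x ^ n \<notin> M" by auto
    have "ev x (pCons c p) = x ^ n * (u + \<iota> c * inverse x ^ n)"
      using x_nz by (simp add: u(3) n_def algebra_simps power_inverse)
    thus ?thesis using w False by (intro pCons(3)[OF w]) (simp add: n_def)
  qed
qed simp

lemma x_tr: "tr x"
  unfolding transcendental_over_def
proof (intro allI impI)
  fix p :: "'a poly" assume "p \<noteq> 0"
  then obtain u where "u \<notin> M" "ev x p = x ^ degree p * u" by (rule ev_unit)
  thus "poly (map_poly \<iota> p) x \<noteq> 0" using x_nz M_0 by (auto simp flip: ev_def)
qed

text \<open>On \<open>k(x)\<close> the ring \<open>V\<close> induces the place at infinity, where
  the order of a fraction is a difference of degrees.\<close>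

lemma fraction_V_iff:
  assumes "b \<noteq> 0"
  shows "ev x a / ev x b \<in> V \<longleftrightarrow> a = 0 \<or> degree a \<le> degree b"
    and "ev x a / ev x b \<in> M \<longleftrightarrow> a = 0 \<or> degree a < degree b"
proof -
  have *: "(ev x a / ev x b \<in> V \<longleftrightarrow> degree a \<le> degree b) \<and> (ev x a / ev x b \<in> M \<longleftrightarrow> degree a < degree b)"
    if a: "a \<noteq> 0"
  proof -
    obtain u where u: "u \<in> V" "u \<notin> M" "ev x a = x ^ degree a * u" using a by (rule ev_unit)
    obtain w where w: "w \<in> V" "w \<notin> M" "ev x b = x ^ degree b * w" using assms by (rule ev_unit)
    define t where "t = u * inverse w"
    have t: "t \<in> V" "t \<notin> M" using unit_mult[of u "inverse w"] unit_inverse[OF w(1,2)] u by (auto simp: t_def)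
    have t0: "t \<noteq> 0" using t M_0 by auto
    have q: "ev x a / ev x b = x ^ degree a / x ^ degree b * t"
      by (simp add: u(3) w(3) t_def divide_inverse)
    consider "degree a < degree b" | "degree a = degree b" | "degree a > degree b" by linarith
    thus ?thesis
    proof cases
      case 1
      hence "ev x a / ev x b = t * inverse x ^ (degree b - degree a)"
        unfolding q using x_nz by (simp add: power_diff power_inverse field_simps)
      also have "\<dots> \<in> M" using 1 t by (intro M_mult inverse_x_power_M) auto
      finally show ?thesis using 1 M_V by auto
    next
      case 2
      thus ?thesis using t x_nz by (simp add: q)
    next
      case 3
      have "inverse (ev x a / ev x b) = inverse t * inverse x ^ (degree a - degree b)"
        unfolding q using x_nz 3 by (simp add: power_diff power_inverse field_simps)
      also have "\<dots> \<in> M" using 3 t unit_inverse by (intro M_mult inverse_x_power_M) auto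
      finally have "inverse (ev x a / ev x b) \<in> M" .
      moreover have "inverse (ev x a / ev x b) \<noteq> 0" using a assms x_tr by (simp add: tr_ev)
      ultimately have "inverse (inverse (ev x a / ev x b)) \<notin> V" by (rule inverse_M_notin_V)
      thus ?thesis using 3 M_V by auto
    qed
  qed
  thus "ev x a / ev x b \<in> V \<longleftrightarrow> a = 0 \<or> degree a \<le> degree b"
    "ev x a / ev x b \<in> M \<longleftrightarrow> a = 0 \<or> degree a < degree b"
    using V_0 M_0 by (cases "a = 0"; simp)+
qed

text \<open>The degrees of \<open>A^2\<close> and \<open>(B y)^2 = B^2 f\<close> have opposite
  parity, so one summand dominates the other and no cancellation can hide a pole.\<close>

lemma split_V:
  assumes y: "y^2 = ev x f" "y \<in> E" and f: "odd (degree f)" and K: "K x \<subseteq> E"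
    and AB: "A \<in> K x" "B \<in> K x" "A + B * y \<in> V"
  shows "A \<in> V" "B * y \<in> V"
proof -
  have E: "A \<in> E" "B * y \<in> E" using AB K y(2) E_closed(4) by auto
  have small: "r \<in> V \<and> s \<in> V" if "r / s \<in> M" "r + s \<in> V" "s \<noteq> 0" "s \<in> E" for r s
  proof -
    have u: "1 + r / s \<in> V" "1 + r / s \<notin> M" using unit_add[OF V_1 one_notin_M that(1)] by auto
    have nz: "1 + r / s \<noteq> 0" using u(2) M_0 by auto
    have "r + s = s * (1 + r / s)" using that(3) by (simp add: field_simps)
    hence "s = (r + s) * inverse (1 + r / s)" using nz by simp
    moreover have "(r + s) * inverse (1 + r / s) \<in> V"
      using unit_inverse[OF u] by (intro V_mult that(2)) simp
    ultimately have s: "s \<in> V" by (simp only:)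
    have "r = (r + s) - s" by simp
    thus ?thesis using s V_diff[OF that(2) s] by simp
  qed
  have "A \<in> V \<and> B * y \<in> V"
  proof (cases "A = 0 \<or> B * y = 0")
    case True
    thus ?thesis using AB V_0 by auto
  next
    case False
    obtain a b where A: "b \<noteq> 0" "A = ev x a / ev x b" using x_tr AB(1) by (rule K_E)
    obtain c d where B: "d \<noteq> 0" "B = ev x c / ev x d" using x_tr AB(2) by (rule K_E)
    have nz: "a \<noteq> 0" "c \<noteq> 0" "f \<noteq> 0" using False A B f by auto
    define p where "p = (a * d)^2"
    define q where "q = (b * c)^2 * f"
    have pq: "p \<noteq> 0" "q \<noteq> 0" "degree p = 2 * degree (a * d)" "degree q = 2 * degree (b * c) + degree f"
      unfolding p_def q_def using A(1) B(1) nz by (simp_all add: degree_mult_eq degree_power_eq)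
    hence "degree p \<noteq> degree q" using f by presburger
    hence "ev x p / ev x q \<in> M \<or> ev x q / ev x p \<in> M" using fraction_V_iff(2) pq(1,2) by auto
    moreover have "ev x p / ev x q = (A / (B * y))^2" "ev x q / ev x p = (B * y / A)^2"
      unfolding p_def q_def A(2) B(2) by (simp_all add: ev_simps power_divide power_mult_distrib y(1)[symmetric] mult_ac)
    ultimately have "A / (B * y) \<in> M \<or> B * y / A \<in> M"
      using sq_M[OF E_closed(8)[OF E]] sq_M[OF E_closed(8)[OF E(2,1)]] by auto
    thus ?thesis
    proof
      assume "A / (B * y) \<in> M"
      thus ?thesis using small[of A "B * y"] AB(3) False E by blast
    next
      assume "B * y / A \<in> M"
      moreover have "B * y + A \<in> V" using AB(3) by (simp add: add.commute)
      ultimately show ?thesis using small[of "B * y" A] False E by blast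
    qed
  qed
  thus "A \<in> V" "B * y \<in> V" by auto
qed

end

text \<open>Membership of \<open>A\<close> and of \<open>(B y)^2\<close> is decided by degrees in
  \<open>k(x)\<close>, and \<open>sq_V\<close> passes from \<open>(B y)^2\<close> to
  \<open>B y\<close>. The lemma serves to recognise the pullback of an origin.\<close>

lemma (in field_embedding) place_at_infinity_unique:
  assumes y: "y^2 = ev x f" and f: "odd (degree f)" and E: "E = adjoin \<iota> {x, y}"
    and V: "is_point \<iota> E V" "x \<notin> V" and V': "is_point \<iota> E V'" "x \<notin> V'"
  shows "V = V'"
proof -
  have sub: "V \<subseteq> V'" if V: "is_point \<iota> E V" "x \<notin> V" and V': "is_point \<iota> E V'" "x \<notin> V'" for V V'
  proof
    have E': "is_subfield E" "x \<in> E" "y \<in> E" "K x \<subseteq> E"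
      unfolding E by (simp_all add: is_subfield_adjoin subset_adjoin K_subset)
    interpret V: place_at_infinity \<iota> E V x by unfold_locales (use V E' in auto)
    interpret V': place_at_infinity \<iota> E V' x by unfold_locales (use V' E' in auto)
    fix z assume z: "z \<in> V"
    have "z \<in> adjoin \<iota> {x, y}" using V.V_E[OF z] E by simp
    then obtain A B where AB: "A \<in> K x" "B \<in> K x" "z = A + B * y"
      unfolding adjoin_pair_iff[OF V.x_tr y] by blast
    have *: "r \<in> V'" if r: "r \<in> K x" "r \<in> V" for r
    proof -
      obtain a b where "b \<noteq> 0" "r = ev x a / ev x b" using V.x_tr r(1) by (rule K_E)
      thus ?thesis using V.fraction_V_iff(1)[of b a] V'.fraction_V_iff(1)[of b a] r(2) by simp
    qed
    have AV: "A \<in> V" "B * y \<in> V"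
      using z unfolding AB(3) by (rule V.split_V[OF y E'(3) f E'(4) AB(1,2)])+
    have "(B * y)^2 \<in> K x" unfolding power_mult_distrib y using AB(2) by (intro adjoin_closed(4,9) ev_K)
    from *[OF this V.V_power[OF AV(2)]] have "(B * y)^2 \<in> V'" .
    with V.V_E[OF AV(2)] have "B * y \<in> V'" by (rule V'.sq_V)
    with *[OF AB(1) AV(1)] show "z \<in> V'" unfolding AB(3) by (rule V'.V_add)
  qed
  show ?thesis using sub[OF V V'] sub[OF V' V] by blast
qed

section \<open>Chords of a cubic, and points over \<open>k(x)\<close>\<close>

lemma third_point_on_cubic:
  fixes x y x0 y0 :: "'a::field"
  assumes y: "y^2 = a6 + x * (a4 + x * (a2 + x))" and y0: "y0^2 = a6 + x0 * (a4 + x0 * (a2 + x0))"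
    and ne: "x \<noteq> x0" and l: "l = (y - y0) / (x - x0)"
    and x': "x' = l^2 - a2 - x - x0" and y': "y' = y0 + l * (x' - x0)"
  shows "y'^2 = a6 + x' * (a4 + x' * (a2 + x'))"
proof -
  \<comment> \<open>The cubic minus the square of the line differs from
    \<open>(z - x0) (z - x) (z - x')\<close> by \<open>\<alpha> z + \<beta>\<close>, the choice of
    \<open>x'\<close> having cancelled the quadratic terms. This linear remainder vanishes at
    \<open>x\<close> and \<open>x0\<close>, hence identically.\<close>
  define \<alpha> where "\<alpha> = a4 - (l * (y0 - l * x0) + l * (y0 - l * x0)) - (x0 * x + x0 * x' + x * x')"
  define \<beta> where "\<beta> = a6 - (y0 - l * x0)^2 + x0 * x * x'"
  have a2: "a2 = l^2 - x' - x - x0" using x' by simp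
  have id: "a6 + z * (a4 + z * (a2 + z)) - (y0 + l * (z - x0))^2 = (z - x0) * (z - x) * (z - x') + (\<alpha> * z + \<beta>)"
    for z unfolding \<alpha>_def \<beta>_def a2 by (simp add: algebra_simps power2_eq_square)
  have "l * (x - x0) = y - y0" using ne l by simp
  hence "\<alpha> * x + \<beta> = 0" "\<alpha> * x0 + \<beta> = 0" using id[of x] id[of x0] y y0 by simp_all
  hence "(\<alpha> * x + \<beta>) - (\<alpha> * x0 + \<beta>) = 0" by simp
  hence "\<alpha> * (x - x0) = 0" by (simp add: right_diff_distrib)
  hence "\<alpha> = 0" using ne by simp
  hence "\<beta> = 0" using \<open>\<alpha> * x + \<beta> = 0\<close> by simp
  show ?thesis using id[of x'] \<open>\<alpha> = 0\<close> \<open>\<beta> = 0\<close> by (simp add: y')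
qed

lemma square_dvd_square_poly:
  fixes h u :: "'k::field poly"
  assumes dvd: "h^2 dvd u^2" and h: "h \<noteq> 0"
  shows "h dvd u"
proof -
  obtain d u' h' where r: "u = d * u'" "h = d * h'" "comaximal u' h'"
    using comaximal_reduction[OF h] by metis
  have "d^2 * h'^2 dvd d^2 * u'^2" using dvd unfolding r by (simp only: power_mult_distrib)
  hence "h'^2 dvd u'^2 * 1" using h r(2) by (subst (asm) dvd_times_left_cancel_iff) auto
  hence "h'^2 dvd 1" using r(3) comaximal_commute comaximal_power comaximal_dvd_mult by blast
  hence "h' dvd 1" by (metis dvd_trans dvd_power zero_less_numeral)
  thus ?thesis unfolding r by (meson dvd_refl mult_dvd_mono unit_imp_dvd)
qed

context field_embedding
begin

text \<open>The exponent four is even, so clearing the denominator changes the value of the cubic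
  only by a square; this is the reason for the extra factor \<open>q\<close> in
  \<open>cubic_form\<close>.\<close>

lemma ev_cubic_form:
  assumes "ev x q \<noteq> 0"
  shows "ev x (cubic_form b2 b4 b6 p q) = ev x q ^ 4 * ev (ev x p / ev x q) [:b6, b4, b2, 1:]"
proof -
  define r where "r = ev x p / ev x q"
  have p: "ev x p = r * ev x q" using assms by (simp add: r_def)
  show ?thesis unfolding cubic_form_def r_def[symmetric] ev_mult ev_add ev_power p
    by (simp add: algebra_simps power2_eq_square power3_eq_cube power4_eq_xxxx)
qed

lemma K_reduced_fraction:
  assumes "tr x" "r \<in> K x"
  obtains p q where "q \<noteq> 0" "comaximal p q" "r = ev x p / ev x q"
proof -
  obtain a b where ab: "b \<noteq> 0" "r = ev x a / ev x b" using assms by (rule K_E)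
  obtain d p q where d: "a = d * p" "b = d * q" "comaximal p q" using comaximal_reduction[OF ab(1)] .
  have "ev x d \<noteq> 0" using ab(1) d(2) tr_ev[OF assms(1)] by auto
  hence "r = ev x p / ev x q" unfolding ab(2) d(1,2) by (simp add: ev_mult)
  thus ?thesis using that d ab(1) by auto
qed

end

locale field_embedding_alg_closed = field_embedding \<iota>
  for \<iota> :: "'k::{alg_closed_field, field_char_0} \<Rightarrow> 'a::field"
begin

lemma two_nz: "(2::'a) \<noteq> 0"
proof -
  have "\<iota> 2 \<noteq> 0" unfolding \<iota>_eq_0 by simp
  thus ?thesis unfolding \<iota>_numeral .
qed

lemma double_eq_0: "z + z = (0::'a) \<longleftrightarrow> z = 0"
  using two_nz unfolding mult_2[symmetric] by simp

lemma square_eq_\<iota>: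
  assumes "z^2 = \<iota> e"
  obtains d where "z = \<iota> d"
proof -
  obtain d where "d^2 = e" using nth_root_exists[of 2 e] by auto
  hence "z^2 = (\<iota> d)^2" using assms by (auto simp: \<iota>_power)
  thus ?thesis using that[of d] that[of "-d"] by (auto simp: power2_eq_iff \<iota>_minus)
qed

lemma cubic_points_over_K_const:
  assumes x: "tr x" and R: "r \<in> K x" "s \<in> K x" and eq: "s^2 = ev r [:b6, b4, b2, 1:]"
    and D: "cubic_disc b2 b4 b6 \<noteq> 0"
  obtains c d where "r = \<iota> c" "s = \<iota> d"
proof -
  obtain p q where pq: "q \<noteq> 0" "comaximal p q" "r = ev x p / ev x q" using x R(1) by (rule K_reduced_fraction)
  obtain g h where gh: "h \<noteq> 0" "s = ev x g / ev x h" using x R(2) by (rule K_E)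
  have nz: "ev x q \<noteq> 0" "ev x h \<noteq> 0" using pq(1) gh(1) tr_ev[OF x] by auto
  let ?F = "cubic_form b2 b4 b6 p q"
  have g: "ev x g = s * ev x h" using nz(2) by (simp add: gh(2))
  have "ev x ((g * q^2)^2) = ev x (h^2 * ?F)"
    unfolding ev_mult ev_power ev_cubic_form[OF nz(1)] pq(3)[symmetric] eq[symmetric] g
    by (simp add: power_mult_distrib power2_eq_square power4_eq_xxxx mult_ac)
  hence "ev x ((g * q^2)^2 - h^2 * ?F) = 0" by (simp add: ev_diff)
  hence u: "(g * q^2)^2 = h^2 * ?F" using tr_ev[OF x] by simp
  have "h dvd g * q^2" using gh(1) by (rule square_dvd_square_poly[rotated]) (simp only: u dvd_triv_left)
  then obtain m where m: "g * q^2 = h * m" by blast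
  have "h^2 * m^2 = h^2 * ?F" using u unfolding m by (simp only: power_mult_distrib)
  hence "m^2 = ?F" by (rule mult_left_cancel[THEN iffD1, rotated]) (simp add: gh(1))
  from square_eq_cubic_form_imp_const[OF this pq(2) D pq(1)]
  obtain p0 q0 where "p = [:p0:]" "q = [:q0:]" by (auto elim!: degree_eq_zeroE)
  hence r: "r = \<iota> (p0 * inverse q0)" unfolding pq(3) by (simp add: \<iota>_simps divide_inverse)
  define c where "c = p0 * inverse q0"
  have "s^2 = \<iota> (poly [:b6, b4, b2, 1:] c)" unfolding eq r c_def[symmetric] by (simp add: \<iota>_simps)
  then obtain d where "s = \<iota> d" by (rule square_eq_\<iota>)
  thus ?thesis using that r by blast
qed

end

context field_embedding_alg_closed
begin

text \<open>Otherwise every nonzero polynomial in \<open>x\<close>, a product of linear factors up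
  to a constant, would be a unit. Then \<open>V\<close> would contain \<open>k(x)\<close>, also
  \<open>y\<close> because it contains \<open>y^2\<close>, and so the whole field.\<close>

lemma exists_residue:
  assumes x: "tr x" and y: "y^2 = ev x f" and E: "E = adjoin \<iota> {x, y}"
    and V: "is_point \<iota> E V" "x \<in> V"
  obtains c where "x - \<iota> c \<in> place.M E V"
proof -
  have sub: "is_subfield E" unfolding E by (rule is_subfield_adjoin)
  interpret place \<iota> E V by unfold_locales (use V sub in auto)
  show ?thesis
  proof (rule ccontr)
    assume "\<not> ?thesis"
    hence unit: "x - \<iota> c \<notin> M" for c using that by blast
    have ev_unit: "ev x p \<notin> M" if "p \<noteq> 0" for p using that
    proof (induction "degree p" arbitrary: p)
      case 0
      then obtain c where "p = [:c:]" by (auto elim: degree_eq_zeroE)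
      thus ?case using 0 M_\<iota> by simp
    next
      case (Suc n)
      then obtain z where "poly p z = 0" using alg_closed_imp_poly_has_root by (metis zero_less_Suc)
      then obtain q where q: "p = [:-z, 1:] * q" by (metis poly_eq_0_iff_dvd dvdE)
      hence q0: "q \<noteq> 0" using Suc by auto
      have "degree p = Suc (degree q)" unfolding q using q0 by (subst degree_mult_eq) auto
      hence "ev x q \<notin> M" using Suc q0 by simp
      moreover have "ev x p = (x - \<iota> z) * ev x q" unfolding q ev_mult by (simp add: \<iota>_minus)
      ultimately show ?case
        using unit[of z] prime_M V_ev[OF V(2)] V_diff[OF V(2) V_\<iota>] by metis
    qed
    have K: "r \<in> V" if r: "r \<in> K x" for r
    proof -
      obtain a b where ab: "b \<noteq> 0" "r = ev x a / ev x b" using x r by (rule K_E)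
      have "inverse (ev x b) \<in> V" using unit_inverse[OF V_ev[OF V(2)] ev_unit[OF ab(1)]] by simp
      thus ?thesis unfolding ab(2) divide_inverse by (intro V_mult V_ev V(2))
    qed
    have "y \<in> V" using sq_V[of y] V_ev[OF V(2), of f] unfolding y E by (simp add: subset_adjoin)
    hence "z \<in> V" if "z \<in> E" for z
      using that K V_add V_mult unfolding E adjoin_pair_iff[OF x y] by blast
    thus False using V(1) unfolding is_point_def by blast
  qed
qed

text \<open>
  Any point of the curve is moved to infinity by the involution that sends a point to the third
  point on its line through a fixed point of the curve.
\<close>
lemma exists_coordinates_with_pole:
  assumes x: "tr x" and y: "y^2 = ev x [:a6, a4, a2, 1:]" and E: "E = adjoin \<iota> {x, y}"
    and V: "is_point \<iota> E V" and D: "cubic_disc a2 a4 a6 \<noteq> 0"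
  obtains x' y' where "x' \<notin> V" "y'^2 = ev x' [:a6, a4, a2, 1:]" "E = adjoin \<iota> {x', y'}"
proof (cases "x \<in> V")
  case False
  thus ?thesis using that y E by blast
next
  case True
  let ?f = "[:a6, a4, a2, 1:]"
  have sub: "is_subfield E" unfolding E by (rule is_subfield_adjoin)
  interpret place \<iota> E V by unfold_locales (use V sub in auto)
  have xyE: "x \<in> E" "y \<in> E" unfolding E by (simp_all add: subset_adjoin)
  obtain c where c: "x - \<iota> c \<in> M" using exists_residue[OF x y E V True] .
  have xc: "x - \<iota> c \<noteq> 0" using tr_ev[OF x, of "[:-c, 1:]"] by (simp add: \<iota>_minus)
  have res: "ev x p - \<iota> (poly p c) \<in> M" for p
  proof -
    have "[:-c, 1:] dvd p - [:poly p c:]" by (simp flip: poly_eq_0_iff_dvd)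
    then obtain q where "p - [:poly p c:] = [:-c, 1:] * q" by (elim dvdE)
    hence "ev x (p - [:poly p c:]) = ev x ([:-c, 1:] * q)" by simp
    hence "ev x p - \<iota> (poly p c) = ev x q * (x - \<iota> c)"
      unfolding ev_diff ev_mult by (simp add: \<iota>_minus mult.commute)
    thus ?thesis using M_mult[OF V_ev[OF True] c] by simp
  qed
  have yV: "y \<in> V" using sq_V[of y] V_ev[OF True, of ?f] xyE y by simp
  \<comment> \<open>\<open>(c, w)\<close> are the coordinates of the point \<open>V\<close>;
    primality of \<open>M\<close> selects the right square root.\<close>
  obtain w where w: "w^2 = poly ?f c" "y - \<iota> w \<in> M"
  proof -
    obtain w where w: "w^2 = poly ?f c" using nth_root_exists[of 2 "poly ?f c"] by auto
    have "(y - \<iota> w) * (y + \<iota> w) = ev x ?f - \<iota> (poly ?f c)"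
      unfolding y[symmetric] w[symmetric] by (simp add: \<iota>_power \<iota>_mult power2_eq_square algebra_simps)
    hence "(y - \<iota> w) * (y - \<iota> (- w)) \<in> M" using res[of ?f] by (simp add: \<iota>_minus)
    hence "y - \<iota> w \<in> M \<or> y - \<iota> (- w) \<in> M" by (intro prime_M V_diff yV V_\<iota>)
    thus ?thesis using that[of w] that[of "-w"] w by auto
  qed
  \<comment> \<open>The slope of the chord from the generic point to \<open>(c, -w)\<close>, the
    conjugate of the point \<open>V\<close>. At \<open>V\<close> the chord becomes vertical, which
    is why the third point acquires a pole there.\<close>
  define l where "l = (y - \<iota> (- w)) / (x - \<iota> c)"
  have lE: "l \<in> E" unfolding l_def using xyE \<iota>_E by (intro E_closed)
  have lV: "l \<notin> V"
  proof (cases "w = 0")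
    case False
    have "\<iota> (w + w) \<notin> M" unfolding M_\<iota> using False by simp
    hence "\<iota> (w + w) + (y - \<iota> w) \<notin> M" using unit_add[OF V_\<iota> _ w(2)] by blast
    moreover have "l * (x - \<iota> c) = \<iota> (w + w) + (y - \<iota> w)"
      unfolding l_def \<iota>_add \<iota>_minus using xc by simp
    ultimately show ?thesis using mult_M_notin_V[OF lE c] by simp
  next
    \<comment> \<open>At a point of order two the numerator vanishes as well; instead
      \<open>l * y\<close> is a unit because \<open>c\<close> is a simple root, while
      \<open>y\<close> lies in \<open>M\<close>.\<close>
    case True
    hence fc: "poly ?f c = 0" using w(1) by simp
    then obtain g where g: "?f = [:-c, 1:] * g" by (metis poly_eq_0_iff_dvd dvdE)
    have "poly g c \<noteq> 0"
    proof
      assume "poly g c = 0"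
      hence "poly (pderiv ?f) c = 0" unfolding g by (simp add: pderiv_mult pderiv_pCons del: mult_pCons_left)
      hence "a4 + c * (2*a2 + c * 3) = 0" by (simp add: pderiv_pCons)
      moreover have "a6 + c * (a4 + c * (a2 + c)) = 0" using fc by simp
      ultimately have "cubic_disc a2 a4 a6 = 0" unfolding cubic_disc_def by algebra
      thus False using D by simp
    qed
    hence "\<iota> (poly g c) \<notin> M" by (simp add: M_\<iota>)
    hence "\<iota> (poly g c) + (ev x g - \<iota> (poly g c)) \<notin> M" using unit_add[OF V_\<iota> _ res] by blast
    moreover have "l * y = \<iota> (poly g c) + (ev x g - \<iota> (poly g c))"
    proof -
      have "l * y = y^2 / (x - \<iota> c)" by (simp add: l_def True power2_eq_square)
      also have "y^2 = (x - \<iota> c) * ev x g" unfolding y g ev_mult by (simp add: \<iota>_minus)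
      finally show ?thesis using xc by simp
    qed
    ultimately show ?thesis using mult_M_notin_V[OF lE, of y] w(2) True by simp
  qed
  define x' where "x' = l^2 - \<iota> a2 - x - \<iota> c"
  define y' where "y' = \<iota> (- w) + l * (x' - \<iota> c)"
  have "l^2 = x' + \<iota> a2 + x + \<iota> c" by (simp add: x'_def)
  hence x'V: "x' \<notin> V" using sq_V[OF lE] lV True by (auto intro: V_add V_\<iota>)
  have y'2: "y'^2 = \<iota> a6 + x' * (\<iota> a4 + x' * (\<iota> a2 + x'))"
  proof (rule third_point_on_cubic[OF _ _ _ l_def x'_def y'_def])
    show "y^2 = \<iota> a6 + x * (\<iota> a4 + x * (\<iota> a2 + x))" using y by simp
    show "(\<iota> (- w))^2 = \<iota> a6 + \<iota> c * (\<iota> a4 + \<iota> c * (\<iota> a2 + \<iota> c))"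
      using w(1) by (simp flip: \<iota>_power \<iota>_add \<iota>_mult)
    show "x \<noteq> \<iota> c" using xc by simp
  qed
  have "E = adjoin \<iota> {x', y'}"
  proof
    have "x' \<in> E" unfolding x'_def by (intro E_closed(7,9) \<iota>_E lE xyE)
    moreover from this have "y' \<in> E" unfolding y'_def by (intro E_closed(3,4,7) \<iota>_E lE)
    ultimately have x'E: "x' \<in> E" "y' \<in> E" .
    show "adjoin \<iota> {x', y'} \<subseteq> E" using x'E \<iota>_E by (intro adjoin_least subfield) auto
    \<comment> \<open>The old and the new point lie on the same chord, so its slope and then the old
      coordinates are recovered from the new ones.\<close>
    have "x' - \<iota> c \<noteq> 0" using x'V V_\<iota>[of c] by auto
    hence l': "l = (y' - \<iota> (- w)) / (x' - \<iota> c)" by (simp add: y'_def)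
    have m: "x' \<in> adjoin \<iota> {x', y'}" "y' \<in> adjoin \<iota> {x', y'}" by (simp_all add: subset_adjoin)
    have lm: "l \<in> adjoin \<iota> {x', y'}" unfolding l' using m by (intro adjoin_closed range_subset_adjoin)
    have "x = l^2 - \<iota> a2 - x' - \<iota> c" by (simp add: x'_def)
    hence xm: "x \<in> adjoin \<iota> {x', y'}" using adjoin_closed(7,9) range_subset_adjoin lm m(1) by metis
    have "y = \<iota> (- w) + l * (x - \<iota> c)" using xc by (simp add: l_def)
    hence "y \<in> adjoin \<iota> {x', y'}" using adjoin_closed(3,4,7) range_subset_adjoin lm xm by metis
    thus "E \<subseteq> adjoin \<iota> {x', y'}" unfolding E using xm
      by (intro adjoin_least is_subfield_adjoin) (auto intro: range_subset_adjoin)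
  qed
  thus ?thesis using that x'V y'2 by simp
qed

end

context place
begin

text \<open>Here \<open>w^2\<close> is \<open>z^3\<close> times a unit, so the squares of
  \<open>z / w\<close> and \<open>1 / w\<close> are units times powers of \<open>1 / z\<close>;
  \<open>sq_M\<close> then extracts the square roots without an integer-valued valuation.\<close>

lemma cubic_point_near_infinity:
  assumes z: "z \<in> E" "z \<notin> V" and w: "w \<in> E" "w^2 = ev z [:b6, b4, b2, 1:]"
  shows "w \<noteq> 0" "z / w \<in> M" "1 / w \<in> M"
proof -
  interpret z: place_at_infinity \<iota> E V z by unfold_locales (use z in auto)
  have deg: "[:b6, b4, b2, 1:] \<noteq> 0" "degree [:b6, b4, b2, 1:] = 3" by simp_all
  obtain u where u: "u \<in> V" "u \<notin> M" "ev z [:b6, b4, b2, 1:] = z ^ 3 * u"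
    using z.ev_unit[OF deg(1)] unfolding deg(2) by blast
  have u0: "u \<noteq> 0" using u(2) M_0 by auto
  have eq: "w^2 = z^3 * u" using w(2) u(3) by simp
  show w0: "w \<noteq> 0"
  proof
    assume "w = 0"
    hence "z^3 * u = 0" using eq by simp
    thus False using u0 z.x_nz by simp
  qed
  have iu: "inverse u \<in> V" using unit_inverse[OF u(1,2)] by simp
  have "inverse u * inverse z * (z^3 * u) = (inverse u * u) * (inverse z * z) * z^2"
    by (simp add: power3_eq_cube power2_eq_square)
  hence *: "z^2 = inverse u * inverse z * w^2"
    unfolding eq left_inverse[OF u0] left_inverse[OF z.x_nz] mult_1_left by (rule sym)
  have w2: "w^2 \<noteq> 0" using w0 by simp
  have "(z / w)^2 = inverse u * inverse z"
    unfolding power_divide nonzero_divide_eq_eq[OF w2] by (rule *)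
  hence "(z / w)^2 \<in> M" using M_mult[OF iu z.inverse_x_M] by simp
  with E_closed(8)[OF z(1) w(1)] show "z / w \<in> M" by (rule sq_M)
  have "(1 / w)^2 = inverse u * inverse z ^ 3"
    unfolding power_divide eq by (simp add: divide_inverse power_inverse)
  hence "(1 / w)^2 \<in> M" using M_mult[OF iu z.inverse_x_power_M[of 3]] by simp
  with E_closed(8)[OF E_closed(2) w(1)] show "1 / w \<in> M" by (rule sq_M)
qed

text \<open>
  The line through two points near infinity has the equation \<open>m x + b y = 1\<close> with \<open>m\<close> and
  \<open>b\<close> in the maximal ideal, so it contains no constant point.
\<close>
lemma line_near_infinity:
  assumes z1: "z1 \<in> E" "z1 \<notin> V" "w1 \<in> E" "w1^2 = ev z1 [:b6, b4, b2, 1:]"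
    and z2: "z2 \<in> E" "z2 \<notin> V" "w2 \<in> E" "w2^2 = ev z2 [:b6, b4, b2, 1:]"
    and ne: "z1 \<noteq> z2"
  obtains m b where "m \<in> M" "b \<in> M" "m * z1 + b * w1 = 1" "m * z2 + b * w2 = 1"
proof -
  note n1 = cubic_point_near_infinity[OF z1] and n2 = cubic_point_near_infinity[OF z2]
  define p where "p = z1 / w1"
  define q where "q = z2 / w2"
  define r where "r = 1 / w1"
  define s where "s = 1 / w2"
  have M: "p \<in> M" "q \<in> M" "r \<in> M" "s \<in> M" using n1 n2 by (simp_all add: p_def q_def r_def s_def)
  note mV = M_V[OF M(1)] M_V[OF M(2)] M_V[OF M(3)] M_V[OF M(4)]
  \<comment> \<open>The equation of the curve divided by \<open>w^3\<close>, in the coordinates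
    \<open>k = z / w\<close> and \<open>t = 1 / w\<close> at infinity.\<close>
  have curve: "t = k^3 + \<iota> b2 * k^2 * t + \<iota> b4 * k * t^2 + \<iota> b6 * t^3"
    if "w \<noteq> 0" "w^2 = ev z [:b6, b4, b2, 1:]" "k = z / w" "t = 1 / w" for z w k t
  proof -
    have z: "z = k * w" and tw: "t * w = 1" using that by auto
    have "t^3 * w^2 = t * (t * w)^2" by (simp add: power2_eq_square power3_eq_cube)
    hence "t = t^3 * w^2" unfolding tw by simp
    also have "w^2 = \<iota> b6 + \<iota> b4 * z + \<iota> b2 * z^2 + z^3"
      using that(2) by (simp add: algebra_simps power2_eq_square power3_eq_cube)
    also have "t^3 * \<dots> = (t*w)^3 * k^3 + \<iota> b2 * (t*w)^2 * k^2 * t + \<iota> b4 * (t*w) * k * t^2 + \<iota> b6 * t^3"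
      unfolding z by (simp add: algebra_simps power2_eq_square power3_eq_cube)
    finally show ?thesis using tw by (simp add: mult_ac add_ac)
  qed
  have c1: "r = p^3 + \<iota> b2 * p^2 * r + \<iota> b4 * p * r^2 + \<iota> b6 * r^3"
    by (rule curve[OF n1(1) z1(4) p_def r_def])
  have c2: "s = q^3 + \<iota> b2 * q^2 * s + \<iota> b4 * q * s^2 + \<iota> b6 * s^3"
    by (rule curve[OF n2(1) z2(4) q_def s_def])
  \<comment> \<open>\<open>P\<close> and \<open>Q\<close> come from subtracting the two curve
    equations and factoring out \<open>p - q\<close> and \<open>r - s\<close>. As
    \<open>1 - Q\<close> is a unit, the slope \<open>P / (1 - Q)\<close> lies in
    \<open>M\<close>.\<close>
  define P where "P = p * p + p * q + q * q + \<iota> b2 * (p + q) * r + \<iota> b4 * r * r"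
  define Q where "Q = \<iota> b2 * q * q + \<iota> b4 * q * (r + s) + \<iota> b6 * (r * r + r * s + s * s)"
  have PM: "P \<in> M" "Q \<in> M" unfolding P_def Q_def
    by (intro M_add M_mult V_mult V_add V_\<iota> M mV)+
  have "r - s = (p - q) * P + (r - s) * Q"
    unfolding P_def Q_def by (subst c1, subst c2) (simp add: algebra_simps power2_eq_square power3_eq_cube)
  hence rel: "(r - s) * (1 - Q) = (p - q) * P" by (simp add: algebra_simps)
  have u: "1 - Q \<in> V" "1 - Q \<notin> M" using unit_add[OF V_1 one_notin_M M_minus[OF PM(2)]] by simp_all
  have nzQ: "1 - Q \<noteq> 0" using u(2) M_0 by auto
  have pq: "p \<noteq> q"
  proof
    assume "p = q"
    hence "r = s" using rel nzQ by simp
    hence "w1 = w2" using n1(1) n2(1) by (simp add: r_def s_def)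
    thus False using \<open>p = q\<close> n1(1) ne by (simp add: p_def q_def)
  qed
  define m where "m = P * inverse (1 - Q)"
  define b where "b = r - m * p"
  have mM: "m \<in> M" unfolding m_def using M_mult[of "inverse (1 - Q)" P] unit_inverse[OF u] PM(1)
    by (simp add: mult.commute)
  have bM: "b \<in> M" unfolding b_def by (intro M_diff M_mult M(3) M(1) M_V[OF mM])
  have "(r - s) * (1 - Q) * inverse (1 - Q) = (p - q) * m" unfolding rel m_def by simp
  hence rs: "r - s = (p - q) * m" by (simp only: mult.assoc right_inverse[OF nzQ] mult_1_right)
  show ?thesis
  proof (rule that[OF mM bM])
    have "m * p + b = r" by (simp add: b_def)
    hence "(m * p + b) * w1 = 1" using n1(1) by (simp add: r_def)
    thus "m * z1 + b * w1 = 1" using n1(1) by (simp add: p_def algebra_simps)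
    have "m * q + b = s" using rs by (simp add: b_def algebra_simps)
    hence "(m * q + b) * w2 = 1" using n2(1) by (simp add: s_def)
    thus "m * z2 + b * w2 = 1" using n2(1) by (simp add: q_def algebra_simps)
  qed
qed

end

context field_embedding_alg_closed
begin

text \<open>
  A point \<open>Q = (x', y')\<close> over the function field that lies near infinity is odd: the third point on
  the line through \<open>Q\<close> and its conjugate is defined over \<open>k(x)\<close>, hence constant.
\<close>
lemma pole_preserving_map_even:
  assumes y: "y^2 = ev x f" and f: "odd (degree f)" and E: "E = adjoin \<iota> {x, y}"
    and V: "is_point \<iota> E V" "x \<notin> V"
    and P: "x' \<in> E" "y' \<in> E" "x' \<notin> V" and eq: "y'^2 = ev x' [:b6, b4, b2, 1:]"
    and D: "cubic_disc b2 b4 b6 \<noteq> 0"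
  obtains g where "x' \<in> K x" "g \<in> K x" "y' = g * y"
proof -
  let ?f2 = "[:b6, b4, b2, 1:]"
  have E': "is_subfield E" "x \<in> E" "y \<in> E" "K x \<subseteq> E"
    unfolding E by (simp_all add: is_subfield_adjoin subset_adjoin K_subset)
  interpret place_at_infinity \<iota> E V x by unfold_locales (use V E' in auto)
  note ind = pair_independent[OF x_tr y f]
  obtain A B where AB: "A \<in> K x" "B \<in> K x" "x' = A + B * y"
    using P(1) unfolding E adjoin_pair_iff[OF x_tr y] by blast
  obtain C G where CG: "C \<in> K x" "G \<in> K x" "y' = C + G * y"
    using P(2) unfolding E adjoin_pair_iff[OF x_tr y] by blast
  have y0: "y \<noteq> 0"
  proof
    assume "y = 0"
    hence "0 + 1 * y = 0" by simp
    from ind[OF adjoin_closed(1,2) this] show False by simp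
  qed
  have const: False if "r \<in> K x" "s \<in> K x" "s^2 = ev r ?f2" "r \<notin> V" for r s
    using cubic_points_over_K_const[OF x_tr that(1-3) D] V_\<iota> that(4) by metis
  have B0: "B = 0"
  proof (rule ccontr)
    assume B: "B \<noteq> 0"
    obtain \<sigma> where \<sigma>: "field_hom_on (adjoin \<iota> {x, y}) \<sigma>" "\<And>c. \<sigma> (\<iota> c) = \<iota> c" "\<sigma> x = x" "\<sigma> y = - y"
      using hom_extension[OF x_tr y f x_tr, of "- y"] y by auto
    note \<sigma>D = field_hom_onD[OF \<sigma>(1) is_subfield_adjoin]
    have \<sigma>ev: "\<sigma> (ev z p) = ev (\<sigma> z) p" if "z \<in> adjoin \<iota> {x, y}" for z p
      by (rule hom_ev[OF \<sigma>(1,2) is_subfield_adjoin _ that]) (auto intro: range_subset_adjoin)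
    have xy: "x \<in> adjoin \<iota> {x, y}" "y \<in> adjoin \<iota> {x, y}" by (simp_all add: subset_adjoin)
    have \<sigma>K: "\<sigma> r = r" if r: "r \<in> K x" for r
    proof -
      obtain a b where ab: "b \<noteq> 0" "r = ev x a / ev x b" using x_tr r by (rule K_E)
      show ?thesis unfolding ab(2) divide_inverse using xy
        by (simp add: \<sigma>D \<sigma>ev \<sigma>(3) ev_mem_adjoin adjoin_closed)
    qed
    have KE: "r \<in> adjoin \<iota> {x, y}" if "r \<in> K x" for r using E'(4) that unfolding E by blast
    define x2 where "x2 = A - B * y"
    define y2 where "y2 = C - G * y"
    have "\<sigma> x' = x2" "\<sigma> y' = y2"
      unfolding AB(3) CG(3) x2_def y2_def using AB(1,2) CG(1,2) xy
      by (simp_all add: \<sigma>D \<sigma>K \<sigma>(4) KE adjoin_closed)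
    hence eq2: "y2^2 = ev x2 ?f2"
      using \<sigma>ev[of x' ?f2] \<sigma>D(7)[of y' 2] P(1,2) eq unfolding E by simp
    have x2E: "x2 \<in> E" "y2 \<in> E" unfolding x2_def y2_def using AB CG E' by (auto intro!: E_closed)
    \<comment> \<open>If the conjugate had no pole, both of its parts \<open>A\<close> and
      \<open>B y\<close> would lie in \<open>V\<close>, and so would \<open>x'\<close>.\<close>
    have x2V: "x2 \<notin> V"
    proof
      assume "x2 \<in> V"
      hence *: "A + (- B) * y \<in> V" by (simp add: x2_def)
      note s = split_V[OF y E'(3) f E'(4) AB(1) adjoin_closed(5)[OF AB(2)] *]
      have "A - (- B) * y \<in> V" using s by (rule V_diff)
      thus False using P(3) by (simp add: AB(3))
    qed
    have dx: "x' - x2 = B * y + B * y" "y' - y2 = G * y + G * y"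
      by (simp_all add: AB(3) CG(3) x2_def y2_def)
    have ne: "x' \<noteq> x2"
    proof
      assume "x' = x2"
      hence "B * y + B * y = 0" using dx(1) by simp
      thus False using B y0 unfolding double_eq_0 by simp
    qed
    \<comment> \<open>Numerator and denominator are multiples of \<open>y\<close>, which cancels and
      leaves a slope in \<open>k(x)\<close>.\<close>
    define l where "l = (y' - y2) / (x' - x2)"
    have "2 * y \<noteq> 0" using y0 by (simp only: mult_2 double_eq_0 not_False_eq_True)
    moreover have "l = (2 * y) * G / ((2 * y) * B)"
      unfolding l_def dx by (simp add: algebra_simps)
    ultimately have l: "l = G / B" using nonzero_mult_divide_mult_cancel_left by metis
    have lK: "l \<in> K x" unfolding l using AB(2) CG(2) by (intro adjoin_closed)
    define x3 where "x3 = l^2 - \<iota> b2 - x' - x2"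
    define y3 where "y3 = y2 + l * (x3 - x2)"
    have "y3^2 = \<iota> b6 + x3 * (\<iota> b4 + x3 * (\<iota> b2 + x3))"
      using eq eq2 ne by (intro third_point_on_cubic[OF _ _ ne l_def x3_def y3_def]) simp_all
    hence eq3: "y3^2 = ev x3 ?f2" by simp
    have x3: "x3 = l^2 - \<iota> b2 - A - A" by (simp add: x3_def AB(3) x2_def)
    have x3K: "x3 \<in> K x" unfolding x3 by (intro adjoin_closed(7,9) range_subset_adjoin lK AB(1))
    have "l * B = G" using B by (simp add: l)
    hence "y3 = C + l * (x3 - A)" by (simp add: y3_def y2_def x2_def algebra_simps)
    hence y3K: "y3 \<in> K x" using CG(1) lK x3K AB(1) by (simp add: adjoin_closed)
    obtain c d where cd: "x3 = \<iota> c" "y3 = \<iota> d" using cubic_points_over_K_const[OF x_tr x3K y3K eq3 D] .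
    obtain m b where mb: "m \<in> M" "b \<in> M" "m * x' + b * y' = 1" "m * x2 + b * y2 = 1"
      using line_near_infinity[OF P(1,3,2) eq x2E(1) x2V x2E(2) eq2 ne] .
    have "m * (x' - x2) + b * (y' - y2) = 0" using mb(3,4) by (simp add: algebra_simps)
    moreover have "y' - y2 = l * (x' - x2)" using ne by (simp add: l_def)
    ultimately have "(x' - x2) * (m + b * l) = 0" by (simp add: algebra_simps)
    hence ml: "m + b * l = 0" using ne by simp
    have "m * x3 + b * y3 = (m * x2 + b * y2) + (m + b * l) * (x3 - x2)" by (simp add: y3_def algebra_simps)
    hence "1 = \<iota> c * m + \<iota> d * b" using mb(4) ml by (simp add: cd mult.commute)
    moreover have "\<iota> c * m + \<iota> d * b \<in> M" by (intro M_add M_mult V_\<iota> mb)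
    ultimately show False using one_notin_M by simp
  qed
  hence x': "x' = A" using AB by simp
  \<comment> \<open>With \<open>x'\<close> in \<open>k(x)\<close>, the coefficient
    \<open>2 C G\<close> of \<open>y\<close> in \<open>y'^2\<close> must vanish. If \<open>G\<close>
    were 0, the point would be defined over \<open>k(x)\<close>, hence constant and without a
    pole.\<close>
  have "(C^2 + G^2 * ev x f - ev x' ?f2) + (C * G + C * G) * y = 0"
    using eq unfolding CG(3) y[symmetric] by (simp add: power2_eq_square algebra_simps)
  moreover have "C^2 + G^2 * ev x f - ev x' ?f2 \<in> K x" "C * G + C * G \<in> K x"
    unfolding x' by (intro adjoin_closed(3,4,7,9) ev_K ev_mem_adjoin AB(1) CG(1,2))+
  ultimately have "C * G + C * G = 0" using ind by blast
  hence "C * G = 0" unfolding double_eq_0 .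
  moreover have "G \<noteq> 0" using const[of x' y'] AB(1) CG P(3) eq x' by auto
  ultimately have "y' = G * y" using CG(3) by simp
  thus ?thesis using that AB(1) x' CG(2) by blast
qed

end

section \<open>Degrees of extensions\<close>

lemma is_subfield_sum: "is_subfield F \<Longrightarrow> (\<And>i. i \<in> I \<Longrightarrow> c i \<in> F) \<Longrightarrow> sum c I \<in> F"
  by (induction I rule: infinite_finite_induct) (auto intro: is_subfieldD)

text \<open>Gaussian elimination: a nonzero coefficient of the last equation removes its unknown
  from the others, and every quotient formed stays in \<open>F\<close>.\<close>

lemma homogeneous_system_solution:
  fixes c :: "nat \<Rightarrow> 'j \<Rightarrow> 'a::field"
  assumes F: "is_subfield F" and "finite J" "n < card J" "\<And>i j. i < n \<Longrightarrow> j \<in> J \<Longrightarrow> c i j \<in> F"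
  shows "\<exists>t. (\<forall>j\<in>J. t j \<in> F) \<and> (\<exists>j\<in>J. t j \<noteq> 0) \<and> (\<forall>i<n. (\<Sum>j\<in>J. c i j * t j) = 0)"
  using assms(2-)
proof (induction n arbitrary: J c)
  case 0
  hence "J \<noteq> {}" by auto
  thus ?case using is_subfieldD(2)[OF F] by (intro exI[of _ "\<lambda>_. 1"]) auto
next
  case (Suc n)
  show ?case
  proof (cases "\<forall>j\<in>J. c n j = 0")
    case True
    obtain t where "\<forall>j\<in>J. t j \<in> F" "\<exists>j\<in>J. t j \<noteq> 0" "\<forall>i<n. (\<Sum>j\<in>J. c i j * t j) = 0"
      using Suc.IH[OF Suc.prems(1), of c] Suc.prems(2,3) by auto
    thus ?thesis using True by (intro exI[of _ t]) (auto simp: less_Suc_eq)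
  next
    case False
    then obtain k where k: "k \<in> J" "c n k \<noteq> 0" by blast
    define J' where "J' = J - {k}"
    define c' where "c' i j = c i j - c i k / c n k * c n j" for i j
    have J': "finite J'" "n < card J'" "J' \<subseteq> J" using Suc.prems k by (auto simp: J'_def)
    have cF: "c i j \<in> F" if "i \<le> n" "j \<in> J" for i j using Suc.prems(3) that by auto
    have "c' i j \<in> F" if "i < n" "j \<in> J'" for i j
      unfolding c'_def using cF[of i j] cF[of i k] cF[of n k] cF[of n j] that J'(3) k(1)
      by (intro is_subfieldD(4,7,8)[OF F]) auto
    then obtain t where t: "\<forall>j\<in>J'. t j \<in> F" "\<exists>j\<in>J'. t j \<noteq> 0" "\<forall>i<n. (\<Sum>j\<in>J'. c' i j * t j) = 0"
      using Suc.IH[OF J'(1,2), of c'] by auto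
    define s where "s = (\<Sum>j\<in>J'. c n j * t j)"
    define t' where "t' j = (if j = k then - s / c n k else t j)" for j
    have sum: "(\<Sum>j\<in>J. c i j * t' j) = (\<Sum>j\<in>J'. c i j * t j) - c i k * s / c n k" for i
    proof -
      have "(\<Sum>j\<in>J. c i j * t' j) = c i k * t' k + (\<Sum>j\<in>J'. c i j * t' j)"
        unfolding J'_def using Suc.prems(1) k(1) by (rule sum.remove)
      also have "(\<Sum>j\<in>J'. c i j * t' j) = (\<Sum>j\<in>J'. c i j * t j)"
        by (intro sum.cong) (auto simp: t'_def J'_def)
      finally show ?thesis by (simp add: t'_def)
    qed
    have "(\<Sum>j\<in>J'. c i j * t j) = c i k * s / c n k" if "i < n" for i
    proof -
      have "0 = (\<Sum>j\<in>J'. c i j * t j - c i k / c n k * (c n j * t j))"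
        using t(3) that by (simp add: c'_def left_diff_distrib mult.assoc)
      also have "\<dots> = (\<Sum>j\<in>J'. c i j * t j) - c i k / c n k * s"
        by (simp only: sum_subtractf sum_distrib_left s_def)
      finally show ?thesis by simp
    qed
    hence "(\<Sum>j\<in>J. c i j * t' j) = 0" if "i < Suc n" for i
      using that k(2) unfolding sum by (cases "i = n") (auto simp: s_def)
    moreover have "s \<in> F" unfolding s_def
      using t(1) cF[of n] J'(3) by (intro is_subfield_sum[OF F] is_subfieldD(4)[OF F]) auto
    hence "t' j \<in> F" if "j \<in> J" for j
      using t(1) that is_subfieldD(5,8)[OF F] cF[of n k] k(1) by (simp add: t'_def J'_def)
    moreover have "\<exists>j\<in>J. t' j \<noteq> 0" using t(2) J'(3) by (auto simp: t'_def J'_def)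
    ultimately show ?thesis by (intro exI[of _ t']) simp
  qed
qed

text \<open>Otherwise the second basis would satisfy a nontrivial linear relation, against the
  unique expansion of 0. Invariance of the degree allows comparing the prescribed 3 with the degree
  of an explicit basis.\<close>

lemma has_degree_le:
  assumes F: "is_subfield F" and n: "has_degree E F n" and m: "has_degree E F m"
  shows "m \<le> n"
proof (rule ccontr)
  assume "\<not> m \<le> n"
  from n obtain b where
    b: "\<forall>z\<in>E. \<exists>!c. (\<forall>i<n. c i \<in> F) \<and> (\<forall>i\<ge>n. c i = 0) \<and> z = (\<Sum>i<n. c i * b i)"
    unfolding has_degree_def by (elim conjE exE)
  from m obtain d where d1: "\<forall>j<m. d j \<in> E" and
    d: "\<forall>z\<in>E. \<exists>!c. (\<forall>i<m. c i \<in> F) \<and> (\<forall>i\<ge>m. c i = 0) \<and> z = (\<Sum>i<m. c i * d i)"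
    unfolding has_degree_def by (elim conjE exE)
  have "\<forall>j. \<exists>c. j < m \<longrightarrow> (\<forall>i<n. c i \<in> F) \<and> d j = (\<Sum>i<n. c i * b i)"
  proof (intro allI)
    fix j
    show "\<exists>c. j < m \<longrightarrow> (\<forall>i<n. c i \<in> F) \<and> d j = (\<Sum>i<n. c i * b i)"
    proof (cases "j < m")
      case True
      with d1 have "d j \<in> E" by simp
      from ex1_implies_ex[OF bspec[OF b this]] show ?thesis by (elim exE conjE) (rule exI, rule impI, rule conjI)
    qed simp
  qed
  from choice[OF this] obtain c where
    c': "\<forall>j. j < m \<longrightarrow> (\<forall>i<n. c j i \<in> F) \<and> d j = (\<Sum>i<n. c j i * b i)" by blast
  have c: "c j i \<in> F" "d j = (\<Sum>i<n. c j i * b i)" if "j < m" "i < n" for i j using c' that by blast+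
  have c2: "d j = (\<Sum>i<n. c j i * b i)" if "j < m" for j using c' that by blast
  obtain t where t: "\<forall>j\<in>{..<m}. t j \<in> F" "\<exists>j\<in>{..<m}. t j \<noteq> 0"
    "\<forall>i<n. (\<Sum>j\<in>{..<m}. c j i * t j) = 0"
    using homogeneous_system_solution[OF F, of "{..<m}" n "\<lambda>i j. c j i"] c(1) \<open>\<not> m \<le> n\<close> by auto
  define t' where "t' j = (if j < m then t j else 0)" for j
  have "(\<Sum>j<m. t' j * d j) = (\<Sum>j<m. \<Sum>i<n. t j * c j i * b i)"
    by (intro sum.cong) (auto simp: t'_def c2 sum_distrib_left mult.assoc)
  also have "\<dots> = (\<Sum>i<n. (\<Sum>j<m. c j i * t j) * b i)"
    unfolding sum_distrib_right by (subst sum.swap) (simp only: mult_ac)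
  also have "\<dots> = 0" using t(3) by simp
  finally have 0: "0 = (\<Sum>j<m. t' j * d j)" by simp
  have "0 \<in> E" using n is_subfieldD(1)[OF F] unfolding has_degree_def by blast
  from bspec[OF d this] have uniq:
    "\<exists>\<^sub>\<le>\<^sub>1 c. (\<forall>i<m. c i \<in> F) \<and> (\<forall>i\<ge>m. c i = 0) \<and> 0 = (\<Sum>i<m. c i * d i)"
    unfolding ex1_iff_ex_Uniq by (rule conjunct2)
  have "t' = (\<lambda>_. 0)"
  proof (rule Uniq_D[OF uniq])
    have "(\<forall>i<m. t' i \<in> F) \<and> (\<forall>i\<ge>m. t' i = 0)" using t(1) by (simp add: t'_def)
    thus "(\<forall>i<m. t' i \<in> F) \<and> (\<forall>i\<ge>m. t' i = 0) \<and> 0 = (\<Sum>i<m. t' i * d i)" using 0 by blast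
  qed (simp add: is_subfieldD(1)[OF F])
  hence "t' j = 0" for j by simp
  hence "t j = 0" if "j < m" for j using that t'_def by metis
  thus False using t(2) by auto
qed

lemma has_degree_unique:
  "is_subfield F \<Longrightarrow> has_degree E F n \<Longrightarrow> has_degree E F m \<Longrightarrow> n = m"
  using has_degree_le by (metis le_antisym)

context field_embedding
begin

lemma ev_altdef: "ev x p = (\<Sum>i\<le>degree p. \<iota> (coeff p i) * x ^ i)"
proof -
  have "map_poly \<iota> p = (\<Sum>i\<le>degree p. monom (\<iota> (coeff p i)) i)"
    by (subst poly_as_sum_of_monoms[symmetric])
      (intro poly_eqI, simp add: coeff_map_poly coeff_sum)
  thus ?thesis by (simp add: ev_def poly_sum poly_monom)
qed

lemma ev_eq_sum_lessThan:
  assumes "degree p < n"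
  shows "ev x p = (\<Sum>i<n. \<iota> (coeff p i) * x ^ i)"
  unfolding ev_altdef using assms by (intro sum.mono_neutral_left) (auto simp: coeff_eq_0)

lemma K_common_denominator:
  assumes r: "tr r" and c: "\<forall>i<n::nat. c i \<in> K r"
  shows "\<exists>d a. d \<noteq> 0 \<and> (\<forall>i<n. c i * ev r d = ev r (a i))"
  using c
proof (induction n)
  case 0
  show ?case by (intro exI[of _ 1]) simp
next
  case (Suc n)
  then obtain d a where d: "d \<noteq> 0" "\<forall>i<n. c i * ev r d = ev r (a i)" by auto
  have "c n \<in> K r" using Suc.prems by simp
  then obtain e b where b: "b \<noteq> 0" "c n = ev r e / ev r b" using K_E[OF r] by blast
  have "ev r b \<noteq> 0" using b(1) by (simp add: tr_ev[OF r])
  hence cn: "c n * ev r b = ev r e" by (simp add: b(2))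
  define a' where "a' i = (if i = n then e * d else a i * b)" for i
  have "c i * ev r (d * b) = ev r (a' i)" if "i < Suc n" for i
  proof (cases "i = n")
    case True
    thus ?thesis using cn by (simp add: a'_def ev_mult mult.commute flip: cn)
  next
    case False
    hence "c i * ev r d = ev r (a i)" using d(2) that by simp
    thus ?thesis using False by (simp add: a'_def ev_mult mult_ac flip: \<open>c i * ev r d = ev r (a i)\<close>)
  qed
  moreover have "d * b \<noteq> 0" using d(1) b(1) by simp
  ultimately show ?case by blast
qed

end

section \<open>The degree of \<open>k(x)\<close> over \<open>k(r)\<close> for a rational function
  \<open>r\<close> with a pole at infinity\<close>

locale rational_map = field_embedding_alg_closed \<iota>
  for \<iota> :: "'k::{alg_closed_field, field_char_0} \<Rightarrow> 'a::field" +
  fixes x r :: 'a and p q :: "'k poly" and n :: nat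
  assumes x: "tr x" and r_tr: "tr r" and r: "r = ev x p / ev x q"
    and cop: "comaximal p q" and deg: "degree p = n" "degree q < n" and q0: "q \<noteq> 0"
begin

lemma ev_q: "ev x q \<noteq> 0" using q0 by (simp add: tr_ev[OF x])

lemma r_q: "r * ev x q = ev x p" using ev_q by (simp add: r)

text \<open>
  The lowest coefficients of a relation give a polynomial of degree less than \<open>n\<close> in \<open>x\<close>
  that is divisible by \<open>p\<close>.
\<close>
lemma powers_independent_poly:
  assumes "\<forall>i<n. a i = 0 \<or> degree (a i) < N" "(\<Sum>i<n. ev r (a i) * x ^ i) = 0"
  shows "\<forall>i<n. a i = 0"
  using assms
proof (induction N arbitrary: a)
  case (Suc N)
  \<comment> \<open>Splitting off the constant terms in \<open>r\<close> writes the relation as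
    \<open>A(x) + r S = 0\<close>, where \<open>S\<close> is an expression of the same kind with
    smaller degrees.\<close>
  have "\<forall>i. \<exists>c b. a i = pCons c b" by (metis pCons_cases)
  then obtain c b where ab: "\<And>i. a i = pCons (c i) (b i)" by metis
  have b: "b i = 0 \<or> degree (b i) < N" if "i < n" for i
    using Suc.prems(1) that ab[of i] by (auto split: if_splits)
  define A where "A = (\<Sum>i<n. monom (c i) i)"
  define S where "S = (\<Sum>i<n. ev r (b i) * x ^ i)"
  have evA: "ev x A = (\<Sum>i<n. \<iota> (c i) * x ^ i)"
  proof (cases "n = 0")
    case False
    have "degree A < n" unfolding A_def using False
      by (intro degree_sum_less) (auto intro: le_less_trans[OF degree_monom_le])
    moreover have "coeff A i = (if i < n then c i else 0)" for i by (simp add: A_def coeff_sum)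
    ultimately show ?thesis by (simp add: ev_eq_sum_lessThan)
  qed (simp add: A_def)
  have rel: "ev x A + r * S = 0"
    using Suc.prems(2) unfolding ab evA S_def by (simp add: algebra_simps sum.distrib sum_distrib_left)
  \<comment> \<open>The ring \<open>k[x, 1/q]\<close>. It contains \<open>r\<close>, so a power of
    \<open>q\<close> clears the denominators of \<open>S\<close> and the relation becomes one
    between polynomials.\<close>
  define Z where "Z = {z. \<exists>m B. z * ev x q ^ m = ev x B}"
  have Zev: "ev x B \<in> Z" for B unfolding Z_def by (intro CollectI exI[of _ 0] exI[of _ B]) simp
  have Zmult: "z * w \<in> Z" if zw: "z \<in> Z" "w \<in> Z" for z w
  proof -
    obtain m B m' B' where *: "z * ev x q ^ m = ev x B" "w * ev x q ^ m' = ev x B'" using zw by (auto simp: Z_def)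
    have "z * w * ev x q ^ (m + m') = (z * ev x q ^ m) * (w * ev x q ^ m')" by (simp add: power_add)
    also have "\<dots> = ev x (B * B')" by (simp add: * ev_mult)
    finally show ?thesis unfolding Z_def by blast
  qed
  have Zadd: "z + w \<in> Z" if zw: "z \<in> Z" "w \<in> Z" for z w
  proof -
    obtain m B m' B' where *: "z * ev x q ^ m = ev x B" "w * ev x q ^ m' = ev x B'" using zw by (auto simp: Z_def)
    have "(z + w) * ev x q ^ (m + m')
        = (z * ev x q ^ m) * ev x q ^ m' + (w * ev x q ^ m') * ev x q ^ m"
      by (simp add: power_add algebra_simps)
    also have "\<dots> = ev x (B * q ^ m' + B' * q ^ m)" by (simp add: * ev_simps)
    finally show ?thesis unfolding Z_def by blast
  qed
  have Zr: "r \<in> Z" unfolding Z_def by (intro CollectI exI[of _ 1] exI[of _ p]) (simp add: r_q)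
  have "ev r B \<in> Z" for B
  proof (induction B)
    case 0
    show ?case using Zev[of 0] by simp
  next
    case (pCons e B)
    have "\<iota> e \<in> Z" using Zev[of "[:e:]"] by simp
    thus ?case using pCons Zadd Zmult Zr by simp
  qed
  hence bZ: "ev r (b i) * x ^ i \<in> Z" for i
    using Zmult Zev[of "[:0,1:] ^ i"] by (simp add: ev_power)
  have "sum g I \<in> Z" if "\<And>i. g i \<in> Z" for g and I :: "nat set"
    using Zev[of 0] Zadd that by (induction I rule: infinite_finite_induct) auto
  from this[OF bZ] have "S \<in> Z" unfolding S_def .
  then obtain m B where B: "S * ev x q ^ m = ev x B" by (auto simp: Z_def)
  have "ev x (A * q ^ Suc m + p * B) = (ev x A + r * S) * ev x q ^ Suc m"
    by (simp add: ev_simps algebra_simps flip: r_q B)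
  hence "A * q ^ Suc m + p * B = 0" using rel tr_ev[OF x] by simp
  hence "p dvd q ^ Suc m * A" by (metis add_eq_0_iff2 dvd_minus_iff dvd_triv_left mult.commute)
  hence pA: "p dvd A" using comaximal_dvd_mult[OF comaximal_power_right[OF cop]] by blast
  have "A = 0"
  proof (rule ccontr)
    assume "A \<noteq> 0"
    hence "n \<le> degree A" using pA dvd_imp_degree_le deg(1) by blast
    moreover have "degree A < n" unfolding A_def using deg(2)
      by (intro degree_sum_less) (auto intro: le_less_trans[OF degree_monom_le])
    ultimately show False by simp
  qed
  hence "c i = 0" if "i < n" for i
  proof -
    have "coeff A i = c i" using that by (simp add: A_def coeff_sum)
    thus ?thesis using \<open>A = 0\<close> by simp
  qed
  moreover have "r \<noteq> 0" using tr_ev[OF r_tr, of "[:0,1:]"] by simp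
  hence "S = 0" using rel \<open>A = 0\<close> by simp
  hence "\<forall>i<n. b i = 0" unfolding S_def using b by (intro Suc.IH) auto
  ultimately show ?case by (simp add: ab)
qed auto

lemma powers_independent:
  assumes c: "\<forall>i<n. c i \<in> K r" and sum: "(\<Sum>i<n. c i * x ^ i) = 0" and i: "i < n"
  shows "c i = 0"
proof -
  obtain d a where d: "d \<noteq> 0" "\<forall>i<n. c i * ev r d = ev r (a i)"
    using K_common_denominator[OF r_tr c] by blast
  have "(\<Sum>i<n. ev r (a i) * x ^ i) = (\<Sum>i<n. ev r d * (c i * x ^ i))"
    using d(2) by (intro sum.cong) (auto simp: mult_ac)
  also have "\<dots> = 0" using sum by (simp flip: sum_distrib_left)
  finally have 0: "(\<Sum>i<n. ev r (a i) * x ^ i) = 0" .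
  have "\<forall>i<n. a i = 0 \<or> degree (a i) < Suc (\<Sum>j<n. degree (a j))"
    by (auto simp: less_Suc_eq_le intro!: member_le_sum)
  from powers_independent_poly[OF this 0] have "c i * ev r d = 0" using d(2) i by simp
  thus ?thesis using d(1) tr_ev[OF r_tr] by simp
qed

text \<open>The span of \<open>1, ..., x^(n-1)\<close> over \<open>k(r)\<close>. It exhausts
  \<open>k(x)\<close> because it is closed under multiplication by \<open>x\<close> and, the field
  \<open>k\<close> being algebraically closed, under division by polynomials one linear factor at a
  time.\<close>

definition W where "W = {\<Sum>i<n. c i * x ^ i | c. \<forall>i<n. c i \<in> K r}"

lemma r_K: "r \<in> K r" by (simp add: subset_adjoin)

lemma W_I: "\<forall>i<n. c i \<in> K r \<Longrightarrow> (\<Sum>i<n. c i * x ^ i) \<in> W" unfolding W_def by blast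

lemma W_add: "z \<in> W \<Longrightarrow> w \<in> W \<Longrightarrow> z + w \<in> W"
proof -
  assume "z \<in> W" "w \<in> W"
  then obtain c d where "z = (\<Sum>i<n. c i * x ^ i)" "\<forall>i<n. c i \<in> K r"
    "w = (\<Sum>i<n. d i * x ^ i)" "\<forall>i<n. d i \<in> K r" unfolding W_def by blast
  thus ?thesis using W_I[of "\<lambda>i. c i + d i"] by (simp add: adjoin_closed algebra_simps sum.distrib)
qed

lemma W_scale: "s \<in> K r \<Longrightarrow> z \<in> W \<Longrightarrow> s * z \<in> W"
proof -
  assume s: "s \<in> K r" and "z \<in> W"
  then obtain c where "z = (\<Sum>i<n. c i * x ^ i)" "\<forall>i<n. c i \<in> K r" unfolding W_def by blast
  thus ?thesis using W_I[of "\<lambda>i. s * c i"] s by (simp add: adjoin_closed sum_distrib_left mult.assoc)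
qed

lemma W_power: "i < n \<Longrightarrow> x ^ i \<in> W"
proof -
  assume i: "i < n"
  have "(\<Sum>j<n. (if j = i then 1 else 0) * x ^ j) \<in> W" by (intro W_I) (auto simp: adjoin_closed)
  moreover have "(\<Sum>j<n. (if j = i then 1 else 0) * x ^ j) = x ^ i"
    using i by (simp add: if_distrib[of "\<lambda>z. z * _"] cong: if_cong)
  ultimately show ?thesis by simp
qed

lemma W_0: "0 \<in> W" using W_I[of "\<lambda>_. 0"] by (simp add: adjoin_closed)

lemma W_sum: "(\<And>i. i \<in> I \<Longrightarrow> f i \<in> W) \<Longrightarrow> sum f I \<in> W"
  by (induction I rule: infinite_finite_induct) (auto intro: W_add W_0)

text \<open>Solve \<open>p(x) = r q(x)\<close> for the leading term of \<open>p\<close>; since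
  \<open>deg q < n\<close>, all other terms already lie in \<open>W\<close>.\<close>

lemma W_x_power_n: "x ^ n \<in> W"
proof -
  define s where "s = (\<Sum>i<n. (r * \<iota> (coeff q i) - \<iota> (coeff p i)) * x ^ i)"
  have sW: "s \<in> W" unfolding s_def
    by (intro W_I allI impI adjoin_closed(4,7) range_subset_adjoin r_K)
  have "ev x p = \<iota> (coeff p n) * x ^ n + (\<Sum>i<n. \<iota> (coeff p i) * x ^ i)"
    unfolding ev_altdef deg(1) lessThan_Suc_atMost[symmetric] by (simp add: add.commute)
  moreover have "ev x q = (\<Sum>i<n. \<iota> (coeff q i) * x ^ i)" by (rule ev_eq_sum_lessThan[OF deg(2)])
  ultimately have "\<iota> (coeff p n) * x ^ n = s"
    using r_q by (simp add: s_def left_diff_distrib sum_subtractf sum_distrib_left mult.assoc eq_diff_eq)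
  moreover have cn: "coeff p n \<noteq> 0" using deg by (metis leading_coeff_0_iff degree_0 not_less0)
  ultimately have "x ^ n = \<iota> (inverse (coeff p n)) * s"
    by (metis \<iota>_inverse \<iota>_eq_0 left_inverse mult.assoc mult_1)
  thus ?thesis using W_scale[OF range_subset_adjoin sW] by simp
qed

lemma W_mult_x: "z \<in> W \<Longrightarrow> x * z \<in> W"
proof -
  assume "z \<in> W"
  then obtain c where c: "z = (\<Sum>i<n. c i * x ^ i)" "\<forall>i<n. c i \<in> K r" unfolding W_def by blast
  have "x * z = (\<Sum>i<n. c i * x ^ Suc i)" by (simp add: c(1) sum_distrib_left mult_ac)
  also have "\<dots> \<in> W"
  proof (intro W_sum W_scale)
    fix i assume "i \<in> {..<n}"
    thus "c i \<in> K r" using c(2) by simp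
    show "x ^ Suc i \<in> W" using W_power[of "Suc i"] W_x_power_n \<open>i \<in> {..<n}\<close> by (cases "Suc i = n") auto
  qed
  finally show ?thesis .
qed

lemma W_mult_ev: "z \<in> W \<Longrightarrow> ev x a * z \<in> W"
proof (induction a)
  case (pCons c a)
  have "ev x (pCons c a) * z = \<iota> c * z + x * (ev x a * z)" by (simp add: algebra_simps)
  thus ?case using pCons by (auto intro!: W_add W_scale W_mult_x range_subset_adjoin)
qed (simp add: W_0)

text \<open>Since \<open>p(x) = r q(x)\<close>, the element \<open>t = p(c) - r q(c)\<close> of
  \<open>k(r)\<close> is \<open>x - c\<close> times a polynomial expression in \<open>x\<close> and
  \<open>r\<close>. It is nonzero because \<open>p\<close> and \<open>q\<close> have no common root,
  so dividing by \<open>x - c\<close> amounts to multiplying by that expression and dividing by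
  \<open>t\<close>.\<close>

lemma W_divide_linear:
  assumes "z \<in> W" shows "z / (x - \<iota> c) \<in> W"
proof -
  define t where "t = \<iota> (poly p c) - r * \<iota> (poly q c)"
  have "t = ev r [:poly p c, - poly q c:]" by (simp add: t_def \<iota>_minus)
  moreover have "poly p c \<noteq> 0 \<or> poly q c \<noteq> 0" using comaximal_poly_nonzero[OF cop] by blast
  hence "[:poly p c, - poly q c:] \<noteq> 0" by auto
  hence "ev r [:poly p c, - poly q c:] \<noteq> 0" unfolding tr_ev[OF r_tr] .
  ultimately have t0: "t \<noteq> 0" by (simp only: not_False_eq_True)
  have tK: "t \<in> K r" unfolding t_def by (intro adjoin_closed(4,7) range_subset_adjoin subset_adjoin) simp
  have div: "\<exists>s'. ev x s = \<iota> (poly s c) + (x - \<iota> c) * ev x s'" for s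
  proof -
    have "[:-c, 1:] dvd s - [:poly s c:]" by (simp flip: poly_eq_0_iff_dvd)
    then obtain s' where "s - [:poly s c:] = [:-c, 1:] * s'" by (elim dvdE)
    hence "ev x (s - [:poly s c:]) = ev x ([:-c, 1:] * s')" by simp
    hence "ev x s - \<iota> (poly s c) = (x - \<iota> c) * ev x s'"
      unfolding ev_diff ev_mult by (simp add: \<iota>_minus)
    hence "ev x s = \<iota> (poly s c) + (x - \<iota> c) * ev x s'" by (simp add: algebra_simps)
    thus ?thesis by blast
  qed
  obtain p' where p': "ev x p = \<iota> (poly p c) + (x - \<iota> c) * ev x p'" using div by blast
  obtain q' where q': "ev x q = \<iota> (poly q c) + (x - \<iota> c) * ev x q'" using div by blast
  have xc: "x - \<iota> c \<noteq> 0" using tr_ev[OF x, of "[:-c, 1:]"] by (simp add: \<iota>_minus)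
  have "(x - \<iota> c) * (r * ev x q' - ev x p') = t"
    using r_q unfolding p' q' t_def by (simp add: algebra_simps)
  hence "inverse (x - \<iota> c) = inverse t * (r * ev x q' - ev x p')"
    using xc t0 by (metis inverse_mult_distrib inverse_unique left_inverse mult.assoc mult.commute mult_1)
  hence "z / (x - \<iota> c) = inverse t * (r * (ev x q' * z) + - 1 * (ev x p' * z))"
    unfolding divide_inverse by (simp only:) (simp add: algebra_simps)
  also have "\<dots> \<in> W"
    by (intro W_add W_scale[OF adjoin_closed(6)[OF tK]] W_scale[OF r_K] W_mult_ev assms
        W_scale[OF adjoin_closed(5)[OF adjoin_closed(2)]])
  finally show ?thesis .
qed

lemma W_divide_ev: "z \<in> W \<Longrightarrow> b \<noteq> 0 \<Longrightarrow> z / ev x b \<in> W"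
proof (induction "degree b" arbitrary: b z)
  case 0
  then obtain c where "b = [:c:]" by (auto elim: degree_eq_zeroE)
  hence "z / ev x b = \<iota> (inverse c) * z" by (simp add: \<iota>_inverse divide_inverse mult.commute)
  thus ?case using 0 by (auto intro!: W_scale range_subset_adjoin)
next
  case (Suc m)
  have "degree b > 0" using Suc(2) by simp
  then obtain e where "poly b e = 0" using alg_closed_imp_poly_has_root by blast
  then obtain b' where b': "b = [:-e, 1:] * b'" by (metis poly_eq_0_iff_dvd dvdE)
  hence b0: "b' \<noteq> 0" using Suc by auto
  have "degree b = Suc (degree b')" unfolding b' using b0 by (subst degree_mult_eq) auto
  hence m: "m = degree b'" using Suc(2) by simp
  have "z / ev x b = z / (x - \<iota> e) / ev x b'" unfolding b' ev_mult by (simp add: \<iota>_minus)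
  also have "\<dots> \<in> W" by (rule Suc(1)[OF m W_divide_linear[OF Suc(3)] b0])
  finally show ?case .
qed

lemma K_subset_W: "z \<in> K x \<Longrightarrow> z \<in> W"
proof -
  assume "z \<in> K x"
  then obtain a b where ab: "b \<noteq> 0" "z = ev x a / ev x b" using x by (elim K_E)
  have "1 \<in> W" using W_power[of 0] deg(2) by simp
  from W_divide_ev[OF W_mult_ev[OF this, of a] ab(1)] show ?thesis by (simp add: ab(2))
qed

end

section \<open>Isogenies of degree 3\<close>

lemma comaximal_add_mult: "u dvd 1 \<Longrightarrow> comaximal (u + l * s) l"
proof -
  assume "u dvd 1"
  then obtain v where v: "1 = u * v" by (elim dvdE)
  have "v * (u + l * s) + (- v * s) * l = u * v" by (simp add: algebra_simps)
  thus ?thesis unfolding comaximal_def v[symmetric] by blast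
qed

text \<open>
  Velu's formulas for the kernel \<open>{O, (a, \<plusminus> sqrt A6)}\<close>, up to affine changes of coordinates.
\<close>
lemma three_isogeny_normal_form_imp_map:
  fixes a2 a4 a6 b2 b4 b6 :: "'k::{alg_closed_field, field_char_0}"
  assumes "three_isogeny_normal_form a2 a4 a6 b2 b4 b6"
  obtains p q g where "comaximal p q" "degree p = 3" "degree q < 3" "q \<noteq> 0" "g \<noteq> 0"
    "[:a6, a4, a2, 1:] * g^2 = cubic_form b2 b4 b6 p q"
proof -
  obtain a k r A2 A4 A6 where k: "k \<noteq> 0" "A6 \<noteq> 0" "A4^2 = 4*A2*A6"
    and A: "A2 = 3*a + a2" "A4 = 3*a^2 + 2*a2*a + a4" "A6 = a^3 + a2*a^2 + a4*a + a6"
    and B: "3*r + b2 = k * A2" "3*r^2 + 2*b2*r + b4 = k^2 * (-9*A4)"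
      "r^3 + b2*r^2 + b4*r + b6 = k^3 * (-27*A6 - 8*A2*A4)"
    using assms unfolding three_isogeny_normal_form_def by blast
  \<comment> \<open>Scaling the abscissa by \<open>k\<close> multiplies the cubic by
    \<open>k^3\<close>, so \<open>y\<close> is scaled by a square root of
    \<open>k^3\<close>.\<close>
  obtain m where m: "m^2 = k^3" using nth_root_exists[of 2] by auto
  have m0: "m \<noteq> 0" using m k(1) by auto
  define L where "L = [:-a, 1:]"
  define c2 c4 c6 where "c2 = [:A2:]" and "c4 = [:A4:]" and "c6 = [:A6:]"
  \<comment> \<open>\<open>N / L^2\<close> is the abscissa \<open>L + 2 A4 / L + 4 A6 / L^2\<close>
    of the image, and \<open>w / L^3\<close> is its derivative: the image of \<open>y\<close> is
    \<open>y\<close> times this derivative because the invariant differential is preserved.\<close>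
  define N where "N = L^3 + 2 * c4 * L + 4 * c6"
  define w where "w = L^3 - 2 * c4 * L - 8 * c6"
  define p where "p = [:k:] * N + [:r:] * L^2"
  have L: "L \<noteq> 0" "degree L = 1" by (simp_all add: L_def)
  have numeral: "numeral n * [:c:] = [:numeral n * c:]" for n and c :: 'k
    by (simp add: numeral_poly)
  have f: "[:a6, a4, a2, 1:] = L^3 + c2 * L^2 + c4 * L + c6"
    unfolding L_def c2_def c4_def c6_def A by (simp add: power2_eq_square power3_eq_cube algebra_simps)
  have "[:A4^2:] = [:4*A2*A6:]" by (simp only: k(3))
  hence rel: "c4^2 = 4 * c2 * c6"
    unfolding c2_def c4_def c6_def by (simp add: power2_eq_square numeral_poly mult_ac)
  have id: "(L^3 + c2 * L^2 + c4 * L + c6) * w^2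
      = N^3 + c2 * N^2 * L^2 - 9 * c4 * N * L^4 - (27 * c6 + 8 * c2 * c4) * L^6"
    unfolding N_def w_def using rel by algebra
  have B': "3 * [:r:] + [:b2:] = [:k:] * c2" "3 * [:r:]^2 + 2 * [:b2:] * [:r:] + [:b4:] = [:k:]^2 * (- 9 * c4)"
    "[:r:]^3 + [:b2:] * [:r:]^2 + [:b4:] * [:r:] + [:b6:] = [:k:]^3 * (- 27 * c6 - 8 * c2 * c4)"
    using B unfolding c2_def c4_def c6_def
    by (simp_all add: power2_eq_square power3_eq_cube numeral_poly mult_ac)
  have m': "[:m:]^2 = [:k:]^3" using m by (simp add: power2_eq_square power3_eq_cube)
  have "p^3 + [:b2:] * p^2 * L^2 + [:b4:] * p * (L^2)^2 + [:b6:] * (L^2)^3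
      = [:k:]^3 * (N^3 + c2 * N^2 * L^2 - 9 * c4 * N * L^4 - (27 * c6 + 8 * c2 * c4) * L^6)"
    unfolding p_def using B' by algebra
  also have "\<dots> = [:a6, a4, a2, 1:] * ([:m:] * w)^2" unfolding id[symmetric] f power_mult_distrib m' by (simp only: mult_ac)
  finally have "[:a6, a4, a2, 1:] * (L * ([:m:] * w))^2 = cubic_form b2 b4 b6 p (L^2)"
    unfolding cubic_form_def by (simp only: power_mult_distrib mult_ac)
  moreover have "comaximal p (L^2)"
  proof (rule comaximal_power_right)
    \<comment> \<open>Modulo \<open>L\<close> the numerator is the constant \<open>4 k A6\<close>,
      nonzero because the kernel points do not have order two.\<close>
    have "p = [:4 * k * A6:] + L * ([:k:] * (L^2 + 2 * c4) + [:r:] * L)"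
      unfolding p_def N_def c6_def by (simp add: numeral_poly power2_eq_square power3_eq_cube algebra_simps)
    moreover have "[:4 * k * A6:] dvd 1" using k by (simp add: is_unit_iff_degree)
    ultimately show "comaximal p L" by (simp only: comaximal_add_mult)
  qed
  moreover have dw: "degree w = 3" "w \<noteq> 0" "degree p = 3"
  proof -
    have "w = [:(2*A4*a - 8*A6 - a^3), 3*a^2 - 2*A4, - (3*a), 1:]"
      unfolding w_def L_def c4_def c6_def
      by (simp add: numeral_poly power2_eq_square power3_eq_cube algebra_simps)
    thus "degree w = 3" "w \<noteq> 0" by simp_all
    have "p = [:k * (4*A6 - 2*A4*a - a^3) + r*a^2, k * (3*a^2 + 2*A4) - 2*r*a, r - 3*k*a, k:]"
      unfolding p_def N_def L_def c4_def c6_def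
      by (simp add: numeral_poly power2_eq_square power3_eq_cube algebra_simps)
    thus "degree p = 3" using k(1) by simp
  qed
  moreover have "degree (L^2) < 3" "L^2 \<noteq> 0" using L by (simp_all add: degree_power_eq)
  moreover have "L * ([:m:] * w) \<noteq> 0" using L dw m0 by simp
  ultimately show ?thesis using that by blast
qed

context rational_map
begin

text \<open>The large field is \<open>k(x) + k(x) y\<close> and the small one is
  \<open>k(r) + k(r) g y\<close>. Dividing the coefficient of \<open>y\<close> by \<open>g\<close>
  reduces both spanning and independence to the powers of \<open>x\<close> over
  \<open>k(r)\<close>.\<close>

lemma has_degree_rational_map:
  assumes y: "y^2 = ev x f" "odd (degree f)" and g: "g \<in> K x" "g \<noteq> 0"
    and y': "(g * y)^2 = ev r f'"
  shows "has_degree (adjoin \<iota> {x, y}) (adjoin \<iota> {r, g * y}) n"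
proof -
  let ?E = "adjoin \<iota> {x, y}" and ?F = "adjoin \<iota> {r, g * y}"
  have xy: "x \<in> ?E" "y \<in> ?E" by (simp_all add: subset_adjoin)
  have KE: "K x \<subseteq> ?E" using xy(1) by (rule K_subset)
  have rK: "r \<in> K x" unfolding r by (intro adjoin_closed(8) ev_K)
  have KK: "K r \<subseteq> K x" using rK by (rule K_subset)
  have F: "z \<in> ?F \<longleftrightarrow> (\<exists>A\<in>K r. \<exists>B\<in>K r. z = A + B * (g * y))" for z
    by (rule adjoin_pair_iff[OF r_tr y'])
  have FE: "?F \<subseteq> ?E"
    using rK g(1) KE xy by (intro adjoin_least is_subfield_adjoin) (auto intro: range_subset_adjoin adjoin_closed(4))
  have sumK: "(\<Sum>i<n. P i * x ^ i) \<in> K x" if "\<forall>i<n. P i \<in> K r" for P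
    using that KK by (intro is_subfield_sum is_subfield_adjoin adjoin_closed(4,9)) (auto simp: subset_adjoin)
  have indep: "\<forall>i<n. c i = 0" if c: "\<forall>i<n. c i \<in> ?F" "(\<Sum>i<n. c i * x ^ i) = 0" for c
  proof -
    have "\<forall>i. \<exists>P Q. i < n \<longrightarrow> P \<in> K r \<and> Q \<in> K r \<and> c i = P + Q * (g * y)" using c(1) F by blast
    then obtain P Q where PQ: "\<And>i. i < n \<Longrightarrow> P i \<in> K r" "\<And>i. i < n \<Longrightarrow> Q i \<in> K r"
      "\<And>i. i < n \<Longrightarrow> c i = P i + Q i * (g * y)" by metis
    have "0 = (\<Sum>i<n. P i * x ^ i) + (\<Sum>i<n. Q i * x ^ i) * g * y"
      unfolding c(2)[symmetric] by (simp add: PQ(3) sum_distrib_left sum_distrib_right distrib_right distrib_left sum.distrib mult_ac)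
    hence "(\<Sum>i<n. P i * x ^ i) = 0 \<and> (\<Sum>i<n. Q i * x ^ i) * g = 0"
      using PQ(1,2) g(1) by (intro pair_independent[OF x y] adjoin_closed(4) sumK) auto
    hence "(\<Sum>i<n. P i * x ^ i) = 0" "(\<Sum>i<n. Q i * x ^ i) = 0" using g(2) by auto
    hence "P i = 0" "Q i = 0" if "i < n" for i using powers_independent PQ(1,2) that by blast+
    thus ?thesis by (simp add: PQ(3))
  qed
  have span: "\<exists>c. (\<forall>i<n. c i \<in> ?F) \<and> (\<forall>i\<ge>n. c i = 0) \<and> z = (\<Sum>i<n. c i * x ^ i)" if z: "z \<in> ?E" for z
  proof -
    obtain A B where AB: "A \<in> K x" "B \<in> K x" "z = A + B * y"
      using z unfolding adjoin_pair_iff[OF x y(1)] by blast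
    have "B / g \<in> K x" using AB(2) g(1) by (rule adjoin_closed(8))
    then obtain Q where Q: "B / g = (\<Sum>i<n. Q i * x ^ i)" "\<forall>i<n. Q i \<in> K r"
      using K_subset_W unfolding W_def by blast
    obtain P where P: "A = (\<Sum>i<n. P i * x ^ i)" "\<forall>i<n. P i \<in> K r"
      using K_subset_W[OF AB(1)] unfolding W_def by blast
    define c where "c i = (if i < n then P i + Q i * (g * y) else 0)" for i
    have "z = A + (B / g) * (g * y)" using AB(3) g(2) by simp
    also have "\<dots> = (\<Sum>i<n. c i * x ^ i)"
      unfolding P(1) Q(1) by (simp add: c_def sum_distrib_left sum_distrib_right distrib_right distrib_left sum.distrib mult_ac)
    finally have "z = (\<Sum>i<n. c i * x ^ i)" .
    moreover have "\<forall>i<n. c i \<in> ?F" using P(2) Q(2) F by (auto simp: c_def)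
    moreover have "\<forall>i\<ge>n. c i = 0" by (simp add: c_def)
    ultimately show ?thesis by blast
  qed
  have "\<exists>!c. (\<forall>i<n. c i \<in> ?F) \<and> (\<forall>i\<ge>n. c i = 0) \<and> z = (\<Sum>i<n. c i * x ^ i)" if z: "z \<in> ?E" for z
  proof (rule ex_ex1I[OF span[OF z]])
    fix c d assume c: "(\<forall>i<n. c i \<in> ?F) \<and> (\<forall>i\<ge>n. c i = 0) \<and> z = (\<Sum>i<n. c i * x ^ i)"
      and d: "(\<forall>i<n. d i \<in> ?F) \<and> (\<forall>i\<ge>n. d i = 0) \<and> z = (\<Sum>i<n. d i * x ^ i)"
    have "(\<Sum>i<n. (c i - d i) * x ^ i) = (\<Sum>i<n. c i * x ^ i) - (\<Sum>i<n. d i * x ^ i)"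
      by (simp add: left_diff_distrib sum_subtractf)
    also have "\<dots> = z - z" using c d by metis
    finally have "(\<Sum>i<n. (c i - d i) * x ^ i) = 0" by simp
    moreover have "\<forall>i<n. c i - d i \<in> ?F" using c d by (simp add: adjoin_closed(7))
    ultimately have "\<forall>i<n. c i - d i = 0" by (intro indep)
    hence "c i = d i" for i using c d by (cases "i < n") auto
    thus "c = d" by (rule ext)
  qed
  thus ?thesis unfolding has_degree_def using FE xy(1)
    by (intro conjI exI[of _ "\<lambda>i. x ^ i"]) (auto intro: adjoin_closed(9))
qed

end

context field_embedding_alg_closed
begin

lemma three_isogeny_imp_normal_form:
  assumes c1: "x \<notin> O1" "y^2 = ev x [:a6, a4, a2, 1:]" "E1 = adjoin \<iota> {x, y}" and O1: "is_point \<iota> E1 O1"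
    and c2: "x2 \<notin> O2" "y2^2 = ev x2 [:b6, b4, b2, 1:]" "E2 = adjoin \<iota> {x2, y2}"
    and D: "cubic_disc a2 a4 a6 \<noteq> 0" "cubic_disc b2 b4 b6 \<noteq> 0"
    and iso: "exists_isogeny_of_degree \<iota> (E1, O1) (E2, O2) 3"
  shows "three_isogeny_normal_form a2 a4 a6 b2 b4 b6"
proof -
  obtain \<phi> where \<phi>: "field_hom_on E2 \<phi>" "\<And>a. \<phi> (\<iota> a) = \<iota> a" "\<phi> ` E2 \<subseteq> E1" "{z\<in>E2. \<phi> z \<in> O1} = O2"
    and deg3: "has_degree E1 (\<phi> ` E2) 3"
    using iso unfolding exists_isogeny_of_degree_def is_isogeny_def by auto
  have E1: "is_subfield E1" "x \<in> E1" and E2: "is_subfield E2" "x2 \<in> E2" "y2 \<in> E2" "range \<iota> \<subseteq> E2"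
    unfolding c1(3) c2(3) by (auto simp: is_subfield_adjoin subset_adjoin range_subset_adjoin)
  define r where "r = \<phi> x2"
  define y' where "y' = \<phi> y2"
  have rE: "r \<in> E1" "y' \<in> E1" using \<phi>(3) E2 by (auto simp: r_def y'_def)
  have rO: "r \<notin> O1" using \<phi>(4) c2(1) E2(2) by (auto simp: r_def)
  have y'2: "y'^2 = ev r [:b6, b4, b2, 1:]"
  proof -
    have "y'^2 = \<phi> (y2^2)" unfolding y'_def using field_hom_onD(7)[OF \<phi>(1) E2(1) E2(3)] by simp
    also have "\<dots> = ev r [:b6, b4, b2, 1:]"
      unfolding c2(2) r_def by (rule hom_ev[OF \<phi>(1,2) E2(1,4,2)])
    finally show ?thesis .
  qed
  interpret place_at_infinity \<iota> E1 O1 x by unfold_locales (use E1 O1 c1(1) in auto)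
  interpret R: place_at_infinity \<iota> E1 O1 r by unfold_locales (use rE rO in auto)
  have odd: "odd (degree [:a6, a4, a2, 1:])" by simp
  obtain g where g: "r \<in> K x" "g \<in> K x" "y' = g * y"
    using pole_preserving_map_even[OF c1(2) odd c1(3) O1 c1(1) rE rO y'2 D(2)] by blast
  obtain p q where pq: "q \<noteq> 0" "comaximal p q" "r = ev x p / ev x q"
    using x_tr g(1) by (rule K_reduced_fraction)
  \<comment> \<open>The pole of \<open>r\<close> at the origin becomes a strict inequality of
    degrees.\<close>
  have dpq: "degree q < degree p" using rO fraction_V_iff(1)[OF pq(1), of p] unfolding pq(3) by auto
  interpret rational_map \<iota> x r p q "degree p"
    by unfold_locales (use x_tr R.x_tr pq dpq in auto)
  have g0: "g \<noteq> 0"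
  proof
    assume "g = 0"
    hence "ev r [:b6, b4, b2, 1:] = 0" using y'2 g(3) by simp
    thus False by (simp only: tr_ev[OF R.x_tr]) simp
  qed
  have gy: "(g * y)^2 = ev r [:b6, b4, b2, 1:]" using y'2 g(3) by simp
  have "\<phi> ` E2 = adjoin \<iota> {r, g * y}"
    using hom_image_adjoin[of "{x2, y2}" \<phi>] \<phi>(1,2) g(3) unfolding c2(3) by (simp add: r_def y'_def)
  moreover have "has_degree E1 (adjoin \<iota> {r, g * y}) (degree p)"
    unfolding c1(3) by (rule has_degree_rational_map[OF c1(2) odd g(2) g0 gy])
  ultimately have n: "degree p = 3"
    using has_degree_unique[OF is_subfield_adjoin] deg3 by metis
  obtain a b where ab: "b \<noteq> 0" "g = ev x a / ev x b" using x_tr g(2) by (rule K_E)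
  have evb: "ev x b \<noteq> 0" using ab(1) by (simp add: tr_ev[OF x_tr])
  have ga: "ev x a = g * ev x b" using evb by (simp add: ab(2))
  let ?F = "cubic_form b2 b4 b6 p q"
  have "ev x ([:a6, a4, a2, 1:] * (a * q^2)^2) = ev x (b^2 * ?F)"
    unfolding ev_mult ev_power ev_cubic_form[OF ev_q] pq(3)[symmetric] gy[symmetric] ga c1(2)[symmetric]
    by (simp add: power_mult_distrib power2_eq_square power4_eq_xxxx mult_ac)
  hence "ev x ([:a6, a4, a2, 1:] * (a * q^2)^2 - b^2 * ?F) = 0" unfolding ev_diff by simp
  hence "[:a6, a4, a2, 1:] * (a * q^2)^2 = b^2 * ?F" unfolding tr_ev[OF x_tr] by simp
  thus ?thesis using ab(1) pq(2) n dpq pq(1) D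
    by (intro three_isogeny_normal_form_of_map[of a6 a4 a2 a q b]) auto
qed

lemma normal_form_imp_three_isogeny:
  assumes c1: "x \<notin> O1" "y^2 = ev x [:a6, a4, a2, 1:]" "E1 = adjoin \<iota> {x, y}" and O1: "is_point \<iota> E1 O1"
    and c2: "x2 \<notin> O2" "y2^2 = ev x2 [:b6, b4, b2, 1:]" "E2 = adjoin \<iota> {x2, y2}" and O2: "is_point \<iota> E2 O2"
    and nf: "three_isogeny_normal_form a2 a4 a6 b2 b4 b6"
  shows "exists_isogeny_of_degree \<iota> (E1, O1) (E2, O2) 3"
proof -
  let ?f2 = "[:b6, b4, b2, 1:]"
  have odd: "odd (degree [:a6, a4, a2, 1:])" "odd (degree ?f2)" by simp_all
  have E1: "is_subfield E1" "x \<in> E1" "y \<in> E1" "K x \<subseteq> E1" and E2: "is_subfield E2" "x2 \<in> E2"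
    unfolding c1(3) c2(3) by (auto simp: is_subfield_adjoin subset_adjoin intro: K_subset[THEN subsetD, rotated])
  interpret place_at_infinity \<iota> E1 O1 x by unfold_locales (use E1 O1 c1(1) in auto)
  interpret P2: place_at_infinity \<iota> E2 O2 x2 by unfold_locales (use E2 O2 c2(1) in auto)
  obtain p q h where pq: "comaximal p q" "degree p = 3" "degree q < 3" "q \<noteq> 0" "h \<noteq> 0"
    "[:a6, a4, a2, 1:] * h^2 = cubic_form b2 b4 b6 p q"
    using nf by (rule three_isogeny_normal_form_imp_map)
  define r where "r = ev x p / ev x q"
  define g where "g = ev x h / ev x (q^2)"
  have rK: "r \<in> K x" "g \<in> K x" unfolding r_def g_def by (intro adjoin_closed(8) ev_K)+
  have g0: "g \<noteq> 0" unfolding g_def using pq(4,5) by (simp add: tr_ev[OF x_tr])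
  have evq: "ev x q \<noteq> 0" using pq(4) by (simp add: tr_ev[OF x_tr])
  have rE: "r \<in> E1" "g * y \<in> E1" using rK E1 E_closed(4) by auto
  have "p \<noteq> 0" using pq(2) by auto
  hence rO: "r \<notin> O1" using fraction_V_iff(1)[OF pq(4), of p] pq(2,3) by (simp add: r_def)
  interpret R: place_at_infinity \<iota> E1 O1 r by unfold_locales (use rE rO in auto)
  interpret rational_map \<iota> x r p q 3
    by unfold_locales (use x_tr R.x_tr r_def pq in auto)
  have "ev x q ^ 4 * (g * y)^2 = ev x ([:a6, a4, a2, 1:] * h^2)"
    unfolding g_def ev_mult ev_power c1(2)[symmetric] using evq
    by (simp add: power_mult_distrib power_divide flip: power_mult)
  also have "\<dots> = ev x q ^ 4 * ev r ?f2" unfolding pq(6) ev_cubic_form[OF evq] r_def ..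
  finally have gy: "(g * y)^2 = ev r ?f2" using evq by simp
  obtain \<phi> where \<phi>: "field_hom_on (adjoin \<iota> {x2, y2}) \<phi>" "\<And>c. \<phi> (\<iota> c) = \<iota> c" "\<phi> x2 = r" "\<phi> y2 = g * y"
    using hom_extension[OF P2.x_tr c2(2) odd(2) R.x_tr gy] by blast
  have \<phi>E2: "field_hom_on E2 \<phi>" using \<phi>(1) by (simp add: c2(3))
  have image: "\<phi> ` E2 = adjoin \<iota> {r, g * y}"
    unfolding c2(3) hom_image_adjoin[OF \<phi>(1,2)] by (simp add: \<phi>(3,4))
  have sub: "\<phi> ` E2 \<subseteq> E1"
    unfolding image using rE \<iota>_E by (intro adjoin_least E1(1)) auto
  \<comment> \<open>The image of the origin \<open>O1\<close>. It is a point of the second curve at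
    which \<open>x2\<close> has a pole, and there is only one such point, \<open>O2\<close>.\<close>
  define V where "V = {z\<in>E2. \<phi> z \<in> O1}"
  note \<phi>D = field_hom_onD[OF \<phi>E2 E2(1)]
  have "is_point \<iota> E2 V" unfolding is_point_def
  proof (intro conjI ballI)
    have "range \<iota> \<subseteq> V" using P2.\<iota>_E V_\<iota> by (auto simp: V_def \<phi>(2))
    \<comment> \<open>A nonconstant element, needed because \<open>is_point\<close> asks for a
      proper inclusion of the constants.\<close>
    moreover have "inverse x2 \<in> V"
      using P2.E_closed(6)[OF E2(2)] M_V[OF R.inverse_x_M] by (simp add: V_def \<phi>D(6)[OF E2(2)] \<phi>(3))
    moreover have "inverse x2 \<notin> range \<iota>"
    proof
      assume "inverse x2 \<in> range \<iota>"
      then obtain c where "inverse x2 = \<iota> c" by auto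
      hence "x2 = \<iota> (inverse c)" unfolding \<iota>_inverse by (metis inverse_inverse_eq)
      thus False using c2(1) P2.V_\<iota> by simp
    qed
    ultimately show "range \<iota> \<subset> V" by blast
    have "x2 \<notin> V" using rO by (simp add: V_def \<phi>(3))
    thus "V \<subset> E2" using E2(2) by (auto simp: V_def)
    fix a b assume ab: "a \<in> V" "b \<in> V"
    thus "a + b \<in> V" "a - b \<in> V" "a * b \<in> V"
      using P2.E_closed(3,4,7) V_add V_diff V_mult by (auto simp: V_def \<phi>D)
  next
    fix z assume z: "z \<in> E2"
    show "z \<in> V \<or> inverse z \<in> V"
      using z sub V_total[of "\<phi> z"] P2.E_closed(6)[OF z] by (auto simp: V_def \<phi>D(6)[OF z])
  qed
  moreover have "x2 \<notin> V" using rO by (simp add: V_def \<phi>(3))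
  ultimately have "V = O2" using place_at_infinity_unique[OF c2(2) odd(2) c2(3) _ _ O2 c2(1)] by blast
  hence "is_isogeny \<iota> (E1, O1) (E2, O2) \<phi>"
    unfolding is_isogeny_def using \<phi>E2 \<phi>(2) sub by (simp add: V_def)
  moreover have "has_degree E1 (\<phi> ` E2) 3"
    unfolding c1(3) image by (rule has_degree_rational_map[OF c1(2) odd(1) rK(2) g0 gy])
  ultimately show ?thesis unfolding exists_isogeny_of_degree_def by auto
qed

text \<open>Moving the origins to infinity changes the generators but keeps all coefficients of both
  cubics, so one condition on coefficients serves every choice of origins.\<close>

theorem exists_three_isogeny_iff:
  assumes x: "tr x" "y^2 = ev x [:a6, a4, a2, 1:]" and x2: "tr x2" "y2^2 = ev x2 [:b6, b4, b2, 1:]"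
    and O1: "is_point \<iota> (adjoin \<iota> {x, y}) O1" and O2: "is_point \<iota> (adjoin \<iota> {x2, y2}) O2"
    and D: "cubic_disc a2 a4 a6 \<noteq> 0" "cubic_disc b2 b4 b6 \<noteq> 0"
  shows "exists_isogeny_of_degree \<iota> (adjoin \<iota> {x, y}, O1) (adjoin \<iota> {x2, y2}, O2) 3
    \<longleftrightarrow> three_isogeny_normal_form a2 a4 a6 b2 b4 b6"
proof -
  obtain x' y' where c1: "x' \<notin> O1" "y'^2 = ev x' [:a6, a4, a2, 1:]" "adjoin \<iota> {x, y} = adjoin \<iota> {x', y'}"
    using exists_coordinates_with_pole[OF x refl O1 D(1)] .
  obtain x2' y2' where c2: "x2' \<notin> O2" "y2'^2 = ev x2' [:b6, b4, b2, 1:]"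
    "adjoin \<iota> {x2, y2} = adjoin \<iota> {x2', y2'}"
    using exists_coordinates_with_pole[OF x2 refl O2 D(2)] .
  show ?thesis
    using three_isogeny_imp_normal_form[OF c1 O1 c2 D] normal_form_imp_three_isogeny[OF c1 O1 c2 O2] by blast
qed

end

theorem mainTheorem4:
  fixes s1 s2 u v :: "'k::{alg_closed_field, field_char_0}"
    and \<iota> :: "'k \<Rightarrow> 'a::field" and X Y :: 'a
    and E1 E2 O1 O2 :: "'a set"
  assumes disc: "27 - 18*s1*s2 - s1^2*s2^2 + 4*s1^3 + 4*s2^3 \<noteq> 0"
    and embed: "field_hom_on UNIV \<iota>"
    and X_trans: "transcendental_over \<iota> X"
    and curve: "Y^2 = X^6 - \<iota> s1 * X^4 + \<iota> s2 * X^2 - 1"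
    and K: "adjoin \<iota> {X, Y} = UNIV"
    and E1: "E1 = adjoin \<iota> {X^2, Y}"
    and E2: "E2 = adjoin \<iota> {X^2, X*Y}"
    and O1: "is_point \<iota> E1 O1"
    and O2: "is_point \<iota> E2 O2"
    and u: "u = s1 * s2"
    and v: "v = s1^3 + s2^3"
  shows "exists_isogeny_of_degree \<iota> (E1, O1) (E2, O2) 3 \<longleftrightarrow>
           (4*v - u^2 + 110*u - 1125) * g1 u v * g2 u v = 0"
proof -
  interpret field_embedding_alg_closed \<iota> by unfold_locales (rule embed)
  have X0: "X \<noteq> 0" using tr_ev[OF X_trans, of "[:0,1:]"] by simp
  have compose: "ev (X^2) p = ev X (pcompose p [:0,0,1:])" for p
    by (induction p) (simp_all add: pcompose_pCons ev_simps power2_eq_square)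
  have x1: "tr (X^2)" unfolding transcendental_over_def
  proof (intro allI impI)
    fix p :: "'k poly" assume "p \<noteq> 0"
    hence "pcompose p [:0,0,1:] \<noteq> 0" by (simp add: pcompose_eq_0_iff)
    thus "poly (map_poly \<iota> p) (X^2) \<noteq> 0" using compose[of p] tr_ev[OF X_trans] by (simp add: ev_def)
  qed
  have y1: "Y^2 = ev (X^2) [:-1, s2, -s1, 1:]"
    unfolding curve by (simp add: \<iota>_minus algebra_simps flip: power_add)
  \<comment> \<open>Reversing \<open>t^3 - s1 t^2 + s2 t - 1\<close> produces the leading
    coefficient -1, which a square root of -1 in the ordinate makes 1.\<close>
  obtain m where m: "m^2 = (-1::'k)" using nth_root_exists[of 2] by auto
  hence m0: "m \<noteq> 0" by auto
  define x2 where "x2 = inverse (X^2)"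
  \<comment> \<open>This is \<open>m Y / X^3\<close>, written so that its membership in
    \<open>E2\<close> is visible.\<close>
  define y2 where "y2 = \<iota> m * (X * Y) * x2^2"
  have inv: "X^2 * x2 = 1" using X0 by (simp add: x2_def)
  \<comment> \<open>A relation for \<open>1 / X^2\<close> becomes one for \<open>X^2\<close> when
    the coefficients are reversed.\<close>
  have x2: "tr x2" unfolding transcendental_over_def
  proof (intro allI impI notI)
    fix p :: "'k poly" assume p: "p \<noteq> 0" "poly (map_poly \<iota> p) x2 = 0"
    have deg: "degree (map_poly \<iota> p) = degree p" by (rule degree_map_poly) simp
    have "map_poly \<iota> (reflect_poly p) = reflect_poly (map_poly \<iota> p)"
      by (intro poly_eqI) (simp add: coeff_map_poly coeff_reflect_poly deg)
    moreover have "X^2 \<noteq> 0" using X0 by simp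
    ultimately have "ev (X^2) (reflect_poly p) = (X^2) ^ degree p * ev x2 p"
      unfolding ev_def x2_def using poly_reflect_poly_nz[of "X^2" "map_poly \<iota> p"] by (simp add: deg)
    hence "ev (X^2) (reflect_poly p) = 0" using p(2) by (simp add: ev_def)
    thus False using p(1) by (simp add: tr_ev[OF x1])
  qed
  have y2: "y2^2 = ev x2 [:-1, s1, -s2, 1:]"
  proof -
    define t where "t = X^2"
    have t: "t * x2 = 1" using inv by (simp add: t_def)
    have "y2^2 = \<iota> (m^2) * t * Y^2 * x2^4"
      by (simp add: y2_def t_def \<iota>_power power_mult_distrib flip: power_mult)
    also have "Y^2 = t^3 - \<iota> s1 * t^2 + \<iota> s2 * t - 1"
      unfolding curve t_def by (simp flip: power_mult)
    also have "\<iota> (m^2) * t * \<dots> * x2^4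
        = - ((t*x2)^4 - \<iota> s1 * (t*x2)^3 * x2 + \<iota> s2 * (t*x2)^2 * x2^2 - (t*x2) * x2^3)"
      unfolding m by (simp add: \<iota>_minus algebra_simps power2_eq_square power3_eq_cube power4_eq_xxxx)
    also have "\<dots> = ev x2 [:-1, s1, -s2, 1:]"
      unfolding t by (simp add: \<iota>_minus algebra_simps power2_eq_square power3_eq_cube)
    finally show ?thesis .
  qed
  have E2': "E2 = adjoin \<iota> {x2, y2}"
  proof
    have *: "X^2 \<in> E2" "X * Y \<in> E2" unfolding E2 by (simp_all add: subset_adjoin)
    hence "x2 \<in> E2" unfolding x2_def E2 by (intro adjoin_closed(6))
    moreover from this * have "y2 \<in> E2"
      unfolding y2_def E2 by (simp only: adjoin_closed(4,9) range_subset_adjoin)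
    ultimately show "adjoin \<iota> {x2, y2} \<subseteq> E2"
      unfolding E2 by (intro adjoin_least is_subfield_adjoin) (auto intro: range_subset_adjoin)
    have **: "x2 \<in> adjoin \<iota> {x2, y2}" "y2 \<in> adjoin \<iota> {x2, y2}" by (simp_all add: subset_adjoin)
    have "X^2 = inverse x2" by (simp add: x2_def)
    hence X2: "X^2 \<in> adjoin \<iota> {x2, y2}" using **(1) by (simp only: adjoin_closed(6))
    have "X * Y = \<iota> (inverse m) * y2 * (X^2)^2"
    proof -
      have "\<iota> (inverse m) * y2 * (X^2)^2 = \<iota> (inverse m * m) * (X * Y) * (X^2 * x2)^2"
        unfolding y2_def by (simp only: \<iota>_mult power_mult_distrib mult_ac)
      thus ?thesis using m0 by (simp add: inv)
    qed
    hence "X * Y \<in> adjoin \<iota> {x2, y2}"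
      using **(2) X2 by (simp only: adjoin_closed(4,9) range_subset_adjoin)
    thus "E2 \<subseteq> adjoin \<iota> {x2, y2}"
      unfolding E2 using X2 by (intro adjoin_least is_subfield_adjoin) (auto intro: range_subset_adjoin)
  qed
  have "cubic_disc (-s1) s2 (-1) = - (27 - 18*s1*s2 - s1^2*s2^2 + 4*s1^3 + 4*s2^3)"
    "cubic_disc (-s2) s1 (-1) = - (27 - 18*s1*s2 - s1^2*s2^2 + 4*s1^3 + 4*s2^3)"
    unfolding cubic_disc_def by algebra+
  hence D: "cubic_disc (-s1) s2 (-1) \<noteq> 0" "cubic_disc (-s2) s1 (-1) \<noteq> 0"
    using disc by (simp_all only: neg_equal_0_iff_equal not_False_eq_True)
  show ?thesis
    using exists_three_isogeny_iff[OF x1 y1 x2 y2 _ _ D] O1 O2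
      three_isogeny_normal_form_iff_factors[OF disc u v] unfolding E1 E2' by simp
qed

end
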